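(* Let $\mathscr A$ be a $C^*$-algebra, let $\mathscr E$ be a Hilbert $C^*$-module over $\mathscr A$, and let $\mathscr H$ and $\mathscr K$ be closed submodules of $\mathscr E$. Then the following statements are equivalent: (i) The pair $(\mathscr H,\mathscr K)$ is concordant. (ii) For every state $f$ on $\mathscr A$, $(\mathscr H\cap\mathscr K)_f=\big((\mathscr H^\perp)_f\big)^\perp\cap\big((\mathscr K^\perp)_f\big)^\perp$. (iii) For every pure state $f$ on $\mathscr A$, $(\mathscr H\cap\mathscr K)_f=\big((\mathscr H^\perp)_f\big)^\perp\cap\big((\mathscr K^\perp)_f\big)^\perp$.
   Context: For a submodule $\mathscr M\subseteq\mathscr E$, $\mathscr M^\perp=\{x\in\mathscr E:\langle x,y\rangle=0\text{ for all }y\in\mathscr M\}$. A pair $(\mathscr H,\mathscr K)$ of closed submodules of $\mathscr E$ is concordant if $\mathscr E$ decomposes orthogonally as $\mathscr E=(\mathscr H\cap\mathscr K)\oplus\overline{\mathscr H^\perp+\mathscr K^\perp}$. Localization: for a positive linear functional $f$ on $\mathscr A$, let $\mathscr N_f=\{x\in\mathscr E: f(\langle x,x\rangle)=0\}$, a closed subspace of $\mathscr E$. The quotient $\mathscr E/\mathscr N_f$ is a pre-Hilbert space with inner product $\langle x+\mathscr N_f,y+\mathscr N_f\rangle_f=f(\langle x,y\rangle)$; $\mathscr E_f$ is its Hilbert space completion. For a closed submodule $\mathscr M$ of $\mathscr E$, $\mathscr M_f$ is the closure of $\{x+\mathscr N_f:x\in\mathscr M\}$ in $\mathscr E_f$.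 The complement $\perp$ of a subspace of $\mathscr E_f$ is taken in the Hilbert space $\mathscr E_f$. *)

theory Defs
  imports "HOL-Analysis.Analysis" "HOL-Library.Set_Algebras"
begin

class complex_normed_space = real_normed_vector +
  fixes scaleC :: "complex \<Rightarrow> 'a \<Rightarrow> 'a" (infixr "*\<^sub>C" 75)
  assumes scaleC_add_right: "c *\<^sub>C (x + y) = c *\<^sub>C x + c *\<^sub>C y"
    and scaleC_add_left: "(c + d) *\<^sub>C x = c *\<^sub>C x + d *\<^sub>C x"
    and scaleC_scaleC: "c *\<^sub>C (d *\<^sub>C x) = (c * d) *\<^sub>C x"
    and scaleC_of_real: "complex_of_real r *\<^sub>C x = r *\<^sub>R x"
    and norm_scaleC: "norm (c *\<^sub>C x) = cmod c * norm x"

class complex_banach = complex_normed_space + complete_space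

text \<open>C*-algebras are not assumed to be unital.\<close>

class cstar_algebra = complex_banach + real_normed_algebra +
  fixes star :: "'a \<Rightarrow> 'a"
  assumes scaleC_mult_left: "(c *\<^sub>C a) * b = c *\<^sub>C (a * b)"
    and scaleC_mult_right: "a * (c *\<^sub>C b) = c *\<^sub>C (a * b)"
    and star_star: "star (star a) = a"
    and star_add: "star (a + b) = star a + star b"
    and star_scaleC: "star (c *\<^sub>C a) = cnj c *\<^sub>C star a"
    and star_mult: "star (a * b) = star b * star a"
    and cstar_identity: "norm (star a * a) = (norm a)\<^sup>2"

definition cstar_positive :: "'a::cstar_algebra \<Rightarrow> bool"
  where "cstar_positive a \<longleftrightarrow> (\<exists>b. a = star b * b)"

definition positive_functional :: "('a::cstar_algebra \<Rightarrow> complex) \<Rightarrow> bool"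
  where "positive_functional f \<longleftrightarrow>
    (\<forall>a b. f (a + b) = f a + f b) \<and> (\<forall>c a. f (c *\<^sub>C a) = c * f a) \<and>
    (\<forall>a. cstar_positive a \<longrightarrow> f a \<in> \<real>\<^sub>\<ge>\<^sub>0)"

text \<open>
  The type of bounded real-linear maps supplies the dual norm and the real vector space
  structure in which extreme points are taken; complex linearity is part of
  \<^const>\<open>positive_functional\<close>.
\<close>

definition states :: "('a::cstar_algebra \<Rightarrow>\<^sub>L complex) set"
  where "states = {f. positive_functional (blinfun_apply f) \<and> norm f = 1}"

definition pure_states :: "('a::cstar_algebra \<Rightarrow>\<^sub>L complex) set"
  where "pure_states = {f. f extreme_point_of states}"

text \<open>
  Right modules, with the inner product conjugate-linear in the first variable. Completeness
  is that of the type of module elements, whose norm is required to be the one induced by the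
  inner product.
\<close>

locale hilbert_cstar_module =
  fixes act :: "'e::complex_banach \<Rightarrow> 'a::cstar_algebra \<Rightarrow> 'e"
    and ip :: "'e \<Rightarrow> 'e \<Rightarrow> 'a"
  assumes act_add_left: "act (x + y) a = act x a + act y a"
    and act_add_right: "act x (a + b) = act x a + act x b"
    and act_mult: "act x (a * b) = act (act x a) b"
    and act_scaleC_left: "act (c *\<^sub>C x) a = c *\<^sub>C act x a"
    and act_scaleC_right: "act x (c *\<^sub>C a) = c *\<^sub>C act x a"
    and ip_add_right: "ip x (y + z) = ip x y + ip x z"
    and ip_scaleC_right: "ip x (c *\<^sub>C y) = c *\<^sub>C ip x y"
    and ip_act_right: "ip x (act y a) = ip x y * a"
    and ip_star: "ip y x = star (ip x y)"
    and ip_positive: "cstar_positive (ip x x)"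
    and ip_eq_zero: "ip x x = 0 \<Longrightarrow> x = 0"
    and norm_eq_sqrt_ip: "norm x = sqrt (norm (ip x x))"

definition closed_submodule ::
    "('e::complex_banach \<Rightarrow> 'a::cstar_algebra \<Rightarrow> 'e) \<Rightarrow> 'e set \<Rightarrow> bool"
  where "closed_submodule act M \<longleftrightarrow>
    0 \<in> M \<and> (\<forall>x\<in>M. \<forall>y\<in>M. x + y \<in> M) \<and> (\<forall>c. \<forall>x\<in>M. c *\<^sub>C x \<in> M) \<and>
    (\<forall>a. \<forall>x\<in>M. act x a \<in> M) \<and> closed M"

definition module_perp :: "('e \<Rightarrow> 'e \<Rightarrow> 'a::cstar_algebra) \<Rightarrow> 'e set \<Rightarrow> 'e set"
  where "module_perp ip M = {x. \<forall>y\<in>M. ip x y = 0}"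

definition orthogonal_decomposition ::
    "('e::complex_banach \<Rightarrow> 'e \<Rightarrow> 'a::cstar_algebra) \<Rightarrow> 'e set \<Rightarrow> 'e set \<Rightarrow> bool"
  where "orthogonal_decomposition ip M N \<longleftrightarrow>
    (\<forall>x\<in>M. \<forall>y\<in>N. ip x y = 0) \<and> M + N = UNIV"

definition concordant ::
    "('e::complex_banach \<Rightarrow> 'e \<Rightarrow> 'a::cstar_algebra) \<Rightarrow> 'e set \<Rightarrow> 'e set \<Rightarrow> bool"
  where "concordant ip H K \<longleftrightarrow>
    orthogonal_decomposition ip (H \<inter> K) (closure (module_perp ip H + module_perp ip K))"

text \<open>
  The localization of a module depends on the functional, so its Hilbert spaces cannot be
  types; they are records with a carrier.
\<close>

record 'v inner_space =
  vecs :: "'v set"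
  vadd :: "'v \<Rightarrow> 'v \<Rightarrow> 'v"
  vscale :: "complex \<Rightarrow> 'v \<Rightarrow> 'v"
  vinner :: "'v \<Rightarrow> 'v \<Rightarrow> complex"

definition vdist :: "'v inner_space \<Rightarrow> 'v \<Rightarrow> 'v \<Rightarrow> real"
  where "vdist V u v = (let w = vadd V u (vscale V (-1) v) in sqrt (Re (vinner V w w)))"

definition vclosure :: "'v inner_space \<Rightarrow> 'v set \<Rightarrow> 'v set"
  where "vclosure V S = {u \<in> vecs V. \<forall>e>0. \<exists>v\<in>S. vdist V u v < e}"

definition vperp :: "'v inner_space \<Rightarrow> 'v set \<Rightarrow> 'v set"
  where "vperp V S = {u \<in> vecs V. \<forall>v\<in>S. vinner V u v = 0}"

definition cauchy_seqs :: "'v inner_space \<Rightarrow> (nat \<Rightarrow> 'v) set"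
  where "cauchy_seqs V = {X. range X \<subseteq> vecs V \<and>
    (\<forall>e>0. \<exists>N. \<forall>m\<ge>N. \<forall>n\<ge>N. vdist V (X m) (X n) < e)}"

definition seq_class :: "'v inner_space \<Rightarrow> (nat \<Rightarrow> 'v) \<Rightarrow> (nat \<Rightarrow> 'v) set"
  where "seq_class V X = {Y \<in> cauchy_seqs V. (\<lambda>n. vdist V (X n) (Y n)) \<longlonglongrightarrow> 0}"

definition seq_rep :: "(nat \<Rightarrow> 'v) set \<Rightarrow> nat \<Rightarrow> 'v"
  where "seq_rep P = (SOME X. X \<in> P)"

definition hilbert_completion :: "'v inner_space \<Rightarrow> (nat \<Rightarrow> 'v) set inner_space"
  where "hilbert_completion V =
    \<lparr> vecs = seq_class V ` cauchy_seqs V,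
      vadd = (\<lambda>P Q. seq_class V (\<lambda>n. vadd V (seq_rep P n) (seq_rep Q n))),
      vscale = (\<lambda>c P. seq_class V (\<lambda>n. vscale V c (seq_rep P n))),
      vinner = (\<lambda>P Q. lim (\<lambda>n. vinner V (seq_rep P n) (seq_rep Q n))) \<rparr>"

definition completion_embed :: "'v inner_space \<Rightarrow> 'v \<Rightarrow> (nat \<Rightarrow> 'v) set"
  where "completion_embed V u = seq_class V (\<lambda>_. u)"

definition null_space :: "('e \<Rightarrow> 'e \<Rightarrow> 'a) \<Rightarrow> ('a \<Rightarrow> complex) \<Rightarrow> 'e set"
  where "null_space ip f = {x. f (ip x x) = 0}"

text \<open>
  Cosets are added as sets; in the scalar multiple, the null space is added again because
  \<open>0 *\<^sub>C P\<close> would otherwise be the singleton of \<open>0\<close>. For positive \<open>f\<close> the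
  value \<open>f (ip x y)\<close> is constant for \<open>x \<in> P\<close> and \<open>y \<in> Q\<close>.
\<close>

definition quotient_space ::
    "('e::complex_banach \<Rightarrow> 'e \<Rightarrow> 'a) \<Rightarrow> ('a \<Rightarrow> complex) \<Rightarrow> 'e set inner_space"
  where "quotient_space ip f =
    \<lparr> vecs = range (\<lambda>x. x +o null_space ip f),
      vadd = (\<lambda>P Q. P + Q),
      vscale = (\<lambda>c P. scaleC c ` P + null_space ip f),
      vinner = (\<lambda>P Q. THE z. \<forall>x\<in>P. \<forall>y\<in>Q. f (ip x y) = z) \<rparr>"

definition localization ::
    "('e::complex_banach \<Rightarrow> 'e \<Rightarrow> 'a) \<Rightarrow> ('a \<Rightarrow> complex) \<Rightarrow> (nat \<Rightarrow> 'e set) set inner_space"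
  where "localization ip f = hilbert_completion (quotient_space ip f)"

definition localized_submodule ::
    "('e::complex_banach \<Rightarrow> 'e \<Rightarrow> 'a) \<Rightarrow> ('a \<Rightarrow> complex) \<Rightarrow> 'e set \<Rightarrow> (nat \<Rightarrow> 'e set) set set"
  where "localized_submodule ip f M = vclosure (localization ip f)
    ((\<lambda>x. completion_embed (quotient_space ip f) (x +o null_space ip f)) ` M)"

end

theory Submission
  imports Defs
begin

text \<open>
  Put \<open>N\<close> for the closure of \<open>H\<^sup>\<bottom> + K\<^sup>\<bottom>\<close>. The submodules \<open>H \<inter> K\<close> and \<open>N\<close> are orthogonal, so
  \<open>L = (H \<inter> K) + N\<close> is a closed submodule, and the pair is concordant iff \<open>L\<close> is the whole module.
  The right-hand side in the condition on a functional \<open>f\<close> is the orthogonal complement of the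
  localization of \<open>N\<close>; so the condition says that the image of \<open>L\<close> is dense in the
  localization at \<open>f\<close>. If \<open>L\<close> is everything, this holds for every state
  (\<open>limit_near_iff_limit_orthogonal\<close>). Pure states are states, so the only other task is to find, for a
  proper closed submodule \<open>L\<close>, a pure state at which the image of \<open>L\<close> is not dense.

  By \<open>functional_vanishes\<close> it suffices to find a pure state \<open>f\<close> and a nonzero linear functional \<open>\<psi>\<close>
  on the module which vanishes on \<open>L\<close> and is bounded for the seminorm of \<open>f\<close>. This is
  \<open>ex_separating_pure_state\<close>. Consider the triples \<open>(f, \<psi>, t)\<close> with \<open>f\<close> positive, \<open>\<psi>\<close> zero on \<open>L\<close>,
  \<open>\<bar>\<psi> x\<bar>\<^sup>2 \<le> t f \<langle>x, x\<rangle>\<close> and \<open>norm f + t \<le> 1\<close>. They form the convex set of linear functionals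
  below a sublinear functional on a real vector space. For \<open>x0\<close> outside \<open>L\<close>, this set has an extreme
  point at which the real part of \<open>\<psi> x0\<close> is maximal (\<open>ex_extreme_linear_below_sublinear\<close>), and the maximum
  is positive because \<open>x0\<close> has positive distance from \<open>L\<close>. At an extreme point the normalized \<open>f\<close>
  is a pure state: if \<open>f = f1 + f2\<close>, then \<open>\<psi>\<close> and \<open>t\<close> split accordingly
  (\<open>split_bounded_functional\<close>), with both parts of \<open>\<psi>\<close> still zero on the submodule \<open>L\<close>.

  All of this needs that sums of positive elements \<open>star b * b\<close> are positive and that the norm is
  monotone on them. These facts are derived from the C*-identity by elementary norm
  estimates in the unitization; the decisive one is \<open>psd_star_mult_self\<close>.
\<close>

section \<open>Positive elements of a unital C*-algebra\<close>

class unital_cstar_algebra = cstar_algebra + real_normed_algebra_1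

lemma scaleC_one [simp]: "1 *\<^sub>C (x::'a::complex_normed_space) = x"
  using scaleC_of_real[of 1 x] by simp

lemma scaleC_minus_one [simp]: "(-1) *\<^sub>C (x::'a::complex_normed_space) = - x"
  using scaleC_of_real[of "-1" x] by simp

lemma scaleC_zero_right [simp]: "c *\<^sub>C (0::'a::complex_normed_space) = 0"
  using scaleC_add_right[of c 0 0] by simp

lemma scaleC_zero_left [simp]: "0 *\<^sub>C (x::'a::complex_normed_space) = 0"
  using scaleC_add_left[of 0 0 x] by simp

lemma scaleC_minus_right: "c *\<^sub>C (- x) = - (c *\<^sub>C (x::'a::complex_normed_space))"
  using scaleC_add_right[of c x "-x"] by (simp add: eq_neg_iff_add_eq_0 add.commute)

lemma scaleC_diff_right: "c *\<^sub>C (x - y) = c *\<^sub>C x - c *\<^sub>C (y::'a::complex_normed_space)"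
  using scaleC_add_right[of c x "-y"] by (simp add: scaleC_minus_right)

lemma star_zero [simp]: "star (0::'a::cstar_algebra) = 0"
  using star_add[of "0::'a" 0] by simp

lemma star_minus: "star (- a) = - star (a::'a::cstar_algebra)"
  using star_add[of a "-a"] by (simp add: eq_neg_iff_add_eq_0 add.commute)

lemma star_diff: "star (a - b) = star a - star (b::'a::cstar_algebra)"
  using star_add[of a "-b"] by (simp add: star_minus)

lemma star_scaleR: "star (r *\<^sub>R a) = r *\<^sub>R star (a::'a::cstar_algebra)"
  using star_scaleC[of "complex_of_real r" a] by (simp add: scaleC_of_real)

lemma norm_star: "norm (star a) = norm (a::'a::cstar_algebra)"
proof -
  have le: "norm b \<le> norm (star b)" for b :: 'a
  proof (cases "b = 0")
    case False
    have "norm b * norm b \<le> norm (star b) * norm b"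
      using norm_mult_ineq[of "star b" b] by (simp add: cstar_identity power2_eq_square)
    then show ?thesis using False by simp
  qed simp
  show ?thesis using le[of a] le[of "star a"] by (simp add: star_star)
qed

lemma star_mult_self_eq_0: "star a * a = 0 \<longleftrightarrow> a = (0::'a::cstar_algebra)"
  using cstar_identity[of a] by auto

lemma selfadjoint_square_eq_0: "star a = a \<Longrightarrow> a * a = 0 \<longleftrightarrow> a = (0::'a::cstar_algebra)"
  using star_mult_self_eq_0[of a] by simp

lemma bounded_linear_star: "bounded_linear (star :: 'a::cstar_algebra \<Rightarrow> 'a)"
  by (rule bounded_linear_intro[where K = 1]) (simp_all add: star_add star_scaleR norm_star)

lemma star_one [simp]: "star (1::'a::unital_cstar_algebra) = 1"
  using star_mult[of "star 1" "1::'a"] by (simp add: star_star)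

lemma star_power: "star (a ^ n) = star (a::'a::unital_cstar_algebra) ^ n"
  by (induction n) (simp_all add: star_mult power_commutes)

text \<open>
  Square roots come from the iteration \<open>y \<mapsto> (x + y\<^sup>2) / 2\<close> started at \<open>0\<close>. For
  \<open>norm x \<le> 1\<close> its steps are bounded by those of the same iteration for the real number
  \<open>1\<close>, which increases and is bounded by \<open>1\<close>; so it converges. A fixed point satisfies
  \<open>(1 - y)\<^sup>2 = 1 - x\<close>. This takes the place of spectral theory.
\<close>

fun root_step :: "'a::real_normed_algebra_1 \<Rightarrow> nat \<Rightarrow> 'a" where
  "root_step x 0 = 0"
| "root_step x (Suc n) = (1/2) *\<^sub>R (x + root_step x n * root_step x n)"

lemma root_step_commute: "z * x = x * z \<Longrightarrow> z * root_step x n = root_step x n * z"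
proof (induction n)
  case (Suc n)
  have "z * (root_step x n * root_step x n) = root_step x n * root_step x n * z"
    by (metis Suc mult.assoc)
  then show ?case using Suc by (simp add: distrib_left distrib_right)
qed simp

lemma root_step_real: "0 \<le> root_step (1::real) n \<and> root_step (1::real) n \<le> root_step 1 (Suc n)
    \<and> root_step (1::real) n \<le> 1"
proof (induction n)
  case (Suc n)
  then have "root_step (1::real) n * root_step 1 n \<le> root_step 1 (Suc n) * root_step 1 (Suc n)"
    and "root_step (1::real) n * root_step 1 n \<le> 1"
    by (auto intro!: mult_mono mult_le_one simp del: root_step.simps)
  then show ?case using Suc by simp
qed simp

lemma root_step_bounds:
  assumes "norm x \<le> 1"
  shows "norm (root_step x n) \<le> root_step 1 n \<and>
    norm (root_step x (Suc n) - root_step x n) \<le> root_step 1 (Suc n) - root_step 1 n"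
proof (induction n)
  case 0
  then show ?case using assms by simp
next
  case (Suc n)
  let ?y = "root_step x" and ?s = "root_step (1::real)"
  have s: "0 \<le> ?s n" "?s n \<le> ?s (Suc n)" "0 \<le> ?s (Suc n)"
    using root_step_real[of n] root_step_real[of "Suc n"] by (auto simp del: root_step.simps)
  have y: "norm (?y (Suc n)) \<le> ?s (Suc n)"
    using Suc norm_triangle_ineq[of "?y (Suc n) - ?y n" "?y n"] by (simp del: root_step.simps)
  have com: "?y n * ?y (Suc n) = ?y (Suc n) * ?y n"
    by (metis root_step_commute)
  have "?y (Suc (Suc n)) - ?y (Suc n)
      = (1/2) *\<^sub>R (?y (Suc n) * ?y (Suc n) - ?y n * ?y n)"
    by (simp only: root_step.simps(2)[of x "Suc n"] root_step.simps(2)[of x n])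
      (simp add: algebra_simps)
  also have "\<dots> = (1/2) *\<^sub>R ((?y (Suc n) - ?y n) * (?y (Suc n) + ?y n))"
    using com by (simp add: algebra_simps del: root_step.simps)
  finally have "norm (?y (Suc (Suc n)) - ?y (Suc n))
      \<le> 1/2 * (norm (?y (Suc n) - ?y n) * norm (?y (Suc n) + ?y n))"
    by (simp add: norm_mult_ineq del: root_step.simps)
  also have "\<dots> \<le> 1/2 * ((?s (Suc n) - ?s n) * (?s (Suc n) + ?s n))"
    using Suc y s norm_triangle_ineq[of "?y (Suc n)" "?y n"]
    by (intro mult_left_mono mult_mono) (auto simp del: root_step.simps)
  also have "\<dots> = ?s (Suc (Suc n)) - ?s (Suc n)"
    by (simp only: root_step.simps(2)[of 1 "Suc n"] root_step.simps(2)[of 1 n])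
      (simp add: algebra_simps)
  finally show ?case using y by blast
qed

lemma ex_root_one_minus:
  fixes x :: "'a::unital_cstar_algebra"
  assumes x: "norm x \<le> 1"
  obtains y where "(1 - y) * (1 - y) = 1 - x" "norm y \<le> 1"
    "\<And>z. z * x = x * z \<Longrightarrow> z * y = y * z" "star x = x \<Longrightarrow> star y = y"
proof -
  let ?y = "root_step x" and ?s = "root_step (1::real)"
  have dist: "norm (?y (n + k) - ?y n) \<le> ?s (n + k) - ?s n" for n k
  proof (induction k)
    case (Suc k)
    show ?case
      using Suc root_step_bounds[OF x, of "n + k"]
        norm_triangle_ineq[of "?y (Suc (n + k)) - ?y (n + k)" "?y (n + k) - ?y n"]
      by (simp del: root_step.simps)
  qed simp
  have "incseq ?s" using root_step_real by (auto intro: incseq_SucI simp del: root_step.simps)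
  then have "convergent ?s"
    using root_step_real by (intro Bseq_monoseq_convergent incseq_imp_monoseq BseqI'[of _ 1])
      (auto simp del: root_step.simps)
  then have cs: "Cauchy ?s" by (rule convergent_Cauchy)
  have "Cauchy ?y"
  proof (rule CauchyI')
    fix e :: real assume "0 < e"
    then obtain M where M: "\<And>m n. m \<ge> M \<Longrightarrow> n \<ge> M \<Longrightarrow> norm (?s m - ?s n) < e"
      using CauchyD[OF cs] by blast
    have "dist (?y m) (?y n) < e" if "m \<ge> M" "n > m" for m n
    proof -
      have "norm (?y n - ?y m) \<le> ?s n - ?s m" using dist[of m "n - m"] that by simp
      also have "\<dots> < e" using M[of n m] that by simp
      finally show ?thesis by (simp add: dist_norm norm_minus_commute)
    qed
    then show "\<exists>M. \<forall>m\<ge>M. \<forall>n>m. dist (?y m) (?y n) < e" by blast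
  qed
  then obtain y where lim: "?y \<longlonglongrightarrow> y"
    using Cauchy_convergent convergent_def by blast
  have "(\<lambda>n. ?y (Suc n)) \<longlonglongrightarrow> (1/2) *\<^sub>R (x + y * y)"
    unfolding root_step.simps using lim by (intro tendsto_intros)
  then have "y = (1/2) *\<^sub>R (x + y * y)"
    using LIMSEQ_unique[OF LIMSEQ_Suc[OF lim]] by blast
  then have "y + y = x + y * y"
    by (metis scaleR_half_double scaleR_add_right)
  then have 1: "(1 - y) * (1 - y) = 1 - x"
    by (simp add: algebra_simps)
  have "norm (?y n) \<le> 1" for n
    using root_step_bounds[OF x, of n] root_step_real[of n] by linarith
  then have 2: "norm y \<le> 1"
    using LIMSEQ_le_const2[OF tendsto_norm[OF lim]] by blast
  have 3: "z * y = y * z" if "z * x = x * z" for z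
  proof (rule LIMSEQ_unique)
    show "(\<lambda>n. z * ?y n) \<longlonglongrightarrow> z * y" using lim by (intro tendsto_intros)
    show "(\<lambda>n. z * ?y n) \<longlonglongrightarrow> y * z"
      unfolding root_step_commute[OF that] using lim by (intro tendsto_intros)
  qed
  have 4: "star y = y" if "star x = x"
  proof (rule LIMSEQ_unique)
    have "star (?y n) = ?y n" for n
      by (induction n) (simp_all add: star_scaleR star_add star_mult that)
    then show "?y \<longlonglongrightarrow> star y"
      using bounded_linear.tendsto[OF bounded_linear_star lim] by simp
    show "?y \<longlonglongrightarrow> y" by (fact lim)
  qed
  show ?thesis using that 1 2 3 4 by blast
qed

text \<open>
  A number lies in \<open>[0, 2 * t]\<close> iff its distance from \<open>t\<close> is at most \<open>t\<close>. Expressed with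
  norms, this makes the positive elements visibly a convex cone; that they are exactly the elements
  \<open>star b * b\<close> is the content of the lemmas that follow.
\<close>

definition psd :: "'a::unital_cstar_algebra \<Rightarrow> bool"
  where "psd a \<longleftrightarrow> star a = a \<and> (\<exists>t\<ge>0. norm (t *\<^sub>R 1 - a) \<le> t)"

lemma psd_sa: "psd a \<Longrightarrow> star a = a"
  by (simp add: psd_def)

lemma psd_zero [simp]: "psd 0"
  unfolding psd_def by (auto intro!: exI[of _ 0])

lemma psd_add: "psd a \<Longrightarrow> psd b \<Longrightarrow> psd (a + b)"
proof -
  assume "psd a" "psd b"
  then obtain s t where st: "s \<ge> 0" "t \<ge> 0" "norm (s *\<^sub>R 1 - a) \<le> s" "norm (t *\<^sub>R 1 - b) \<le> t"
    and sa: "star a = a" "star b = b"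
    unfolding psd_def by blast
  have "norm ((s + t) *\<^sub>R 1 - (a + b)) \<le> s + t"
    using st norm_triangle_ineq[of "s *\<^sub>R 1 - a" "t *\<^sub>R 1 - b"] by (simp add: algebra_simps)
  then show ?thesis unfolding psd_def using st sa by (auto simp: star_add intro!: exI[of _ "s + t"])
qed

lemma psd_scaleR: "psd a \<Longrightarrow> 0 \<le> c \<Longrightarrow> psd (c *\<^sub>R a)"
proof -
  assume "psd a" "0 \<le> c"
  then obtain t where t: "t \<ge> 0" "norm (t *\<^sub>R 1 - a) \<le> t" and sa: "star a = a"
    unfolding psd_def by blast
  have "norm ((c * t) *\<^sub>R 1 - c *\<^sub>R a) = c * norm (t *\<^sub>R 1 - a)"
    using \<open>0 \<le> c\<close> by (metis norm_scaleR abs_of_nonneg scaleR_right_diff_distrib scaleR_scaleR)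
  also have "\<dots> \<le> c * t" using t \<open>0 \<le> c\<close> by (simp add: mult_left_mono)
  finally show ?thesis
    unfolding psd_def using t sa \<open>0 \<le> c\<close> by (auto simp: star_scaleR intro!: exI[of _ "c * t"])
qed

lemma psd_norm_minus: "star z = z \<Longrightarrow> norm z \<le> t \<Longrightarrow> psd (t *\<^sub>R 1 - z)"
  unfolding psd_def by (auto simp: star_diff star_scaleR intro!: exI[of _ t] order_trans[OF norm_ge_zero])

lemma psd_sqrt:
  assumes "psd a"
  obtains r where "psd r" "r * r = a" "\<And>z. z * a = a * z \<Longrightarrow> z * r = r * z"
proof -
  obtain t where t: "t \<ge> 0" "norm (t *\<^sub>R 1 - a) \<le> t" and sa: "star a = a"
    using assms unfolding psd_def by blast
  show ?thesis
  proof (cases "t = 0")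
    case True
    then show ?thesis using t that[of 0] by simp
  next
    case False
    with t have tp: "t > 0" by simp
    define x where "x = 1 - (1/t) *\<^sub>R a"
    have "norm x = (1/t) * norm (t *\<^sub>R x)" using tp by simp
    also have "t *\<^sub>R x = t *\<^sub>R 1 - a" using tp by (simp add: x_def algebra_simps)
    also have "(1/t) * norm (t *\<^sub>R 1 - a) \<le> 1" using t tp by (simp add: divide_simps)
    finally have "norm x \<le> 1" .
    then obtain y where y: "(1 - y) * (1 - y) = 1 - x" "norm y \<le> 1"
      "\<And>z. z * x = x * z \<Longrightarrow> z * y = y * z" "star x = x \<Longrightarrow> star y = y"
      by (rule ex_root_one_minus) blast
    have sy: "star y = y" using y(4) sa by (simp add: x_def star_diff star_scaleR)
    let ?r = "sqrt t *\<^sub>R (1 - y)"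
    show ?thesis
    proof (rule that[of ?r])
      have "norm (sqrt t *\<^sub>R 1 - ?r) \<le> sqrt t"
        using y(2) t by (simp add: scaleR_right_diff_distrib mult_left_le)
      then show "psd ?r"
        unfolding psd_def using t sy
        by (auto simp: star_scaleR star_diff intro!: exI[of _ "sqrt t"])
      have "?r * ?r = t *\<^sub>R (1 - x)" using tp by (simp add: y(1))
      then show "?r * ?r = a" using tp by (simp add: x_def)
      show "z * ?r = ?r * z" if "z * a = a * z" for z
        using y(3)[of z] that by (simp add: x_def algebra_simps)
    qed
  qed
qed

text \<open>
  The hypotheses make \<open>x + \<i> s\<close> equal to \<open>t\<close> times an isometry (\<open>star u * u = t\<^sup>2\<close>),
  so the C*-identity gives its norm, and \<open>x\<close> and \<open>s\<close> are its real and imaginary parts. All norm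
  bounds for positive elements below rest on this lemma.
\<close>

lemma norm_unitary_part:
  fixes x s :: "'a::unital_cstar_algebra"
  assumes "star x = x" "star s = s" "x * s = s * x" "x * x + s * s = (t * t) *\<^sub>R 1" "0 \<le> t"
  shows "norm x \<le> t" "norm s \<le> t"
proof -
  have i: "\<i> *\<^sub>C \<i> *\<^sub>C s = - s" for s :: 'a by (simp add: scaleC_scaleC)
  define u where "u = x + \<i> *\<^sub>C s"
  have su: "star u = x - \<i> *\<^sub>C s"
    using assms(1,2) scaleC_scaleC[of "-1" \<i> s] by (simp add: u_def star_add star_scaleC)
  have "star u * u = (t * t) *\<^sub>R 1"
    using assms(3,4) unfolding su
    by (simp add: u_def algebra_simps scaleC_mult_left scaleC_mult_right
        scaleC_add_right scaleC_diff_right i)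
  then have "(norm u)\<^sup>2 = t\<^sup>2"
    using cstar_identity[of u] assms(5) by (simp add: power2_eq_square)
  then have nu: "norm u = t" using assms(5) by simp
  have "x = (1/2) *\<^sub>R (u + star u)"
    by (simp add: u_def su[unfolded u_def])
  then have "norm x \<le> 1/2 * (norm u + norm (star u))"
    by (metis norm_scaleR norm_triangle_ineq abs_of_nonneg mult_left_mono zero_le_divide_1_iff zero_le_numeral)
  then show "norm x \<le> t" using nu by (simp add: norm_star)
  have "\<i> *\<^sub>C s = (1/2) *\<^sub>R (u - star u)"
    by (simp add: u_def su[unfolded u_def])
  then have "norm (\<i> *\<^sub>C s) \<le> 1/2 * (norm u + norm (star u))"
    by (metis norm_scaleR norm_triangle_ineq4 abs_of_nonneg mult_left_mono zero_le_divide_1_iff zero_le_numeral)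
  then show "norm s \<le> t" using nu by (simp add: norm_star norm_scaleC)
qed

text \<open>
  For \<open>norm g \<le> 1\<close> let \<open>1 - y\<close> be the square root of \<open>1 - g\<^sup>2\<close>. Then
  \<open>g + \<i> (1 - y)\<close> is an isometry, so \<open>norm (1 - y) \<le> 1\<close>, and squaring gives
  \<open>norm (1 - g\<^sup>2) \<le> 1\<close>.
\<close>

lemma psd_square:
  assumes "star h = (h::'a::unital_cstar_algebra)"
  shows "psd (h * h)"
proof -
  have unit: "psd (g * g)" if g: "star g = g" "norm g \<le> 1" for g :: 'a
  proof -
    have "norm (g * g) \<le> 1"
      using norm_mult_ineq[of g g] g(2) mult_le_one[of "norm g" "norm g"] by simp
    then obtain y where y: "(1 - y) * (1 - y) = 1 - g * g"
      "\<And>z. z * (g * g) = g * g * z \<Longrightarrow> z * y = y * z" "star (g * g) = g * g \<Longrightarrow> star y = y"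
      by (rule ex_root_one_minus) blast
    have "star y = y" "g * y = y * g" using y(2)[of g] y(3) g by (auto simp: star_mult mult.assoc)
    then have "norm (1 - y) \<le> 1"
      using norm_unitary_part(2)[of g "1 - y" 1] g y(1) by (simp add: star_diff algebra_simps)
    then have "norm (1 - g * g) \<le> 1"
      unfolding y(1)[symmetric]
      by (metis norm_mult_ineq mult_le_one norm_ge_zero order_trans)
    then show ?thesis unfolding psd_def using g by (auto simp: star_mult intro!: exI[of _ 1])
  qed
  show ?thesis
  proof (cases "h = 0")
    case False
    define g where "g = (1 / norm h) *\<^sub>R h"
    have "psd (g * g)" by (rule unit) (use False assms in \<open>auto simp: g_def star_scaleR\<close>)
    then have "psd ((norm h * norm h) *\<^sub>R (g * g))" by (intro psd_scaleR) auto
    also have "(norm h * norm h) *\<^sub>R (g * g) = h * h" using False by (simp add: g_def)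
    finally show ?thesis .
  qed simp
qed

lemma psd_mult: "psd a \<Longrightarrow> psd b \<Longrightarrow> a * b = b * a \<Longrightarrow> psd (a * b)"
proof -
  assume a: "psd a" and b: "psd b" and ab: "a * b = b * a"
  obtain r where r: "psd r" "r * r = a" "\<And>z. z * a = a * z \<Longrightarrow> z * r = r * z"
    using psd_sqrt[OF a] by blast
  obtain s where s: "psd s" "s * s = b" "\<And>z. z * b = b * z \<Longrightarrow> z * s = s * z"
    using psd_sqrt[OF b] by blast
  have "b * r = r * b" using r(3) ab by simp
  then have rs: "r * s = s * r" using s(3)[of r] by simp
  have "psd ((r * s) * (r * s))"
    by (rule psd_square) (simp add: star_mult psd_sa[OF r(1)] psd_sa[OF s(1)] rs)
  moreover have "(r * s) * (r * s) = a * b"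
    using rs r(2) s(2) by (metis mult.assoc)
  ultimately show ?thesis by simp
qed

text \<open>
  From \<open>0 \<le> x \<le> t\<close> one gets \<open>x\<^sup>2 \<le> t\<^sup>2\<close>, because
  \<open>t\<^sup>2 - x\<^sup>2 = (t + x) (t - x)\<close> is a product of commuting positive elements; with
  \<open>s\<close> the square root of this difference, \<open>x + \<i> s\<close> is \<open>t\<close> times an isometry.
\<close>

lemma psd_norm_le:
  assumes x: "psd x" and "psd (t *\<^sub>R 1 - x)" and t: "0 \<le> t"
  shows "norm x \<le> t"
proof -
  have "psd (t *\<^sub>R (t *\<^sub>R 1 - x) + x * (t *\<^sub>R 1 - x))"
    by (intro psd_add psd_scaleR psd_mult assms) (simp add: algebra_simps)
  then have "psd ((t * t) *\<^sub>R 1 - x * x)" by (simp add: algebra_simps)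
  then obtain s where s: "psd s" "s * s = (t * t) *\<^sub>R 1 - x * x"
    "\<And>z. z * ((t * t) *\<^sub>R 1 - x * x) = ((t * t) *\<^sub>R 1 - x * x) * z \<Longrightarrow> z * s = s * z"
    using psd_sqrt by blast
  show ?thesis
    by (rule norm_unitary_part(1)[of x s]) (use s(2) s(3)[of x] t in \<open>auto simp: psd_sa[OF x] psd_sa[OF s(1)] algebra_simps\<close>)
qed

lemma psd_norm_mono:
  assumes x: "psd x" and y: "psd y"
  shows "norm x \<le> norm (x + y)"
proof (rule psd_norm_le[OF x])
  have "psd (norm (x + y) *\<^sub>R 1 - (x + y))"
    using psd_norm_minus psd_sa psd_add[OF x y] by blast
  from psd_add[OF this y] show "psd (norm (x + y) *\<^sub>R 1 - x)" by (simp add: algebra_simps)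
qed simp

lemma psd_power: "psd a \<Longrightarrow> psd (a ^ n)"
proof (induction n)
  case 0
  then show ?case using psd_square[of 1] by simp
next
  case (Suc n)
  then show ?case using psd_mult[of a "a ^ n"] by (simp add: power_commutes)
qed

lemma psd_bernoulli:
  assumes m: "psd m"
  shows "psd ((1 + m) ^ n - 1 - of_nat n * m)"
proof (induction n)
  case (Suc n)
  have com: "m * (1 + m) ^ n = (1 + m) ^ n * m"
    by (rule power_commuting_commutes[symmetric]) (simp add: algebra_simps)
  have nm: "of_nat n * m = real n *\<^sub>R m" by (simp add: scaleR_conv_of_real)
  have "psd ((1 + m) ^ n - 1)"
    using psd_add[OF Suc, of "real n *\<^sub>R m"] psd_scaleR[OF m] by (simp add: nm)
  then have "psd (((1 + m) ^ n - 1) * m)"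
    by (rule psd_mult[OF _ m]) (simp add: left_diff_distrib right_diff_distrib com)
  from psd_add[OF Suc this] show ?case
    by (simp add: power_Suc2 algebra_simps del: power_Suc)
qed simp

text \<open>
  If \<open>star g * g = - m\<close> with \<open>m\<close> positive, then \<open>g * star g\<close>, which is half
  a sum of two squares plus \<open>m\<close>, is positive. Hence \<open>k = 1 - g * star g / T\<close> is a contraction for a suitable
  \<open>T\<close>, and \<open>star g * k ^ n * g\<close> stays bounded in \<open>n\<close>. But \<open>star g * k = (1 + m / T) * star g\<close>
  turns this into \<open>- (1 + m / T) ^ n * m\<close>, whose norm grows at least like
  \<open>n * norm (m\<^sup>2) / T\<close> by Bernoulli's inequality. So \<open>m = 0\<close>. This replaces the
  comparison of the spectra of \<open>star g * g\<close> and \<open>g * star g\<close>.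
\<close>

lemma psd_eq_neg_star_mult_self_imp_0:
  assumes m: "psd m" and gm: "star g * g = - m"
  shows "g = (0::'a::unital_cstar_algebra)"
proof -
  define x where "x = g + star g"
  define y where "y = \<i> *\<^sub>C (g - star g)"
  have sx: "star x = x" by (simp add: x_def star_add star_star)
  have mi: "(- \<i>) *\<^sub>C z = - (\<i> *\<^sub>C z)" for z :: 'a
    using scaleC_scaleC[of "-1" \<i> z] by simp
  have sy: "star y = y"
    by (simp add: y_def star_scaleC star_diff star_star mi) (simp add: scaleC_diff_right)
  have ii: "\<i> *\<^sub>C \<i> *\<^sub>C z = - z" for z :: 'a by (simp add: scaleC_scaleC)
  have yy: "y * y = - ((g - star g) * (g - star g))"
    unfolding y_def by (simp only: scaleC_mult_left scaleC_mult_right ii)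
  have "x * x + y * y = 2 *\<^sub>R (g * star g) + 2 *\<^sub>R (star g * g)"
    unfolding yy x_def by (simp add: algebra_simps scaleR_2)
  then have "g * star g = (1/2) *\<^sub>R (x * x + y * y) + m"
    by (simp add: gm scaleR_right_diff_distrib)
  then have q: "psd (g * star g)"
    using psd_add[OF psd_scaleR[of _ "1/2"] m] psd_add[OF psd_square[OF sx] psd_square[OF sy]] by simp
  then obtain t where t: "t \<ge> 0" "norm (t *\<^sub>R 1 - g * star g) \<le> t" unfolding psd_def by blast
  \<comment> \<open>Enlarging the radius keeps the bound and makes it strictly positive.\<close>
  define T where "T = t + 1"
  have T: "T > 0" "norm (T *\<^sub>R 1 - g * star g) \<le> T"
    using t norm_triangle_ineq[of "t *\<^sub>R 1 - g * star g" 1] by (auto simp: T_def algebra_simps)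
  define k where "k = 1 - (1/T) *\<^sub>R (g * star g)"
  define M where "M = (1/T) *\<^sub>R m"
  have "norm k = (1/T) * norm (T *\<^sub>R k)" using T by simp
  also have "T *\<^sub>R k = T *\<^sub>R 1 - g * star g" using T by (simp add: k_def algebra_simps)
  also have "(1/T) * norm (T *\<^sub>R 1 - g * star g) \<le> 1" using T by (simp add: divide_simps)
  finally have k: "norm k \<le> 1" .
  have M: "psd M" using psd_scaleR[OF m, of "1/T"] T by (simp add: M_def)
  have "star g * k = (1 + M) * star g"
  proof -
    have "star g * k = star g - (1/T) *\<^sub>R ((star g * g) * star g)"
      by (simp add: k_def algebra_simps)
    also have "\<dots> = (1 + M) * star g" unfolding gm by (simp add: M_def algebra_simps)
    finally show ?thesis .
  qed
  then have pow: "star g * k ^ n = (1 + M) ^ n * star g" for n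
    by (induction n) (simp_all add: power_Suc2 del: power_Suc flip: mult.assoc, simp add: mult.assoc)
  have "n * norm (M * M) \<le> norm g * norm g / T" for n :: nat
  proof -
    have "psd ((1 + M) ^ n - 1 - of_nat n * M)" by (rule psd_bernoulli[OF M])
    then have "psd (((1 + M) ^ n - 1 - of_nat n * M) * M)"
    proof (rule psd_mult[OF _ M])
      have "M * (1 + M) ^ n = (1 + M) ^ n * M"
        by (rule power_commuting_commutes[symmetric]) (simp add: algebra_simps)
      moreover have "M * (of_nat n * M) = of_nat n * M * M" by (metis mult.assoc mult_of_nat_commute)
      ultimately show "((1 + M) ^ n - 1 - of_nat n * M) * M = M * ((1 + M) ^ n - 1 - of_nat n * M)"
        by (simp add: algebra_simps)
    qed
    then have p: "psd (((1 + M) ^ n - 1 - of_nat n * M) * M + M)" using M by (rule psd_add)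
    have nM: "of_nat n * (M * M) = real n *\<^sub>R (M * M)" by (simp add: scaleR_conv_of_real)
    have "psd (real n *\<^sub>R (M * M))" using psd_mult[OF M M] by (intro psd_scaleR) auto
    from psd_norm_mono[OF this p] have "norm (real n *\<^sub>R (M * M)) \<le> norm ((1 + M) ^ n * M)"
      by (simp add: algebra_simps nM)
    also have "(1 + M) ^ n * M = - (1/T) *\<^sub>R (star g * k ^ n * g)"
      unfolding pow by (simp add: mult.assoc gm M_def)
    also have "norm \<dots> = norm (star g * k ^ n * g) / T" using T by simp
    also have "\<dots> \<le> norm g * norm g / T"
    proof (rule divide_right_mono)
      have "norm (star g * k ^ n * g) \<le> norm (star g) * norm (k ^ n) * norm g"
        by (meson norm_mult_ineq mult_right_mono norm_ge_zero order_trans)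
      also have "\<dots> \<le> norm (star g) * 1 * norm g"
        using norm_power_ineq[of k n] power_le_one[OF norm_ge_zero k, of n]
        by (intro mult_right_mono mult_left_mono) auto
      finally show "norm (star g * k ^ n * g) \<le> norm g * norm g" by (simp add: norm_star)
    qed (use T in simp)
    finally show ?thesis by simp
  qed
  then have "norm (M * M) \<le> 0"
    by (meson ex_less_of_nat_mult not_le)
  then have "M = 0" using selfadjoint_square_eq_0[OF psd_sa[OF M]] by simp
  then have "m = 0" using T by (simp add: M_def)
  then show ?thesis using gm star_mult_self_eq_0[of g] by simp
qed

text \<open>
  Let \<open>h = star b * b\<close> and let \<open>k = \<bar>h\<bar>\<close> be the square root of \<open>h\<^sup>2\<close>.
  For \<open>d = k - h\<close> (twice the negative part of \<open>h\<close>) one has \<open>h d = - k d\<close>, so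
  \<open>star (b d) * (b d) = d h d = - d k d\<close> is minus a positive element, and \<open>b d = 0\<close> by the previous
  lemma. Then \<open>h d = k d = 0\<close>, so \<open>d\<^sup>2 = 0\<close> and \<open>h = k\<close>.
\<close>

lemma psd_star_mult_self: "psd (star b * (b::'a::unital_cstar_algebra))"
proof -
  define h where "h = star b * b"
  have sh: "star h = h" by (simp add: h_def star_mult star_star)
  obtain k where k: "psd k" "k * k = h * h" "\<And>z. z * (h * h) = h * h * z \<Longrightarrow> z * k = k * z"
    using psd_sqrt[OF psd_square[OF sh]] by blast
  have hk: "h * k = k * h" using k(3)[of h] by (simp add: mult.assoc)
  obtain w where w: "psd w" "w * w = k" "\<And>z. z * k = k * z \<Longrightarrow> z * w = w * z"
    using psd_sqrt[OF k(1)] by blast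
  have hw: "h * w = w * h" "k * w = w * k" using w(3) hk by auto
  define d where "d = k - h"
  have sd: "star d = d" by (simp add: d_def star_diff sh psd_sa[OF k(1)])
  have hd: "h * d = - (k * d)" using hk k(2) by (simp add: d_def algebra_simps)
  have wd: "w * d = d * w" using hw by (simp add: d_def algebra_simps)
  have "star (b * d) * (b * d) = d * (h * d)" by (simp add: star_mult sd h_def mult.assoc)
  also have "\<dots> = - (d * (w * w * d))" by (simp add: hd w(2))
  also have "d * (w * w * d) = (w * d) * (w * d)" by (metis wd mult.assoc)
  finally have "b * d = 0"
    by (rule psd_eq_neg_star_mult_self_imp_0[rotated])
      (intro psd_square, simp add: star_mult sd psd_sa[OF w(1)] wd)
  then have "h * d = 0" by (simp add: h_def mult.assoc)
  moreover from this hd have "k * d = 0" by simp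
  ultimately have "d * d = 0" by (simp add: d_def algebra_simps)
  then have "d = 0" using selfadjoint_square_eq_0[OF sd] by simp
  then show ?thesis using k(1) by (simp add: d_def h_def)
qed

text \<open>
  For commuting positive \<open>x\<close> and \<open>k = 1 - x\<close>, the inequality \<open>(n + 1) x k ^ n \<le> 1\<close>
  follows by induction from
  \<open>1 - (n + 2) x k ^ (n + 1) = k (1 - (n + 1) x k ^ n) + x (1 - k ^ (n + 1))\<close>. The
  bound tends to \<open>0\<close>, which later makes \<open>1 - (1 - x) ^ n\<close> an approximate unit for \<open>x\<close>.
\<close>

lemma norm_mult_power_one_minus:
  assumes x: "psd x" and k: "psd (1 - x)"
  shows "norm (x * (1 - x) ^ n) \<le> 1 / real (Suc n)"
proof -
  define k where "k = 1 - x"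
  have kp: "psd k" and xk: "x = 1 - k" using k by (simp_all add: k_def)
  have com: "x * k ^ n = k ^ n * x" for n
    by (simp add: xk algebra_simps power_commutes)
  have "norm k \<le> 1" using psd_norm_le[of k 1] kp x by (simp add: xk)
  then have "norm (k ^ n) \<le> 1" for n
    by (meson norm_power_ineq power_le_one norm_ge_zero order_trans)
  then have k1: "psd (1 - k ^ n)" for n
    using psd_norm_minus[of "k ^ n" 1] psd_sa[OF psd_power[OF kp]] by simp
  have D: "psd (1 - real (Suc n) *\<^sub>R (x * k ^ n))" for n
  proof (induction n)
    case (Suc n)
    have "psd (k * (1 - real (Suc n) *\<^sub>R (x * k ^ n)))"
      by (intro psd_mult kp Suc) (simp add: xk algebra_simps power_commutes)
    moreover have "psd (x * (1 - k ^ Suc n))"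
      by (intro psd_mult x k1) (use com[of "Suc n"] in \<open>simp add: algebra_simps del: power_Suc\<close>)
    ultimately have "psd (k * (1 - real (Suc n) *\<^sub>R (x * k ^ n)) + x * (1 - k ^ Suc n))"
      by (rule psd_add)
    also have "\<dots> = 1 - real (Suc (Suc n)) *\<^sub>R (x * k ^ Suc n)"
    proof -
      have "k * (x * k ^ n) = x * k ^ Suc n" by (simp add: xk algebra_simps power_commutes)
      then have "k * (1 - real (Suc n) *\<^sub>R (x * k ^ n)) = k - real (Suc n) *\<^sub>R (x * k ^ Suc n)"
        by (simp add: right_diff_distrib del: power_Suc)
      then show ?thesis
        by (simp add: xk right_diff_distrib scaleR_left_distrib scaleR_2 del: power_Suc)
    qed
    finally show ?case .
  qed (use kp in \<open>simp add: xk\<close>)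
  have "norm (real (Suc n) *\<^sub>R (x * k ^ n)) \<le> 1"
    using D[of n] by (intro psd_norm_le psd_scaleR psd_mult x psd_power kp) (simp_all add: com)
  then have "real (Suc n) * norm (x * k ^ n) \<le> 1" by (simp only: norm_scaleR abs_of_nat)
  then show ?thesis by (simp add: k_def field_simps)
qed

text \<open>
  The norm on the unitization is the maximum of the modulus of the scalar part and the operator norm
  of left multiplication on the algebra. The operator norm alone is only a seminorm if the
  algebra already has a unit; the maximum is a C*-norm in every case.
\<close>

datatype 'a unitization = Unitized (alg_part: 'a) (scal_part: complex)

section \<open>The unitization of a C*-algebra\<close>

lemma scaleR_scaleC: "r *\<^sub>R c *\<^sub>C x = c *\<^sub>C r *\<^sub>R (x::'a::complex_normed_space)"
  by (metis scaleC_of_real scaleC_scaleC mult.commute)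

lemma scaleR_complex_scaleC: "(r *\<^sub>R c) *\<^sub>C x = c *\<^sub>C r *\<^sub>R (x::'a::complex_normed_space)"
  by (metis scaleC_of_real scaleC_scaleC mult.commute scaleR_conv_of_real)

lemma unitization_eqI: "alg_part z = alg_part w \<Longrightarrow> scal_part z = scal_part w \<Longrightarrow> z = w"
  by (rule unitization.expand) simp

definition mult_op :: "'a::cstar_algebra unitization \<Rightarrow> 'a \<Rightarrow> 'a"
  where "mult_op z b = alg_part z * b + scal_part z *\<^sub>C b"

lemma bounded_linear_mult_op: "bounded_linear (mult_op z)"
proof (rule bounded_linear_intro[where K = "norm (alg_part z) + norm (scal_part z)"])
  fix b c r
  show "mult_op z (b + c) = mult_op z b + mult_op z c"
    by (simp add: mult_op_def distrib_left scaleC_add_right)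
  show "mult_op z (r *\<^sub>R b) = r *\<^sub>R mult_op z b"
    by (simp add: mult_op_def scaleR_right_distrib scaleR_scaleC)
  have "norm (mult_op z b) \<le> norm (alg_part z * b) + norm (scal_part z *\<^sub>C b)"
    by (simp add: mult_op_def norm_triangle_ineq)
  also have "\<dots> \<le> norm b * (norm (alg_part z) + norm (scal_part z))"
    using norm_mult_ineq[of "alg_part z" b] by (simp add: norm_scaleC algebra_simps)
  finally show "norm (mult_op z b) \<le> norm b * (norm (alg_part z) + norm (scal_part z))" .
qed

instantiation unitization :: (cstar_algebra) real_algebra_1
begin

definition "0 = Unitized 0 0"
definition "1 = Unitized 0 1"
definition "z + w = Unitized (alg_part z + alg_part w) (scal_part z + scal_part w)"
definition "z - w = Unitized (alg_part z - alg_part w) (scal_part z - scal_part w)"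
definition "- z = Unitized (- alg_part z) (- scal_part z)"
definition "z * w = Unitized
  (alg_part z * alg_part w + scal_part z *\<^sub>C alg_part w + scal_part w *\<^sub>C alg_part z)
  (scal_part z * scal_part w)"
definition "r *\<^sub>R z = Unitized (r *\<^sub>R alg_part z) (r *\<^sub>R scal_part z)"

lemmas unitization_defs = zero_unitization_def one_unitization_def plus_unitization_def
  minus_unitization_def uminus_unitization_def times_unitization_def scaleR_unitization_def

instance
proof
  fix z w v :: "'a unitization" and r s :: real
  show "z + w + v = z + (w + v)" "z + w = w + z" "0 + z = z" "- z + z = 0" "z - w = z + - w"
    "r *\<^sub>R (z + w) = r *\<^sub>R z + r *\<^sub>R w" "(r + s) *\<^sub>R z = r *\<^sub>R z + s *\<^sub>R z"
    "r *\<^sub>R s *\<^sub>R z = (r * s) *\<^sub>R z" "1 *\<^sub>R z = z"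
    "1 * z = z" "z * 1 = z" "(0::'a unitization) \<noteq> 1"
    by (auto simp: unitization_defs algebra_simps intro!: unitization_eqI)
  show "z * w * v = z * (w * v)" "(z + w) * v = z * v + w * v" "z * (w + v) = z * w + z * v"
    by (auto simp: unitization_defs algebra_simps scaleC_add_right scaleC_add_left scaleC_scaleC
        scaleC_mult_left scaleC_mult_right intro!: unitization_eqI)
  show "r *\<^sub>R z * w = r *\<^sub>R (z * w)" "z * r *\<^sub>R w = r *\<^sub>R (z * w)"
    by (auto simp: unitization_defs scaleR_add_right scaleR_scaleC scaleR_complex_scaleC intro!: unitization_eqI)
qed

end

lemma unitization_sel [simp]:
  "alg_part (0::'a::cstar_algebra unitization) = 0" "scal_part (0::'a unitization) = 0"
  "alg_part (1::'a unitization) = 0" "scal_part (1::'a unitization) = 1"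
  "alg_part (z + w) = alg_part z + alg_part (w::'a unitization)"
  "scal_part (z + w) = scal_part z + scal_part w"
  "alg_part (z - w) = alg_part z - alg_part w" "scal_part (z - w) = scal_part z - scal_part w"
  "alg_part (- z) = - alg_part z" "scal_part (- z) = - scal_part z"
  "scal_part (z * w) = scal_part z * scal_part w"
  "alg_part (r *\<^sub>R z) = r *\<^sub>R alg_part z" "scal_part (r *\<^sub>R z) = r *\<^sub>R scal_part z"
  by (simp_all add: unitization_defs)

lemma alg_part_mult: "alg_part (z * w) = alg_part z * alg_part w +
    scal_part z *\<^sub>C alg_part w + scal_part w *\<^sub>C alg_part (z::'a::cstar_algebra unitization)"
  by (simp add: unitization_defs)

lemma mult_op_zero: "mult_op 0 = (\<lambda>b. 0)" by (simp add: mult_op_def fun_eq_iff)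
lemma mult_op_one: "mult_op 1 = (\<lambda>b. b)" by (simp add: mult_op_def fun_eq_iff)
lemma mult_op_add: "mult_op (z + w) = (\<lambda>b. mult_op z b + mult_op w b)"
  by (simp add: mult_op_def fun_eq_iff algebra_simps scaleC_add_left)
lemma mult_op_scaleR: "mult_op (r *\<^sub>R z) = (\<lambda>b. r *\<^sub>R mult_op z b)"
  by (simp add: mult_op_def fun_eq_iff scaleR_add_right scaleR_scaleC scaleR_complex_scaleC)
lemma mult_op_mult: "mult_op (z * w) = mult_op z \<circ> mult_op w"
  by (simp add: mult_op_def alg_part_mult fun_eq_iff algebra_simps scaleC_add_right scaleC_scaleC
      scaleC_mult_left scaleC_mult_right)

lemma onorm_mult_op_alg: "norm a \<le> onorm (mult_op (Unitized a 0))"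
proof (cases "a = 0")
  case True then show ?thesis by (simp add: onorm_pos_le bounded_linear_mult_op)
next
  case False
  have "norm (mult_op (Unitized a 0) (star a)) \<le> onorm (mult_op (Unitized a 0)) * norm (star a)"
    by (rule onorm[OF bounded_linear_mult_op])
  moreover have "norm (a * star a) = norm a * norm a"
    using cstar_identity[of "star a"] by (simp add: star_star norm_star power2_eq_square)
  ultimately show ?thesis using False by (simp add: mult_op_def norm_star)
qed

instantiation unitization :: (cstar_algebra) real_normed_algebra_1
begin

definition "norm z = max (cmod (scal_part z)) (onorm (mult_op z))"
definition "sgn (z :: 'a unitization) = z /\<^sub>R norm z"
definition "dist (z :: 'a unitization) w = norm (z - w)"
definition "(uniformity :: ('a unitization \<times> 'a unitization) filter) =
  (INF e\<in>{0 <..}. principal {(x, y). dist x y < e})"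
definition "open U \<longleftrightarrow>
  (\<forall>x\<in>U. \<forall>\<^sub>F (x', y) in uniformity. (x' :: 'a unitization) = x \<longrightarrow> y \<in> U)"

instance
proof
  fix z w :: "'a unitization" and r :: real and U :: "'a unitization set"
  show "sgn z = z /\<^sub>R norm z" "dist z w = norm (z - w)"
    "(uniformity :: ('a unitization \<times> 'a unitization) filter) =
      (INF e\<in>{0 <..}. principal {(x, y). dist x y < e})"
    "open U \<longleftrightarrow> (\<forall>x\<in>U. \<forall>\<^sub>F (x', y) in uniformity. x' = x \<longrightarrow> y \<in> U)"
    by (simp_all only: sgn_unitization_def dist_unitization_def uniformity_unitization_def
        open_unitization_def)
  show "norm z = 0 \<longleftrightarrow> z = 0"
  proof
    assume "norm z = 0"
    then have *: "scal_part z = 0" "onorm (mult_op z) \<le> 0"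
      unfolding norm_unitization_def by (metis max.cobounded1 norm_le_zero_iff, metis max.cobounded2)
    then have "z = Unitized (alg_part z) 0" by (intro unitization_eqI) auto
    then have "norm (alg_part z) \<le> 0" using onorm_mult_op_alg[of "alg_part z"] *(2) by (metis order_trans)
    then show "z = 0" using * by (intro unitization_eqI) auto
  qed (simp add: norm_unitization_def mult_op_zero onorm_zero)
  show "norm (z + w) \<le> norm z + norm w"
    using onorm_triangle[OF bounded_linear_mult_op bounded_linear_mult_op, of z w]
      norm_triangle_ineq[of "scal_part z" "scal_part w"]
    by (auto simp: norm_unitization_def mult_op_add)
  show "norm (r *\<^sub>R z) = \<bar>r\<bar> * norm z"
    by (simp add: norm_unitization_def mult_op_scaleR onorm_scaleR[OF bounded_linear_mult_op]
        max_mult_distrib_left)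
  show "norm (z * w) \<le> norm z * norm w"
  proof -
    have "onorm (mult_op (z * w)) \<le> onorm (mult_op z) * onorm (mult_op w)"
      unfolding mult_op_mult by (intro onorm_compose bounded_linear_mult_op)
    also have "\<dots> \<le> norm z * norm w"
      unfolding norm_unitization_def
      by (intro mult_mono) (auto intro: onorm_pos_le bounded_linear_mult_op simp: le_max_iff_disj)
    finally have "onorm (mult_op (z * w)) \<le> norm z * norm w" .
    moreover have "cmod (scal_part (z * w)) \<le> norm z * norm w"
      unfolding unitization_sel norm_mult norm_unitization_def
      by (intro mult_mono) (auto simp: le_max_iff_disj)
    ultimately show ?thesis by (simp add: norm_unitization_def[of "z * w"])
  qed
  have "onorm (\<lambda>x::'a. x) \<le> 1" by (rule onorm_id_le)
  then show "norm (1 :: 'a unitization) = 1"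
    by (simp add: norm_unitization_def mult_op_one max_def)
qed

end

lemma norm_alg_part_le: "norm (alg_part z) \<le> 2 * norm (z::'a::cstar_algebra unitization)"
proof -
  let ?w = "Unitized (alg_part z) 0"
  have eq: "mult_op ?w = (\<lambda>b. mult_op z b + mult_op (Unitized 0 (- scal_part z)) b)"
    using mult_op_add[of z "Unitized 0 (- scal_part z)"] by (simp add: plus_unitization_def)
  have m: "mult_op (Unitized 0 (- scal_part z)) b = (- scal_part z) *\<^sub>C b" for b :: 'a
    by (simp add: mult_op_def)
  have "norm (alg_part z) \<le> onorm (mult_op ?w)" by (rule onorm_mult_op_alg)
  also have "\<dots> \<le> onorm (mult_op z) + onorm (mult_op (Unitized 0 (- scal_part z) :: 'a unitization))"
    unfolding eq by (intro onorm_triangle bounded_linear_mult_op)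
  also have "onorm (mult_op (Unitized 0 (- scal_part z) :: 'a unitization)) \<le> cmod (scal_part z)"
    by (rule onorm_bound) (simp_all add: m norm_scaleC)
  finally show ?thesis by (auto simp: norm_unitization_def)
qed

lemma norm_Unitized_alg: "norm (Unitized a 0) = norm (a::'a::cstar_algebra)"
proof -
  have "onorm (mult_op (Unitized a 0)) \<le> norm a"
    by (rule onorm_bound) (simp_all add: mult_op_def norm_mult_ineq)
  then have "onorm (mult_op (Unitized a 0)) = norm a" using onorm_mult_op_alg[of a] by simp
  then show ?thesis by (simp add: norm_unitization_def)
qed

lemma norm_Unitized_le: "norm (Unitized a l) \<le> norm (a::'a::cstar_algebra) + cmod l"
proof -
  have "onorm (mult_op (Unitized a l)) \<le> norm a + cmod l"
  proof (rule onorm_bound)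
    fix b
    have "norm (mult_op (Unitized a l) b) \<le> norm (a * b) + norm (l *\<^sub>C b)"
      by (simp add: mult_op_def norm_triangle_ineq)
    also have "\<dots> \<le> (norm a + cmod l) * norm b"
      using norm_mult_ineq[of a b] by (simp add: norm_scaleC algebra_simps)
    finally show "norm (mult_op (Unitized a l) b) \<le> (norm a + cmod l) * norm b" .
  qed simp
  then show ?thesis by (simp add: norm_unitization_def)
qed

instantiation unitization :: (cstar_algebra) complex_normed_space
begin

definition "c *\<^sub>C z = Unitized (c *\<^sub>C alg_part z) (c * scal_part z)"

instance
proof
  fix z w :: "'a unitization" and c d :: complex and r :: real
  show "c *\<^sub>C (z + w) = c *\<^sub>C z + c *\<^sub>C w" "(c + d) *\<^sub>C z = c *\<^sub>C z + d *\<^sub>C z"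
    "c *\<^sub>C d *\<^sub>C z = (c * d) *\<^sub>C z" "complex_of_real r *\<^sub>C z = r *\<^sub>R z"
    by (auto simp: scaleC_unitization_def scaleC_add_right scaleC_add_left scaleC_scaleC
        scaleC_of_real algebra_simps intro!: unitization_eqI) (simp add: scaleR_conv_of_real)
  have le: "norm (c *\<^sub>C z) \<le> cmod c * norm z" for c and z :: "'a unitization"
  proof -
    have "mult_op (c *\<^sub>C z) b = c *\<^sub>C mult_op z b" for b
      by (simp add: mult_op_def scaleC_unitization_def scaleC_add_right scaleC_scaleC scaleC_mult_left)
    then have "norm (mult_op (c *\<^sub>C z) b) \<le> cmod c * onorm (mult_op z) * norm b" for b
      using onorm[OF bounded_linear_mult_op, of z b] by (simp add: norm_scaleC mult_left_mono mult.assoc)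
    then have "onorm (mult_op (c *\<^sub>C z)) \<le> cmod c * onorm (mult_op z)"
      by (rule onorm_bound[rotated]) (simp add: onorm_pos_le bounded_linear_mult_op)
    also have "\<dots> \<le> cmod c * norm z" by (simp add: norm_unitization_def mult_left_mono)
    finally have "onorm (mult_op (c *\<^sub>C z)) \<le> cmod c * norm z" .
    moreover have "cmod (scal_part (c *\<^sub>C z)) \<le> cmod c * norm z"
      by (simp add: scaleC_unitization_def norm_mult norm_unitization_def mult_left_mono)
    ultimately show ?thesis by (simp add: norm_unitization_def[of "c *\<^sub>C z"])
  qed
  show "norm (c *\<^sub>C z) = cmod c * norm z"
  proof (cases "c = 0")
    case True
    then show ?thesis using le[of c z] by simp
  next
    case False
    have "z = inverse c *\<^sub>C c *\<^sub>C z"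
      using False by (auto simp: scaleC_unitization_def scaleC_scaleC intro!: unitization_eqI)
    then have "norm z \<le> inverse (cmod c) * norm (c *\<^sub>C z)" using le norm_inverse by metis
    from mult_left_mono[OF this norm_ge_zero[of c]]
    have "cmod c * norm z \<le> norm (c *\<^sub>C z)" using False by (simp only: flip: mult.assoc) simp
    then show ?thesis using le[of c z] by simp
  qed
qed

end

instance unitization :: (cstar_algebra) complex_banach
proof
  fix X :: "nat \<Rightarrow> 'a unitization"
  assume X: "Cauchy X"
  have "Cauchy (\<lambda>n. alg_part (X n))"
  proof (rule CauchyI)
    fix e :: real assume "0 < e"
    then obtain M where M: "\<forall>m\<ge>M. \<forall>n\<ge>M. norm (X m - X n) < e/2" using CauchyD[OF X, of "e/2"] by auto
    have "norm (alg_part (X m) - alg_part (X n)) < e" if "m \<ge> M" "n \<ge> M" for m n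
      using norm_alg_part_le[of "X m - X n"] M that by fastforce
    then show "\<exists>M. \<forall>m\<ge>M. \<forall>n\<ge>M. norm (alg_part (X m) - alg_part (X n)) < e" by blast
  qed
  then obtain a where a: "(\<lambda>n. alg_part (X n)) \<longlonglongrightarrow> a"
    using Cauchy_convergent convergent_def by blast
  have "Cauchy (\<lambda>n. scal_part (X n))"
  proof (rule CauchyI)
    fix e :: real assume "0 < e"
    then obtain M where M: "\<forall>m\<ge>M. \<forall>n\<ge>M. norm (X m - X n) < e" using CauchyD[OF X] by blast
    have "norm (scal_part (X m) - scal_part (X n)) \<le> norm (X m - X n)" for m n
      by (simp add: norm_unitization_def)
    then show "\<exists>M. \<forall>m\<ge>M. \<forall>n\<ge>M. norm (scal_part (X m) - scal_part (X n)) < e"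
      using M by (meson le_less_trans)
  qed
  then obtain l where l: "(\<lambda>n. scal_part (X n)) \<longlonglongrightarrow> l"
    using Cauchy_convergent convergent_def by blast
  have "(\<lambda>n. norm (alg_part (X n) - a) + cmod (scal_part (X n) - l)) \<longlonglongrightarrow> 0"
    using a l by (auto intro!: tendsto_add_zero simp: LIM_zero tendsto_norm_zero)
  then have "(\<lambda>n. X n - Unitized a l) \<longlonglongrightarrow> 0"
    by (rule Lim_null_comparison[rotated]) (simp add: minus_unitization_def norm_Unitized_le)
  then show "convergent X" by (auto simp: convergent_def dest: LIM_zero_cancel)
qed

instantiation unitization :: (cstar_algebra) unital_cstar_algebra
begin

definition "star z = Unitized (star (alg_part z)) (cnj (scal_part z))"

instance
proof
  fix z w :: "'a unitization" and c :: complex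
  show "c *\<^sub>C z * w = c *\<^sub>C (z * w)" "z * c *\<^sub>C w = c *\<^sub>C (z * w)"
    by (auto simp: scaleC_unitization_def alg_part_mult scaleC_add_right scaleC_scaleC scaleC_mult_left
        scaleC_mult_right mult.commute intro!: unitization_eqI)
  show ss: "star (star z) = z" for z :: "'a unitization"
    by (auto simp: star_unitization_def star_star intro!: unitization_eqI)
  show "star (z + w) = star z + star w" "star (c *\<^sub>C z) = cnj c *\<^sub>C star z"
    "star (z * w) = star w * star z"
    by (auto simp: star_unitization_def star_add star_scaleC star_mult scaleC_unitization_def
        alg_part_mult intro!: unitization_eqI)
  have o: "onorm (mult_op z) \<ge> 0" for z :: "'a unitization" by (simp add: onorm_pos_le bounded_linear_mult_op)
  have max_sq: "max (a\<^sup>2) (b\<^sup>2) = (max a b)\<^sup>2" if "0 \<le> a" "0 \<le> b" for a b :: real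
    using that abs_le_square_iff[of a b] by (simp add: max_def)
  have adj: "star (mult_op z b) * c = star b * mult_op (star z) c" for z and b c :: 'a
    by (simp add: mult_op_def star_unitization_def star_add star_mult star_scaleC algebra_simps
        scaleC_mult_left scaleC_mult_right)
  have sq: "(onorm (mult_op z))\<^sup>2 \<le> onorm (mult_op (star z * z))" for z :: "'a unitization"
  proof -
    have "norm (mult_op z b) \<le> sqrt (onorm (mult_op (star z * z))) * norm b" for b
    proof (rule power2_le_imp_le)
      have "(norm (mult_op z b))\<^sup>2 = norm (star b * mult_op (star z * z) b)"
        unfolding cstar_identity[symmetric] adj by (simp add: mult_op_mult)
      also have "\<dots> \<le> norm b * (onorm (mult_op (star z * z)) * norm b)"
        using order_trans[OF norm_mult_ineq[of "star b"]
            mult_left_mono[OF onorm[OF bounded_linear_mult_op, of "star z * z" b] norm_ge_zero]]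
        by (simp only: norm_star)
      finally show "(norm (mult_op z b))\<^sup>2 \<le> (sqrt (onorm (mult_op (star z * z))) * norm b)\<^sup>2"
        using o by (simp add: power_mult_distrib power2_eq_square mult_ac)
    qed (simp add: o)
    then have "onorm (mult_op z) \<le> sqrt (onorm (mult_op (star z * z)))"
      by (rule onorm_bound[rotated]) (simp add: o)
    then show ?thesis using o by (metis real_sqrt_le_iff real_sqrt_abs abs_of_nonneg)
  qed
  have comp: "onorm (mult_op (star z * z)) \<le> onorm (mult_op (star z)) * onorm (mult_op z)" for z :: "'a unitization"
    unfolding mult_op_mult by (intro onorm_compose bounded_linear_mult_op)
  have le: "onorm (mult_op z) \<le> onorm (mult_op (star z))" for z :: "'a unitization"
  proof (cases "onorm (mult_op z) = 0")
    case False
    then show ?thesis using order_trans[OF sq[of z] comp[of z]] o[of z] by (simp add: power2_eq_square)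
  qed (simp add: o)
  have "onorm (mult_op (star z)) = onorm (mult_op z)" using le[of z] le[of "star z"] by (simp add: ss)
  then have "onorm (mult_op (star z * z)) = (onorm (mult_op z))\<^sup>2"
    using sq[of z] comp[of z] by (simp add: power2_eq_square)
  moreover have "cmod (scal_part (star z * z)) = (cmod (scal_part z))\<^sup>2"
    by (simp add: star_unitization_def norm_mult power2_eq_square)
  ultimately show "norm (star z * z) = (norm z)\<^sup>2"
    unfolding norm_unitization_def using max_sq[OF norm_ge_zero o] by (simp only:)
qed

end

section \<open>Positivity in a C*-algebra without unit\<close>

abbreviation embed_unit :: "'a::cstar_algebra \<Rightarrow> 'a unitization"
  where "embed_unit a \<equiv> Unitized a 0"

lemma embed_unit_simps:
  "embed_unit a + embed_unit b = embed_unit (a + b)"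
  "embed_unit a - embed_unit b = embed_unit (a - b)"
  "embed_unit a * embed_unit b = embed_unit (a * b)"
  "r *\<^sub>R embed_unit a = embed_unit (r *\<^sub>R a)"
  "star (embed_unit a) = embed_unit (star a)"
  by (simp_all add: unitization_defs star_unitization_def)

text \<open>
  The square root of a positive element of the algebra is formed in the unitization. It lies in the
  algebra again, because the scalar part of its square, and hence its own scalar part, is
  \<open>0\<close>. Sums and norms of elements \<open>star b * b\<close> are thereby controlled by the cone
  \<^const>\<open>psd\<close>.
\<close>

lemma cstar_positive_iff_psd: "cstar_positive a \<longleftrightarrow> psd (embed_unit a)"
proof
  assume "cstar_positive a"
  then obtain b where "a = star b * b" unfolding cstar_positive_def by blast
  then show "psd (embed_unit a)" using psd_star_mult_self[of "embed_unit b"] by (simp add: embed_unit_simps)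
next
  assume "psd (embed_unit a)"
  then obtain r where r: "psd r" "r * r = embed_unit a" using psd_sqrt by blast
  have "scal_part r = 0" using arg_cong[OF r(2), of scal_part] by simp
  then have *: "r = embed_unit (alg_part r)" by (intro unitization_eqI) auto
  have "star (alg_part r) = alg_part r"
    using arg_cong[OF psd_sa[OF r(1)], of alg_part] by (simp add: star_unitization_def)
  moreover have "alg_part r * alg_part r = a" using r(2) * by (metis embed_unit_simps(3) unitization.sel(1))
  ultimately show "cstar_positive a" unfolding cstar_positive_def by metis
qed

lemma cstar_positive_add: "cstar_positive a \<Longrightarrow> cstar_positive b \<Longrightarrow> cstar_positive (a + b)"
  using psd_add by (auto simp: cstar_positive_iff_psd simp flip: embed_unit_simps)

lemma cstar_positive_scaleR: "cstar_positive a \<Longrightarrow> 0 \<le> c \<Longrightarrow> cstar_positive (c *\<^sub>R a)"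
  using psd_scaleR by (auto simp: cstar_positive_iff_psd simp flip: embed_unit_simps)

lemma cstar_positive_zero [simp]: "cstar_positive 0"
  unfolding cstar_positive_def by (auto intro: exI[of _ 0])

lemma cstar_positive_norm_mono:
  "cstar_positive a \<Longrightarrow> cstar_positive b \<Longrightarrow> norm a \<le> norm (a + b)"
  using psd_norm_mono[of "embed_unit a" "embed_unit b"]
  by (simp add: cstar_positive_iff_psd embed_unit_simps norm_Unitized_alg)

lemma cstar_positive_conjugate:
  assumes "star h = h"
  shows "cstar_positive (norm h *\<^sub>R (star d * d) - star d * h * d)"
proof -
  have "psd (norm h *\<^sub>R 1 - embed_unit h)"
    using assms by (intro psd_norm_minus) (simp_all add: embed_unit_simps norm_Unitized_alg)
  then obtain r where r: "psd r" "r * r = norm h *\<^sub>R 1 - embed_unit h"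
    using psd_sqrt by blast
  have "psd (star (r * embed_unit d) * (r * embed_unit d))" by (rule psd_star_mult_self)
  also have "star (r * embed_unit d) * (r * embed_unit d) = embed_unit (star d) * (r * r) * embed_unit d"
    by (simp add: star_mult psd_sa[OF r(1)] embed_unit_simps mult.assoc)
  also have "\<dots> = embed_unit (norm h *\<^sub>R (star d * d) - star d * h * d)"
    unfolding r(2) by (simp add: algebra_simps embed_unit_simps)
  finally show ?thesis by (simp add: cstar_positive_iff_psd)
qed

text \<open>
  With \<open>x = h / norm h\<close> take \<open>e = 1 - (1 - x) ^ n\<close>, which lies in the algebra. The expression
  is \<open>(1 - e) * h * (1 - e)\<close>, and its norm is at most \<open>norm (h * (1 - x) ^ n)\<close>.
\<close>

lemma ex_approximate_unit:
  assumes h: "cstar_positive (h::'a::cstar_algebra)" and eps: "0 < \<epsilon>"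
  shows "\<exists>e. star e = e \<and> norm (h - e * h - h * e + e * h * e) < \<epsilon>"
proof (cases "h = 0")
  case True
  then show ?thesis using eps by (intro exI[of _ 0]) simp
next
  case False
  define x where "x = (1 / norm h) *\<^sub>R embed_unit h"
  have h': "psd (embed_unit h)" using h by (simp add: cstar_positive_iff_psd)
  have x: "psd x" unfolding x_def using h' by (intro psd_scaleR) simp_all
  have nx: "norm x \<le> 1" using False by (simp add: x_def norm_Unitized_alg)
  have k: "psd (1 - x)" using psd_norm_minus[OF psd_sa[OF x] nx] by simp
  have nk: "norm (1 - x) \<le> 1" using psd_norm_le[OF k, of 1] x by simp
  obtain n where n: "norm h / \<epsilon> < real n" using reals_Archimedean2 by blast
  define k where "k = (1 - x) ^ n"
  have sk: "star k = k" by (simp add: k_def star_power psd_sa[OF k])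
  have "scal_part (z ^ n) = scal_part z ^ n" for z :: "'a unitization" by (induction n) simp_all
  then have "scal_part (1 - k) = 0" by (simp add: k_def x_def)
  define e where "e = alg_part (1 - k)"
  have e: "1 - k = embed_unit e"
    using \<open>scal_part (1 - k) = 0\<close> by (intro unitization_eqI) (simp_all add: e_def)
  have "embed_unit (h - e * h - h * e + e * h * e)
      = embed_unit h - (1 - k) * embed_unit h - embed_unit h * (1 - k) + (1 - k) * embed_unit h * (1 - k)"
    unfolding e by (simp add: embed_unit_simps)
  also have "\<dots> = norm h *\<^sub>R (k * (x * k))"
    using False by (simp add: x_def algebra_simps)
  finally have eq: "norm (h - e * h - h * e + e * h * e) = norm h * norm (k * (x * k))"
    by (metis norm_Unitized_alg norm_scaleR abs_norm_cancel)
  have "norm (k * (x * k)) \<le> norm k * norm (x * k)" by (rule norm_mult_ineq)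
  also have "\<dots> \<le> 1 * (1 / real (Suc n))"
  proof (rule mult_mono)
    show "norm k \<le> 1" unfolding k_def using nk by (meson norm_power_ineq power_le_one norm_ge_zero order_trans)
    show "norm (x * k) \<le> 1 / real (Suc n)" unfolding k_def by (rule norm_mult_power_one_minus[OF x \<open>psd (1 - x)\<close>])
  qed auto
  finally have "norm (k * (x * k)) \<le> 1 / real (Suc n)" by simp
  then have "norm h * norm (k * (x * k)) \<le> norm h * (1 / real (Suc n))"
    by (rule mult_left_mono) simp
  also have "\<dots> < \<epsilon>" using n eps by (simp add: field_simps)
  finally have "norm (h - e * h - h * e + e * h * e) < \<epsilon>" unfolding eq .
  moreover have "star e = e"
    using arg_cong[OF sk, of alg_part] by (simp add: e_def star_unitization_def star_minus)
  ultimately show ?thesis by blast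
qed

section \<open>Extreme points below a sublinear functional\<close>

definition sublinear :: "('v::real_vector \<Rightarrow> real) \<Rightarrow> bool"
  where "sublinear p \<longleftrightarrow> (\<forall>x y. p (x + y) \<le> p x + p y) \<and> (\<forall>c x. 0 \<le> c \<longrightarrow> p (c *\<^sub>R x) = c * p x)"

lemma sublinearD:
  assumes "sublinear p"
  shows "p (x + y) \<le> p x + p y" "0 \<le> c \<Longrightarrow> p (c *\<^sub>R x) = c * p x" "p 0 = 0" "- p (- x) \<le> p x"
proof -
  show 1: "p (x + y) \<le> p x + p y" for x y using assms by (simp add: sublinear_def)
  show "0 \<le> c \<Longrightarrow> p (c *\<^sub>R x) = c * p x" using assms by (simp add: sublinear_def)
  have "p (0 *\<^sub>R 0) = 0 * p 0" using assms by (simp only: sublinear_def)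
  then show 0: "p 0 = 0" by simp
  show "- p (- x) \<le> p x" using 1[of x "-x"] 0 by simp
qed

lemma sublinearI:
  assumes add: "\<And>x y. p (x + y) \<le> p x + p y" and scale: "\<And>c x. 0 < c \<Longrightarrow> c * p x \<le> p (c *\<^sub>R x)"
    and zero: "p 0 = 0"
  shows "sublinear p"
proof -
  have "p (c *\<^sub>R x) = c * p x" if "0 \<le> c" for c x
  proof (cases "c = 0")
    case False
    with that have c: "0 < c" by simp
    have "p (c *\<^sub>R x) = c * (inverse c * p (c *\<^sub>R x))" using c by simp
    also have "\<dots> \<le> c * p x" using scale[of "inverse c" "c *\<^sub>R x"] c by (intro mult_left_mono) auto
    finally show ?thesis using scale[OF c] by (simp add: antisym)
  qed (simp add: zero)
  with add show ?thesis unfolding sublinear_def by blast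
qed

text \<open>
  A sublinear functional \<open>q\<close> stands for the convex set of linear functionals below it. The
  definition says that the set of \<open>q\<close> is a face of the set of \<open>p\<close>, in a form
  in which \<open>q\<close> itself need not be linear.
\<close>

definition facial :: "('v::real_vector \<Rightarrow> real) \<Rightarrow> ('v \<Rightarrow> real) \<Rightarrow> bool"
  where "facial q p \<longleftrightarrow> q \<le> p \<and>
    (\<forall>g h t. linear g \<and> linear h \<and> g \<le> p \<and> h \<le> p \<and> 0 < t \<and> t < 1 \<and>
      (\<lambda>x. t * g x + (1 - t) * h x) \<le> q \<longrightarrow> g \<le> q \<and> h \<le> q)"

text \<open>
  This is the functional of the face of \<open>q\<close> on which evaluation at \<open>v\<close> is maximal, that is,
  on which it equals \<open>q v\<close>.
\<close>

definition max_face :: "('v::real_vector \<Rightarrow> real) \<Rightarrow> 'v \<Rightarrow> 'v \<Rightarrow> real"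
  where "max_face q v x = Inf {q (x + t *\<^sub>R v) - t * q v | t. 0 \<le> t}"

lemma max_face:
  assumes q: "sublinear q"
  shows max_face_le: "0 \<le> t \<Longrightarrow> max_face q v x \<le> q (x + t *\<^sub>R v) - t * q v"
    and max_face_ge: "(\<And>t. 0 \<le> t \<Longrightarrow> b \<le> q (x + t *\<^sub>R v) - t * q v) \<Longrightarrow> b \<le> max_face q v x"
proof -
  have "- q (- x) \<le> q (x + t *\<^sub>R v) - t * q v" if "0 \<le> t" for t
    using sublinearD(1)[OF q, of "x + t *\<^sub>R v" "- x"] sublinearD(2)[OF q that, of v] by simp
  then have "bdd_below {q (x + t *\<^sub>R v) - t * q v | t. 0 \<le> t}" by (auto intro!: bdd_belowI)
  then show "0 \<le> t \<Longrightarrow> max_face q v x \<le> q (x + t *\<^sub>R v) - t * q v"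
    unfolding max_face_def by (intro cInf_lower) auto
  show "(\<And>t. 0 \<le> t \<Longrightarrow> b \<le> q (x + t *\<^sub>R v) - t * q v) \<Longrightarrow> b \<le> max_face q v x"
    unfolding max_face_def by (intro cInf_greatest) auto
qed

lemma sublinear_max_face:
  assumes q: "sublinear q"
  shows "sublinear (max_face q v)"
proof -
  note le = max_face_le[OF q] and ge = max_face_ge[OF q]
  have add: "max_face q v (x + y) \<le> max_face q v x + max_face q v y" for x y
  proof -
    have "max_face q v (x + y) - (q (y + s *\<^sub>R v) - s * q v) \<le> max_face q v x" if s: "0 \<le> s" for s
    proof (rule ge)
      fix t :: real assume t: "0 \<le> t"
      have "max_face q v (x + y) \<le> q (x + y + (t + s) *\<^sub>R v) - (t + s) * q v"
        using s t by (intro le) auto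
      also have "x + y + (t + s) *\<^sub>R v = (x + t *\<^sub>R v) + (y + s *\<^sub>R v)" by (simp add: algebra_simps)
      also have "q \<dots> \<le> q (x + t *\<^sub>R v) + q (y + s *\<^sub>R v)" by (rule sublinearD(1)[OF q])
      finally show "max_face q v (x + y) - (q (y + s *\<^sub>R v) - s * q v) \<le> q (x + t *\<^sub>R v) - t * q v"
        by (simp add: algebra_simps)
    qed
    then have "max_face q v (x + y) - max_face q v x \<le> max_face q v y"
      by (intro ge) (simp add: algebra_simps)
    then show ?thesis by simp
  qed
  have scale_le: "c * max_face q v x \<le> max_face q v (c *\<^sub>R x)" if c: "0 < c" for c x
  proof (rule ge)
    fix t :: real assume t: "0 \<le> t"
    have "c * max_face q v x \<le> c * (q (x + (t / c) *\<^sub>R v) - (t / c) * q v)"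
      using c t by (intro mult_left_mono le) auto
    also have "\<dots> = q (c *\<^sub>R (x + (t / c) *\<^sub>R v)) - t * q v"
      using c by (simp add: sublinearD(2)[OF q] right_diff_distrib del: scaleR_add_right)
    also have "c *\<^sub>R (x + (t / c) *\<^sub>R v) = c *\<^sub>R x + t *\<^sub>R v" using c by (simp add: algebra_simps)
    finally show "c * max_face q v x \<le> q (c *\<^sub>R x + t *\<^sub>R v) - t * q v" .
  qed
  have zero: "max_face q v 0 = 0"
  proof (rule antisym)
    show "max_face q v 0 \<le> 0" using le[of 0 v 0] sublinearD(3)[OF q] by simp
    show "0 \<le> max_face q v 0" by (rule ge) (simp add: sublinearD(2)[OF q])
  qed
  show ?thesis using add scale_le zero by (rule sublinearI)
qed

text \<open>
  If a proper convex combination of \<open>g\<close> and \<open>h\<close> lies below \<open>max_face q v\<close>, then it equals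
  \<open>q v\<close> at \<open>v\<close>. As \<open>g\<close> and \<open>h\<close> are at most \<open>q v\<close> there, both attain this value.
\<close>

lemma facial_max_face:
  assumes q: "sublinear q" and qp: "facial q p"
  shows "facial (max_face q v) p"
proof -
  have mq: "max_face q v \<le> q" using max_face_le[OF q, of 0 v] by (auto simp: le_fun_def)
  have "g \<le> max_face q v \<and> h \<le> max_face q v"
    if lg: "linear g" and lh: "linear h" and "g \<le> p" "h \<le> p" and t: "0 < t" "t < 1"
      and m: "(\<lambda>x. t * g x + (1 - t) * h x) \<le> max_face q v" for g h t
  proof -
    have "(\<lambda>x. t * g x + (1 - t) * h x) \<le> q" using m mq by (rule order_trans)
    then have gh: "g \<le> q" "h \<le> q" using qp that unfolding facial_def by blast+
    have "t * g (- v) + (1 - t) * h (- v) \<le> max_face q v (- v)" using m by (auto dest: le_funD)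
    also have "\<dots> \<le> - q v" using max_face_le[OF q, of 1 v "- v"] by (simp add: sublinearD(3)[OF q])
    finally have *: "q v \<le> t * g v + (1 - t) * h v" by (simp add: linear_neg[OF lg] linear_neg[OF lh])
    have "t * g v \<le> t * q v" "(1 - t) * h v \<le> (1 - t) * q v"
      using gh t by (auto intro!: mult_left_mono dest: le_funD)
    then have "t * g v = t * q v" "(1 - t) * h v = (1 - t) * q v" using * by argo+
    then have eq: "g v = q v" "h v = q v" using t by auto
    have "k x \<le> max_face q v x" if k: "linear k" "k \<le> q" "k v = q v" for k x
    proof (rule max_face_ge[OF q])
      fix s :: real assume "0 \<le> s"
      have "k x = k (x + s *\<^sub>R v) - s * q v" using k by (simp add: linear_add linear_scale)
      then show "k x \<le> q (x + s *\<^sub>R v) - s * q v" using le_funD[OF k(2)] by simp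
    qed
    then show ?thesis using lg lh gh eq by (auto simp: le_fun_def)
  qed
  then show ?thesis using mq qp unfolding facial_def by (blast intro: order_trans)
qed

lemma Inf_chain_of_faces:
  assumes C: "C \<noteq> {}" "\<And>q. q \<in> C \<Longrightarrow> sublinear q \<and> facial q p"
    and chain: "\<And>q q'. q \<in> C \<Longrightarrow> q' \<in> C \<Longrightarrow> q \<le> q' \<or> q' \<le> q"
  defines "m \<equiv> \<lambda>x. INF q\<in>C. q x"
  shows "sublinear m" "facial m p" "\<And>q. q \<in> C \<Longrightarrow> m \<le> q"
proof -
  obtain q0 where q0: "q0 \<in> C" using C by blast
  have lb: "- q0 (- x) \<le> q x" if "q \<in> C" for q x
    using chain[OF that q0] sublinearD(4)[of q x] sublinearD(4)[of q0 x] C(2)[OF that] C(2)[OF q0]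
    by (auto dest: le_funD[of _ _ x] le_funD[of _ _ "-x"] intro: order_trans)
  then have bdd: "bdd_below ((\<lambda>q. q x) ` C)" for x by (auto intro!: bdd_belowI)
  have le: "m x \<le> q x" if "q \<in> C" for q x
    unfolding m_def using bdd that by (intro cINF_lower) auto
  have ge: "b \<le> m x" if "\<And>q. q \<in> C \<Longrightarrow> b \<le> q x" for b x
    unfolding m_def using C(1) that by (intro cINF_greatest) auto
  show "m \<le> q" if "q \<in> C" for q using le[OF that] by (auto simp: le_fun_def)
  have add: "m (x + y) \<le> m x + m y" for x y
  proof -
    have "m (x + y) - r y \<le> m x" if r: "r \<in> C" for r
    proof (rule ge)
      fix q assume q: "q \<in> C"
      obtain k where k: "k \<in> C" "k \<le> q" "k \<le> r" using chain[OF q r] q r by blast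
      have "m (x + y) \<le> k x + k y" using le[OF k(1), of "x + y"] sublinearD(1)[of k x y] C(2)[OF k(1)] by linarith
      also have "\<dots> \<le> q x + r y" using k by (intro add_mono) (auto dest: le_funD)
      finally show "m (x + y) - r y \<le> q x" by simp
    qed
    then have "m (x + y) - m x \<le> m y" by (intro ge) (simp add: algebra_simps)
    then show ?thesis by simp
  qed
  have pos: "c * m x \<le> m (c *\<^sub>R x)" if "0 < c" for c x
  proof (rule ge)
    fix q assume q: "q \<in> C"
    have "c * m x \<le> c * q x" using le[OF q] that by (simp add: mult_left_mono)
    then show "c * m x \<le> q (c *\<^sub>R x)" using sublinearD(2)[of q c x] C(2)[OF q] that by simp
  qed
  have "m 0 \<le> 0" using le[OF q0, of 0] C(2)[OF q0] by (simp add: sublinearD(3))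
  moreover have "0 \<le> m 0" by (rule ge) (use C(2) in \<open>simp add: sublinearD(3)\<close>)
  ultimately show "sublinear m" using sublinearI[OF add pos] by simp
  have "m \<le> p" using le[OF q0] C(2)[OF q0] unfolding facial_def by (auto simp: le_fun_def intro: order_trans)
  moreover have "g \<le> m \<and> h \<le> m"
    if "linear g" "linear h" "g \<le> p" "h \<le> p" "0 < t" "t < 1" "(\<lambda>x. t * g x + (1 - t) * h x) \<le> m" for g h t
  proof -
    have "g \<le> q \<and> h \<le> q" if q: "q \<in> C" for q
    proof -
      have "(\<lambda>x. t * g x + (1 - t) * h x) \<le> q"
        using \<open>_ \<le> m\<close> le[OF q] by (auto simp: le_fun_def intro: order_trans)
      then show ?thesis using C(2)[OF q] that \<open>linear g\<close> \<open>linear h\<close> \<open>g \<le> p\<close> \<open>h \<le> p\<close> \<open>0 < t\<close> \<open>t < 1\<close>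
        unfolding facial_def by blast
    qed
    then show ?thesis by (auto simp: le_fun_def intro!: ge)
  qed
  ultimately show "facial m p" unfolding facial_def by blast
qed

text \<open>
  The theorems of Hahn-Banach and Krein-Milman in one, without a topology. Zorn's lemma gives a
  minimal sublinear \<open>q\<close> among those that are faces of \<open>p\<close> contained in the face where
  evaluation at \<open>v\<close> is maximal. Minimality means that every \<open>max_face q w\<close> equals \<open>q\<close>, which
  forces \<open>q (- w) = - q w\<close>, so \<open>q\<close> is linear; the face of a linear functional consists of
  that functional only, so \<open>q\<close> is an extreme point.
\<close>

lemma ex_extreme_linear_below_sublinear:
  fixes p :: "'v::real_vector \<Rightarrow> real"
  assumes p: "sublinear p"
  obtains q where "linear q" "q \<le> p" "q v = p v"
    "\<And>g h t. linear g \<Longrightarrow> linear h \<Longrightarrow> g \<le> p \<Longrightarrow> h \<le> p \<Longrightarrow> 0 < t \<Longrightarrow> t < 1 \<Longrightarrow>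
      q = (\<lambda>x. t * g x + (1 - t) * h x) \<Longrightarrow> g = q \<and> h = q"
proof -
  define F where "F = {q. sublinear q \<and> facial q p \<and> q (- v) \<le> - p v}"
  have "facial p p" unfolding facial_def by auto
  then have "max_face p v \<in> F"
    using sublinear_max_face[OF p] facial_max_face[OF p] max_face_le[OF p, of 1 v "- v"]
    by (auto simp: F_def sublinearD(3)[OF p])
  have po: "partial_order_on F {(a, b). a \<in> F \<and> b \<in> F \<and> b \<le> a}"
    by (auto simp: partial_order_on_def preorder_on_def refl_on_def trans_def antisym_def)
  have "\<exists>q\<in>F. \<forall>r\<in>F. (q, r) \<in> {(a, b). a \<in> F \<and> b \<in> F \<and> b \<le> a} \<longrightarrow> r = q"
  proof (rule Zorns_po_lemma[of "{(a, b). a \<in> F \<and> b \<in> F \<and> b \<le> a}", THEN bexE])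
    have fld: "Field {(a, b). a \<in> F \<and> b \<in> F \<and> b \<le> a} = F" by (auto simp: Field_def)
    show "Partial_order {(a, b). a \<in> F \<and> b \<in> F \<and> b \<le> a}" using po by (simp add: fld)
    fix C assume C: "C \<in> Chains {(a, b). a \<in> F \<and> b \<in> F \<and> b \<le> a}"
    show "\<exists>u\<in>Field {(a, b). a \<in> F \<and> b \<in> F \<and> b \<le> a}. \<forall>a\<in>C. (a, u) \<in> {(a, b). a \<in> F \<and> b \<in> F \<and> b \<le> a}"
    proof (cases "C = {}")
      case True
      then show ?thesis using \<open>max_face p v \<in> F\<close> by (auto simp: fld)
    next
      case False
      have CF: "C \<subseteq> F" "\<And>q q'. q \<in> C \<Longrightarrow> q' \<in> C \<Longrightarrow> q \<le> q' \<or> q' \<le> q"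
        using C by (auto simp: Chains_def)
      define m where "m = (\<lambda>x. INF q\<in>C. q x)"
      have m: "sublinear m" "facial m p" "\<And>q. q \<in> C \<Longrightarrow> m \<le> q"
        unfolding m_def by (rule Inf_chain_of_faces; use False CF in \<open>auto simp: F_def\<close>)+
      obtain q0 where "q0 \<in> C" using False by blast
      then have "m (- v) \<le> - p v" using m(3)[of q0] CF(1) by (auto simp: F_def dest: le_funD intro: order_trans)
      then have "m \<in> F" using m by (simp add: F_def)
      then show ?thesis using m(3) CF(1) by (auto simp: fld)
    qed
  next
    fix q assume "q \<in> Field {(a, b). a \<in> F \<and> b \<in> F \<and> b \<le> a}"
      and "\<forall>a\<in>Field {(a, b). a \<in> F \<and> b \<in> F \<and> b \<le> a}. (q, a) \<in> {(a, b). a \<in> F \<and> b \<in> F \<and> b \<le> a} \<longrightarrow> a = q"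
    then show ?thesis by (auto simp: Field_def)
  qed
  then obtain q where q: "q \<in> F" "\<And>r. r \<in> F \<Longrightarrow> r \<le> q \<Longrightarrow> r = q" by blast
  have sq: "sublinear q" and fq: "facial q p" and qv: "q (- v) \<le> - p v" using q(1) by (auto simp: F_def)
  have eq: "max_face q w = q" for w
  proof (rule q(2))
    show le: "max_face q w \<le> q" using max_face_le[OF sq, of 0 w] by (auto simp: le_fun_def)
    then show "max_face q w \<in> F"
      using sublinear_max_face[OF sq] facial_max_face[OF sq fq] qv
      by (auto simp: F_def dest: le_funD intro: order_trans)
  qed
  have neg: "q (- w) = - q w" for w
    using max_face_le[OF sq, of 1 w "- w"] sublinearD(4)[OF sq, of w] by (simp add: eq sublinearD(3)[OF sq])
  have lin: "linear q"
  proof (rule linearI)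
    show "q (x + y) = q x + q y" for x y
      using sublinearD(1)[OF sq, of x y] sublinearD(1)[OF sq, of "- x" "- y"] neg[of x] neg[of y] neg[of "x + y"]
      by simp
    show "q (c *\<^sub>R x) = c *\<^sub>R q x" for c x
      using sublinearD(2)[OF sq, of c x] sublinearD(2)[OF sq, of "- c" x] neg[of "c *\<^sub>R x"]
      by (cases "0 \<le> c") simp_all
  qed
  have qp: "q \<le> p" using fq by (simp add: facial_def)
  show ?thesis
  proof (rule that[OF lin qp])
    show "q v = p v" using neg[of v] qv le_funD[OF qp, of v] by simp
    fix g h :: "'v \<Rightarrow> real" and t :: real
    assume *: "linear g" "linear h" "g \<le> p" "h \<le> p" "0 < t" "t < 1" "q = (\<lambda>x. t * g x + (1 - t) * h x)"
    have gh: "g \<le> q \<and> h \<le> q"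
      using fq[unfolded facial_def] *(1-6) eq_refl[OF *(7)[symmetric]] by blast
    have "k = q" if k: "linear k" "k \<le> q" for k
    proof
      fix x
      show "k x = q x"
        using le_funD[OF k(2), of x] le_funD[OF k(2), of "- x"] by (simp add: neg linear_neg[OF k(1)])
    qed
    then show "g = q \<and> h = q" using *(1,2) gh by blast
  qed
qed

section \<open>Semi-inner products\<close>

text \<open>
  Positive functionals on the algebra and their localizations of the module both give positive
  semidefinite forms. Completions are avoided as long as possible: a Cauchy sequence for the
  seminorm \<open>sn\<close> below takes the place of a vector of the Hilbert space.
\<close>

locale semi_inner =
  fixes s :: "'v::complex_normed_space \<Rightarrow> 'v \<Rightarrow> complex"
  assumes add_right: "s x (y + z) = s x y + s x z"
    and scale_right: "s x (c *\<^sub>C y) = c * s x y"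
    and hermitian: "s y x = cnj (s x y)"
    and nonneg: "0 \<le> Re (s x x)"
begin

definition sn :: "'v \<Rightarrow> real" where "sn x = sqrt (Re (s x x))"

lemma add_left: "s (x + y) z = s x z + s y z"
  by (subst (1 2 3) hermitian) (simp add: add_right)

lemma scale_left: "s (c *\<^sub>C x) y = cnj c * s x y"
  by (subst (1 2) hermitian) (simp add: scale_right)

lemma zero_right [simp]: "s x 0 = 0" using add_right[of x 0 0] by simp
lemma zero_left [simp]: "s 0 x = 0" using add_left[of 0 0 x] by simp

lemma minus_right: "s x (- y) = - s x y"
  using scale_right[of x "-1" y] by simp
lemma minus_left: "s (- x) y = - s x y"
  using scale_left[of "-1" x y] by simp

lemma diff_right: "s x (y - z) = s x y - s x z"
  using add_right[of x y "- z"] by (simp add: minus_right)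
lemma diff_left: "s (x - y) z = s x z - s y z"
  using add_left[of x "- y" z] by (simp add: minus_left)

lemma self: "s x x = complex_of_real ((sn x)\<^sup>2)"
proof (rule complex_eqI)
  have "Im (s x x) = - Im (s x x)" using arg_cong[OF hermitian[of x x], of Im] by simp
  then show "Im (s x x) = Im (complex_of_real ((sn x)\<^sup>2))" by simp
qed (simp add: sn_def nonneg)

lemma sn_nonneg [simp]: "0 \<le> sn x" by (simp add: sn_def nonneg)
lemma norm_self: "cmod (s x x) = (sn x)\<^sup>2" by (simp only: self) (simp add: norm_power)
lemma sn_zero [simp]: "sn 0 = 0" by (simp add: sn_def)
lemma sn_minus: "sn (- x) = sn x" by (simp add: sn_def minus_left minus_right)

lemma sn_diff_commute: "sn (x - y) = sn (y - x)" using sn_minus[of "x - y"] by simp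

lemma sn_scaleC: "sn (c *\<^sub>C x) = cmod c * sn x"
proof (rule power2_eq_imp_eq)
  have "complex_of_real ((sn (c *\<^sub>C x))\<^sup>2) = cnj c * c * complex_of_real ((sn x)\<^sup>2)"
    unfolding self[symmetric] by (simp add: scale_left scale_right)
  also have "\<dots> = complex_of_real ((cmod c * sn x)\<^sup>2)"
    by (simp add: power_mult_distrib mult.commute[of "cnj c"] flip: complex_norm_square)
  finally show "(sn (c *\<^sub>C x))\<^sup>2 = (cmod c * sn x)\<^sup>2" by (simp only: of_real_eq_iff)
qed simp_all

lemma sn_add_sq: "(sn (x + y))\<^sup>2 = (sn x)\<^sup>2 + 2 * Re (s x y) + (sn y)\<^sup>2"
proof -
  have "s (x + y) (x + y) = s x x + s x y + cnj (s x y) + s y y"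
    using hermitian[of x y] by (simp add: add_left add_right)
  then have "Re (s (x + y) (x + y)) = Re (s x x) + 2 * Re (s x y) + Re (s y y)" by simp
  then show ?thesis by (simp add: self)
qed

text \<open>
  Inserting \<open>c y\<close> for \<open>y\<close> with the best scalar \<open>c\<close> turns a lower bound for a
  quadratic function into a bound for its linear part. Both the Cauchy-Schwarz inequality and the
  representation of functionals below are instances.
\<close>

lemma linear_bound:
  assumes lin: "\<And>c y. \<phi> (c *\<^sub>C y) = c * \<phi> y"
    and bound: "\<And>y. - (\<delta> * \<delta>) \<le> 2 * Re (\<phi> y) + (sn y)\<^sup>2" and d: "0 \<le> \<delta>"
  shows "cmod (\<phi> y) \<le> \<delta> * sn y"
proof -
  have *: "2 * t * cmod (\<phi> y) \<le> \<delta> * \<delta> + t * t * (sn y)\<^sup>2" if "0 \<le> t" for t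
  proof -
    define c where "c = (if \<phi> y = 0 then 0 else - complex_of_real t * cnj (\<phi> y) / cmod (\<phi> y))"
    have "cmod c \<le> t" using that by (simp add: c_def norm_divide norm_mult)
    have "cnj (\<phi> y) * \<phi> y = complex_of_real (cmod (\<phi> y)) * complex_of_real (cmod (\<phi> y))"
      using complex_norm_square[of "\<phi> y"] by (simp add: power2_eq_square mult.commute)
    then have "c * \<phi> y = - complex_of_real (t * cmod (\<phi> y))"
      by (simp add: c_def mult.assoc)
    then have "2 * t * cmod (\<phi> y) \<le> \<delta> * \<delta> + (cmod c * sn y)\<^sup>2"
      using bound[of "c *\<^sub>C y"] by (simp add: lin sn_scaleC)
    also have "(cmod c * sn y)\<^sup>2 \<le> (t * sn y)\<^sup>2"
      using \<open>cmod c \<le> t\<close> by (intro power_mono mult_right_mono) auto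
    finally show ?thesis by (simp add: power2_eq_square mult_ac)
  qed
  show ?thesis
  proof (cases "sn y = 0")
    case True
    have "cmod (\<phi> y) \<le> 0"
    proof (rule ccontr)
      assume "\<not> cmod (\<phi> y) \<le> 0"
      then have p: "0 < cmod (\<phi> y)" by simp
      then show False
        using *[of "(\<delta> * \<delta> + 1) / cmod (\<phi> y)"] True zero_le_square[of \<delta>]
        by (simp add: divide_simps)
    qed
    then show ?thesis using True by simp
  next
    case False
    then have p: "0 < sn y" using sn_nonneg[of y] by linarith
    have "2 * (\<delta> / sn y) * cmod (\<phi> y) \<le> \<delta> * \<delta> + (\<delta> / sn y) * (\<delta> / sn y) * (sn y)\<^sup>2"
      by (rule *) (use p d in simp)
    then have "2 * \<delta> * cmod (\<phi> y) \<le> 2 * \<delta> * (\<delta> * sn y)"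
      using p by (simp add: power2_eq_square field_simps)
    then show ?thesis
    proof (cases "\<delta> = 0")
      case True
      have "2 * t * cmod (\<phi> y) \<le> t * t * (sn y)\<^sup>2" if "0 \<le> t" for t using *[OF that] True by simp
      from this[of "cmod (\<phi> y) / (sn y)\<^sup>2"] p have "cmod (\<phi> y) * cmod (\<phi> y) \<le> 0"
        by (simp add: power2_eq_square field_simps)
      then show ?thesis using True by (simp add: mult_le_0_iff)
    qed (use d in simp)
  qed
qed

lemma cauchy_schwarz: "cmod (s x y) \<le> sn x * sn y"
proof (rule linear_bound)
  fix y
  have "0 \<le> (sn (x + y))\<^sup>2" by simp
  then show "- (sn x * sn x) \<le> 2 * Re (s x y) + (sn y)\<^sup>2"
    unfolding sn_add_sq by (simp add: power2_eq_square)
qed (simp_all add: scale_right)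

lemma inner_diff_le: "cmod (s x y - s x' y') \<le> sn (x - x') * sn y + sn x' * sn (y - y')"
proof -
  have "s x y - s x' y' = s (x - x') y + s x' (y - y')" by (simp add: diff_left diff_right)
  then have "cmod (s x y - s x' y') \<le> cmod (s (x - x') y) + cmod (s x' (y - y'))"
    by (simp only: norm_triangle_ineq)
  also have "\<dots> \<le> sn (x - x') * sn y + sn x' * sn (y - y')" by (intro add_mono cauchy_schwarz)
  finally show ?thesis .
qed

lemma sn_triangle: "sn (x + y) \<le> sn x + sn y"
proof (rule power2_le_imp_le)
  have "Re (s x y) \<le> sn x * sn y" using cauchy_schwarz complex_Re_le_cmod order_trans by blast
  then show "(sn (x + y))\<^sup>2 \<le> (sn x + sn y)\<^sup>2" by (simp add: sn_add_sq power2_sum)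
qed simp

lemma sn_triangle_diff: "sn (x - z) \<le> sn (x - y) + sn (y - z)"
  using sn_triangle[of "x - y" "y - z"] by simp

text \<open>
  A near-minimizer \<open>x\<close> of \<open>(sn x)\<^sup>2 - 2 * Re (\<psi> x)\<close> represents \<open>\<psi>\<close> up to a small
  error, since moving away from \<open>x\<close> cannot lower the value by more than the error allowed.
\<close>

lemma approximate_riesz:
  assumes lin: "\<And>y z. \<psi> (y + z) = \<psi> y + \<psi> z" "\<And>c y. \<psi> (c *\<^sub>C y) = c * \<psi> y"
    and bound: "\<And>y. cmod (\<psi> y) \<le> C * sn y" and e: "0 < \<epsilon>"
  shows "\<exists>x. \<forall>y. cmod (s x y - \<psi> y) \<le> \<epsilon> * sn y"
proof -
  define J where "J x = (sn x)\<^sup>2 - 2 * Re (\<psi> x)" for x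
  have "- (C * C) \<le> J x" for x
  proof -
    have "Re (\<psi> x) \<le> C * sn x" using bound[of x] complex_Re_le_cmod[of "\<psi> x"] by linarith
    moreover have "0 \<le> (sn x - C)\<^sup>2" by simp
    ultimately show ?thesis by (simp add: J_def power2_eq_square algebra_simps)
  qed
  then have bdd: "bdd_below (range J)" by (auto intro!: bdd_belowI)
  have "\<exists>x. J x < Inf (range J) + \<epsilon> * \<epsilon>"
    using cInf_lessD[of "range J" "Inf (range J) + \<epsilon> * \<epsilon>"] e by auto
  then obtain x where x: "J x < Inf (range J) + \<epsilon> * \<epsilon>" by blast
  have "cmod (s x y - \<psi> y) \<le> \<epsilon> * sn y" for y
  proof (rule linear_bound)
    fix y
    have "J x \<le> J (x + y) + \<epsilon> * \<epsilon>" using cInf_lower[OF rangeI bdd, of "x + y"] x by linarith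
    then show "- (\<epsilon> * \<epsilon>) \<le> 2 * Re (s x y - \<psi> y) + (sn y)\<^sup>2"
      by (simp add: J_def sn_add_sq lin)
  qed (use e in \<open>simp_all add: lin scale_right right_diff_distrib\<close>)
  then show ?thesis by blast
qed

definition s_Cauchy :: "(nat \<Rightarrow> 'v) \<Rightarrow> bool"
  where "s_Cauchy X \<longleftrightarrow> (\<forall>e>0. \<exists>N. \<forall>m\<ge>N. \<forall>n\<ge>N. sn (X m - X n) < e)"

lemma s_Cauchy_const: "s_Cauchy (\<lambda>_. x)"
  by (simp add: s_Cauchy_def)

lemma s_Cauchy_bounded:
  assumes "s_Cauchy X"
  obtains B where "0 \<le> B" "\<And>n. sn (X n) \<le> B"
proof -
  obtain N where N: "\<And>m n. m \<ge> N \<Longrightarrow> n \<ge> N \<Longrightarrow> sn (X m - X n) < 1"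
    using assms unfolding s_Cauchy_def by (meson zero_less_one)
  define B where "B = Max ((\<lambda>n. sn (X n)) ` {..N}) + 1"
  have le: "sn (X n) \<le> B - 1" if "n \<le> N" for n using that by (simp add: B_def)
  have "sn (X n) \<le> B" for n
  proof (cases "n \<le> N")
    case False
    then have "sn (X n) \<le> sn (X n - X N) + sn (X N)" using sn_triangle[of "X n - X N" "X N"] by simp
    also have "\<dots> \<le> B" using N[of n N] le[of N] False by simp
    finally show ?thesis .
  qed (use le in force)
  moreover have "0 \<le> B" using le[of N] sn_nonneg[of "X N"] by linarith
  ultimately show ?thesis using that by blast
qed

lemma s_Cauchy_inner_convergent:
  assumes X: "s_Cauchy X" and Y: "s_Cauchy Y"
  shows "convergent (\<lambda>n. s (X n) (Y n))"
proof -
  obtain B where B: "0 \<le> B" "\<And>n. sn (X n) \<le> B" using s_Cauchy_bounded[OF X] by blast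
  obtain C where C: "0 \<le> C" "\<And>n. sn (Y n) \<le> C" using s_Cauchy_bounded[OF Y] by blast
  have "Cauchy (\<lambda>n. s (X n) (Y n))"
  proof (rule CauchyI)
    fix e :: real assume e: "0 < e"
    define d where "d = e / (B + C + 1)"
    have d: "0 < d" using e B(1) C(1) by (simp add: d_def)
    obtain M where M: "\<And>m n. m \<ge> M \<Longrightarrow> n \<ge> M \<Longrightarrow> sn (X m - X n) < d"
      using X d unfolding s_Cauchy_def by blast
    obtain N where N: "\<And>m n. m \<ge> N \<Longrightarrow> n \<ge> N \<Longrightarrow> sn (Y m - Y n) < d"
      using Y d unfolding s_Cauchy_def by blast
    have "cmod (s (X m) (Y m) - s (X n) (Y n)) < e" if "m \<ge> max M N" "n \<ge> max M N" for m n
    proof -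
      have "cmod (s (X m) (Y m) - s (X n) (Y n))
          \<le> sn (X m - X n) * sn (Y m) + sn (X n) * sn (Y m - Y n)" by (rule inner_diff_le)
      also have "\<dots> \<le> d * C + B * d"
        using M[of m n] N[of m n] that B C d by (intro add_mono mult_mono) (auto intro: less_imp_le)
      also have "\<dots> < d * (B + C + 1)" using d by (simp add: algebra_simps)
      also have "\<dots> = e" using B(1) C(1) by (simp add: d_def)
      finally show ?thesis .
    qed
    then show "\<exists>M. \<forall>m\<ge>M. \<forall>n\<ge>M. norm (s (X m) (Y m) - s (X n) (Y n)) < e" by blast
  qed
  then show ?thesis by (rule Cauchy_convergent)
qed

text \<open>
  The sequence \<open>X\<close> plays the role of the vector that represents \<open>\<psi>\<close> in the Hilbert space
  completion.
\<close>

lemma riesz_sequence: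
  assumes lin: "\<And>y z. \<psi> (y + z) = \<psi> y + \<psi> z" "\<And>c y. \<psi> (c *\<^sub>C y) = c * \<psi> y"
    and bound: "\<And>y. cmod (\<psi> y) \<le> C * sn y" and C: "0 \<le> C"
  obtains X where "\<And>y. (\<lambda>n. s (X n) y) \<longlonglongrightarrow> \<psi> y" "s_Cauchy X"
    "\<And>n. sn (X n) \<le> C + 1 / real (Suc n)"
proof -
  have "\<exists>x. \<forall>y. cmod (s x y - \<psi> y) \<le> 1 / real (Suc n) * sn y" for n
    by (rule approximate_riesz[OF lin bound]) simp_all
  then obtain X where X: "\<And>n y. cmod (s (X n) y - \<psi> y) \<le> 1 / real (Suc n) * sn y" by metis
  have "sn (X n) \<le> C + 1 / real (Suc n)" for n
  proof (cases "sn (X n) = 0")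
    case True
    then show ?thesis using C by simp
  next
    case False
    have "sn (X n) * sn (X n) = cmod (s (X n) (X n))" by (simp add: norm_self power2_eq_square)
    also have "\<dots> \<le> cmod (s (X n) (X n) - \<psi> (X n)) + cmod (\<psi> (X n))"
      using norm_triangle_ineq[of "s (X n) (X n) - \<psi> (X n)" "\<psi> (X n)"] by simp
    also have "\<dots> \<le> 1 / real (Suc n) * sn (X n) + C * sn (X n)" by (intro add_mono X bound)
    also have "\<dots> = (C + 1 / real (Suc n)) * sn (X n)" by (simp add: algebra_simps)
    finally show ?thesis using False sn_nonneg[of "X n"] by (metis mult_right_le_imp_le order_le_less)
  qed
  moreover have "s_Cauchy X"
    unfolding s_Cauchy_def
  proof (intro allI impI)
    fix e :: real assume "0 < e"
    then obtain N where N: "1 / real (Suc N) < e / 2" using nat_approx_posE[of "e/2"] by auto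
    have "sn (X m - X n) < e" if "m \<ge> N" "n \<ge> N" for m n
    proof (cases "sn (X m - X n) = 0")
      case False
      let ?d = "X m - X n"
      have "sn ?d * sn ?d = cmod (s (X m) ?d - s (X n) ?d)" by (simp add: norm_self power2_eq_square flip: diff_left)
      also have "\<dots> \<le> cmod (s (X m) ?d - \<psi> ?d) + cmod (s (X n) ?d - \<psi> ?d)"
        using norm_triangle_ineq4[of "s (X m) ?d - \<psi> ?d" "s (X n) ?d - \<psi> ?d"] by simp
      also have "\<dots> \<le> 1 / real (Suc m) * sn ?d + 1 / real (Suc n) * sn ?d" by (intro add_mono X)
      also have "\<dots> = (1 / real (Suc m) + 1 / real (Suc n)) * sn ?d" by (simp add: algebra_simps)
      finally have "sn ?d \<le> 1 / real (Suc m) + 1 / real (Suc n)"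
        using False sn_nonneg[of ?d] by (metis mult_right_le_imp_le order_le_less)
      also have "\<dots> \<le> 1 / real (Suc N) + 1 / real (Suc N)"
        using that by (intro add_mono) (auto simp: frac_le)
      finally show ?thesis using N by simp
    qed (use \<open>0 < e\<close> in simp)
    then show "\<exists>N. \<forall>m\<ge>N. \<forall>n\<ge>N. sn (X m - X n) < e" by blast
  qed
  moreover have "(\<lambda>n. s (X n) y) \<longlonglongrightarrow> \<psi> y" for y
  proof (rule LIM_zero_cancel, rule Lim_null_comparison)
    have "(\<lambda>n. 1 / real (Suc n)) \<longlonglongrightarrow> 0" using LIMSEQ_inverse_real_of_nat by (simp add: inverse_eq_divide)
    then show "(\<lambda>n. 1 / real (Suc n) * sn y) \<longlonglongrightarrow> 0" by (rule tendsto_mult_left_zero)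
  qed (use X in auto)
  ultimately show ?thesis using that by blast
qed

end

lemma semi_innerI:
  fixes s :: "'v::complex_normed_space \<Rightarrow> 'v \<Rightarrow> complex"
  assumes ar: "\<And>x y z. s x (y + z) = s x y + s x z" and al: "\<And>x y z. s (x + y) z = s x z + s y z"
    and cr: "\<And>x c y. s x (c *\<^sub>C y) = c * s x y" and cl: "\<And>x c y. s (c *\<^sub>C x) y = cnj c * s x y"
    and pos: "\<And>x. s x x \<in> \<real>\<^sub>\<ge>\<^sub>0"
  shows "semi_inner s"
proof
  have im: "Im (s x x) = 0" for x using pos[of x] by (auto simp: complex_nonneg_Reals_iff)
  fix x y z :: 'v and c :: complex
  show "s x (y + z) = s x y + s x z" "s x (c *\<^sub>C y) = c * s x y" by (fact ar cr)+
  show "0 \<le> Re (s x x)" using pos[of x] by (auto simp: complex_nonneg_Reals_iff)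
  show "s y x = cnj (s x y)"
    using im[of "x + y"] im[of "x + \<i> *\<^sub>C y"] im[of x] im[of y]
    by (intro complex_eqI) (simp_all add: ar al cr cl)
qed

section \<open>Hilbert modules and positive functionals\<close>

context hilbert_cstar_module
begin

lemma ip_add_left: "ip (x + y) z = ip x z + ip y z"
  by (subst (1 2 3) ip_star) (simp add: ip_add_right star_add)

lemma ip_scaleC_left: "ip (c *\<^sub>C x) y = cnj c *\<^sub>C ip x y"
  by (subst (1 2) ip_star) (simp add: ip_scaleC_right star_scaleC)

lemma ip_act_left: "ip (act x a) y = star a * ip x y"
  by (subst (1 2) ip_star) (simp add: ip_act_right star_mult)

lemma ip_zero_right [simp]: "ip x 0 = 0" using ip_add_right[of x 0 0] by simp
lemma ip_zero_left [simp]: "ip 0 x = 0" using ip_add_left[of 0 0 x] by simp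
lemma ip_minus_right: "ip x (- y) = - ip x y" using ip_scaleC_right[of x "-1" y] by simp
lemma ip_minus_left: "ip (- x) y = - ip x y" using ip_scaleC_left[of "-1" x y] by simp
lemma ip_diff_right: "ip x (y - z) = ip x y - ip x z"
  using ip_add_right[of x y "- z"] by (simp add: ip_minus_right)
lemma ip_diff_left: "ip (x - y) z = ip x z - ip y z"
  using ip_add_left[of x "- y" z] by (simp add: ip_minus_left)
lemma ip_scaleR_right: "ip x (r *\<^sub>R y) = r *\<^sub>R ip x y"
  using ip_scaleC_right[of x "complex_of_real r" y] by (simp add: scaleC_of_real)
lemma ip_scaleR_left: "ip (r *\<^sub>R x) y = r *\<^sub>R ip x y"
  using ip_scaleC_left[of "complex_of_real r" x y] by (simp add: scaleC_of_real)

lemma act_scaleR_left: "act (r *\<^sub>R x) a = r *\<^sub>R act x a"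
  using act_scaleC_left[of "complex_of_real r" x a] by (simp add: scaleC_of_real)

lemma norm_ip_self: "norm (ip x x) = (norm x)\<^sup>2"
  by (simp add: norm_eq_sqrt_ip)

lemma star_ip_self: "star (ip x x) = ip x x"
  by (rule ip_star[symmetric])

text \<open>
  Expand \<open>\<langle>z, z\<rangle> \<ge> 0\<close> for \<open>z = y \<langle>y, x\<rangle> - (norm y)\<^sup>2 x\<close> and use
  \<open>star d * \<langle>y, y\<rangle> * d \<le> (norm y)\<^sup>2 * (star d * d)\<close> for \<open>d = \<langle>y, x\<rangle>\<close>.
\<close>

lemma module_cauchy_schwarz: "cstar_positive ((norm y)\<^sup>2 *\<^sub>R ip x x - ip x y * ip y x)"
proof (cases "y = 0")
  case False
  define C where "C = (norm y)\<^sup>2"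
  have C: "0 < C" and nC: "norm (ip y y) = C" using False by (simp_all add: C_def norm_ip_self)
  let ?d = "ip y x"
  have sd: "star ?d = ip x y" by (rule ip_star[symmetric])
  define z where "z = act y ?d - C *\<^sub>R x"
  have "ip z z = ip x y * ip y y * ?d - (2 * C) *\<^sub>R (ip x y * ?d) + (C * C) *\<^sub>R ip x x"
    by (simp add: z_def ip_diff_left ip_diff_right ip_act_left ip_act_right ip_scaleR_left
        ip_scaleR_right sd algebra_simps scaleR_2 flip: scaleR_scaleR)
  then have "cstar_positive \<dots>" using ip_positive[of z] by simp
  from cstar_positive_add[OF this cstar_positive_conjugate[OF star_ip_self[of y], of ?d]]
  have "cstar_positive ((C * C) *\<^sub>R ip x x - C *\<^sub>R (ip x y * ?d))"
    by (simp add: sd nC algebra_simps scaleR_2 flip: scaleR_scaleR)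
  from cstar_positive_scaleR[OF this, of "1 / C"]
  have "cstar_positive (C *\<^sub>R ip x x - ip x y * ?d)"
    using C by (simp add: scaleR_right_diff_distrib)
  then show ?thesis by (simp add: C_def)
qed simp

lemma norm_ip_le: "norm (ip x y) \<le> norm x * norm y"
proof -
  have "(norm (ip y x))\<^sup>2 = norm (ip x y * ip y x)"
    unfolding cstar_identity[symmetric] by (simp add: ip_star[symmetric])
  also have "\<dots> \<le> norm (ip x y * ip y x + ((norm y)\<^sup>2 *\<^sub>R ip x x - ip x y * ip y x))"
  proof (rule cstar_positive_norm_mono[OF _ module_cauchy_schwarz])
    show "cstar_positive (ip x y * ip y x)"
      unfolding cstar_positive_def by (metis ip_star)
  qed
  also have "\<dots> = (norm x * norm y)\<^sup>2" by (simp add: norm_ip_self power_mult_distrib)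
  finally have "norm (ip y x) \<le> norm x * norm y" by (rule power2_le_imp_le) simp
  then show ?thesis by (subst ip_star) (simp add: norm_star)
qed

lemma norm_act_le: "norm (act x a) \<le> norm x * norm a"
proof (rule power2_le_imp_le)
  have "(norm (act x a))\<^sup>2 = norm (star a * ip x x * a)"
    by (simp add: norm_ip_self[symmetric] ip_act_left ip_act_right mult.assoc)
  also have "\<dots> \<le> norm (star a) * norm (ip x x) * norm a"
    by (meson norm_mult_ineq mult_right_mono norm_ge_zero order_trans)
  finally show "(norm (act x a))\<^sup>2 \<le> (norm x * norm a)\<^sup>2"
    by (simp add: norm_star norm_ip_self power2_eq_square mult_ac)
qed simp

lemma bounded_linear_ip_right: "bounded_linear (ip x)"
  by (rule bounded_linear_intro[of _ "norm x"])
    (simp_all add: ip_add_right ip_scaleR_right norm_ip_le mult.commute[of "norm _" "norm x"])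

lemma bounded_linear_act_left: "bounded_linear (\<lambda>x. act x a)"
  by (rule bounded_linear_intro[of _ "norm a"]) (simp_all add: act_add_left act_scaleR_left norm_act_le)

lemma ex_act_near:
  assumes "0 < \<epsilon>"
  shows "\<exists>a. norm (x - act x a) < \<epsilon>"
proof -
  obtain e where e: "star e = e" "norm (ip x x - e * ip x x - ip x x * e + e * ip x x * e) < \<epsilon>\<^sup>2"
    using ex_approximate_unit[OF ip_positive, of "\<epsilon>\<^sup>2" x] assms by auto
  have "ip (x - act x e) (x - act x e) = ip x x - e * ip x x - ip x x * e + e * ip x x * e"
    by (simp add: ip_diff_left ip_diff_right ip_act_left ip_act_right e(1) algebra_simps)
  then have "(norm (x - act x e))\<^sup>2 < \<epsilon>\<^sup>2" using e(2) by (simp flip: norm_ip_self)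
  then show ?thesis using assms power_less_imp_less_base by (metis less_le)
qed

end

lemma positive_functionalD:
  assumes "positive_functional f"
  shows "f (a + b) = f a + f b" "f (c *\<^sub>C a) = c * f a" "cstar_positive a \<Longrightarrow> f a \<in> \<real>\<^sub>\<ge>\<^sub>0"
    "f 0 = 0" "f (a - b) = f a - f b" "f (r *\<^sub>R a) = r *\<^sub>R f a"
proof -
  show 1: "f (a + b) = f a + f b" "f (c *\<^sub>C a) = c * f a" "cstar_positive a \<Longrightarrow> f a \<in> \<real>\<^sub>\<ge>\<^sub>0" for a b c
    using assms by (auto simp: positive_functional_def)
  show "f 0 = 0" using 1(1)[of 0 0] by simp
  show "f (a - b) = f a - f b" using 1(1)[of a "-b"] 1(2)[of "-1" b] by simp
  show "f (r *\<^sub>R a) = r *\<^sub>R f a"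
    using 1(2)[of "complex_of_real r" a] by (simp add: scaleC_of_real scaleR_conv_of_real)
qed

lemma positive_functional_Re_nonneg: "positive_functional f \<Longrightarrow> cstar_positive a \<Longrightarrow> 0 \<le> Re (f a)"
  using positive_functionalD(3) complex_nonneg_Reals_iff by blast

lemma semi_inner_algebra:
  assumes "positive_functional f"
  shows "semi_inner (\<lambda>a b. f (star a * b))"
  by (rule semi_innerI)
    (auto simp: positive_functionalD[OF assms] distrib_left distrib_right star_add star_scaleC
      scaleC_mult_left scaleC_mult_right cstar_positive_def intro!: positive_functionalD(3)[OF assms])

lemma (in hilbert_cstar_module) semi_inner_module:
  assumes "positive_functional f"
  shows "semi_inner (\<lambda>x y. f (ip x y))"
  by (rule semi_innerI)
    (auto simp: positive_functionalD[OF assms] ip_add_left ip_add_right ip_scaleC_left ip_scaleC_right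
      intro!: positive_functionalD(3)[OF assms] ip_positive)

lemma (in hilbert_cstar_module) sn_module_le:
  assumes f: "positive_functional f" and C: "\<And>a. cmod (f a) \<le> C * norm a"
  shows "semi_inner.sn (\<lambda>x y. f (ip x y)) x \<le> sqrt C * norm x"
proof -
  have "sqrt (Re (f (ip x x))) \<le> sqrt (C * norm (ip x x))"
    using C[of "ip x x"] complex_Re_le_cmod[of "f (ip x x)"] by simp
  then show ?thesis
    unfolding semi_inner.sn_def[OF semi_inner_module[OF f]]
    by (simp add: real_sqrt_mult norm_ip_self)
qed

text \<open>
  On products \<open>a * e\<close> the claim is the symmetry of the form \<open>f (star a * b)\<close>. By
  boundedness it passes to \<open>a\<close>, which is a limit of such products.
\<close>

lemma positive_functional_star:
  assumes f: "positive_functional f" and bl: "bounded_linear f"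
  shows "f (star a) = cnj (f a)"
proof -
  interpret A: semi_inner "\<lambda>a b. f (star a * b)" by (rule semi_inner_algebra[OF f])
  have "\<exists>e. norm (a - a * e) < 1 / real (Suc n)" for n
  proof -
    obtain e where e: "star e = e"
      "norm (star a * a - e * (star a * a) - star a * a * e + e * (star a * a) * e) < (1 / real (Suc n))\<^sup>2"
      using ex_approximate_unit[of "star a * a" "(1 / real (Suc n))\<^sup>2"] by (auto simp: cstar_positive_def)
    have "(norm (a - a * e))\<^sup>2 < (1 / real (Suc n))\<^sup>2"
      using e(2) unfolding cstar_identity[symmetric]
      by (simp add: star_diff star_mult e(1) algebra_simps)
    then show ?thesis by (meson power_less_imp_less_base zero_le_divide_1_iff of_nat_0_le_iff)
  qed
  then obtain e where e: "\<And>n. norm (a - a * e n) < 1 / real (Suc n)" by metis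
  have "(\<lambda>n. a - a * e n) \<longlonglongrightarrow> 0"
    by (rule Lim_null_comparison[OF _ LIMSEQ_inverse_real_of_nat])
      (use e in \<open>auto simp: inverse_eq_divide intro!: always_eventually less_imp_le\<close>)
  then have lim: "(\<lambda>n. a * e n) \<longlonglongrightarrow> a"
    using tendsto_diff[OF tendsto_const[of a]] by fastforce
  have "f (star (a * e n)) = cnj (f (a * e n))" for n
    using A.hermitian[of "e n" "star a"] by (simp add: star_mult star_star)
  moreover have "(\<lambda>n. f (star (a * e n))) \<longlonglongrightarrow> f (star a)"
    by (intro bounded_linear.tendsto[OF bl] bounded_linear.tendsto[OF bounded_linear_star] lim)
  moreover have "(\<lambda>n. cnj (f (a * e n))) \<longlonglongrightarrow> cnj (f a)"
    by (intro tendsto_cnj bounded_linear.tendsto[OF bl] lim)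
  ultimately show ?thesis using LIMSEQ_unique by auto
qed

text \<open>
  If \<open>X\<close> represents \<open>\<psi>\<close> in the localization at \<open>f\<close> and \<open>g \<le> f\<close>, then
  \<open>g (ip x y) = f (ip (T x) y)\<close> for a positive contraction \<open>T\<close> of that Hilbert space, and the
  limit \<open>\<phi>\<close> is the functional represented by \<open>T X\<close>. The point is that \<open>\<phi>\<close> vanishes
  on \<open>L\<close> when \<open>\<psi>\<close> does. The reason is that \<open>T\<close> comes from the commutant of the
  representation of the algebra: for each \<open>e\<close> the functional \<open>c \<mapsto> g (star e * c)\<close> is
  approximated by \<open>c \<mapsto> f (star a * c)\<close> for some \<open>a\<close> in the algebra. So
  \<open>\<phi> (act y e)\<close> is approximated by \<open>\<psi> (act y a)\<close>, which is \<open>0\<close> since \<open>L\<close> is a submodule;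
  finally \<open>y\<close> is a limit of elements \<open>act y e\<close>.
\<close>

lemma (in hilbert_cstar_module) dominated_functional_component:
  assumes f: "positive_functional f" and g: "positive_functional g"
    and gC: "\<And>a. cmod (g a) \<le> C * norm a" and C0: "0 \<le> C"
    and gf: "\<And>a. cstar_positive a \<Longrightarrow> Re (g a) \<le> Re (f a)"
    and X: "semi_inner.s_Cauchy (\<lambda>x y. f (ip x y)) X"
    and X\<psi>: "\<And>y. (\<lambda>n. f (ip (X n) y)) \<longlonglongrightarrow> \<psi> y"
    and L: "\<And>y a. y \<in> L \<Longrightarrow> act y a \<in> L" "\<And>y. y \<in> L \<Longrightarrow> \<psi> y = 0"
  obtains \<phi> t where "\<And>y. (\<lambda>n. g (ip (X n) y)) \<longlonglongrightarrow> \<phi> y" "(\<lambda>n. Re (g (ip (X n) (X n)))) \<longlonglongrightarrow> t"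
    "0 \<le> t" "\<And>y. (cmod (\<phi> y))\<^sup>2 \<le> t * Re (g (ip y y))" "\<And>y. y \<in> L \<Longrightarrow> \<phi> y = 0"
proof -
  interpret F: semi_inner "\<lambda>x y. f (ip x y)" by (rule semi_inner_module[OF f])
  interpret G: semi_inner "\<lambda>x y. g (ip x y)" by (rule semi_inner_module[OF g])
  interpret FA: semi_inner "\<lambda>a b. f (star a * b)" by (rule semi_inner_algebra[OF f])
  interpret GA: semi_inner "\<lambda>a b. g (star a * b)" by (rule semi_inner_algebra[OF g])
  have GF: "G.sn x \<le> F.sn x" for x
    unfolding G.sn_def F.sn_def by (intro real_sqrt_le_mono gf ip_positive)
  have GFA: "GA.sn a \<le> FA.sn a" for a
    unfolding GA.sn_def FA.sn_def by (intro real_sqrt_le_mono gf) (auto simp: cstar_positive_def)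
  have XG: "G.s_Cauchy X"
    using X GF unfolding F.s_Cauchy_def G.s_Cauchy_def by (meson le_less_trans)
  have "\<exists>l. (\<lambda>n. g (ip (X n) y)) \<longlonglongrightarrow> l" for y
    using G.s_Cauchy_inner_convergent[OF XG G.s_Cauchy_const[of y]] by (simp add: convergent_def)
  then obtain \<phi> where \<phi>: "\<And>y. (\<lambda>n. g (ip (X n) y)) \<longlonglongrightarrow> \<phi> y" by metis
  obtain l where "(\<lambda>n. g (ip (X n) (X n))) \<longlonglongrightarrow> l"
    using G.s_Cauchy_inner_convergent[OF XG XG] by (auto simp: convergent_def)
  then have t: "(\<lambda>n. Re (g (ip (X n) (X n)))) \<longlonglongrightarrow> Re l" by (intro tendsto_intros)
  have t0: "0 \<le> Re l" by (rule LIMSEQ_le_const[OF t]) (use G.nonneg in auto)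
  have bound: "(cmod (\<phi> y))\<^sup>2 \<le> Re l * Re (g (ip y y))" for y
  proof (rule LIMSEQ_le)
    show "(\<lambda>n. (cmod (g (ip (X n) y)))\<^sup>2) \<longlonglongrightarrow> (cmod (\<phi> y))\<^sup>2" by (intro tendsto_intros \<phi>)
    show "(\<lambda>n. Re (g (ip (X n) (X n))) * Re (g (ip y y))) \<longlonglongrightarrow> Re l * Re (g (ip y y))"
      by (intro tendsto_intros t)
    have "(cmod (g (ip (X n) y)))\<^sup>2 \<le> (G.sn (X n) * G.sn y)\<^sup>2" for n
      by (intro power_mono G.cauchy_schwarz) simp
    also have "(G.sn (X n) * G.sn y)\<^sup>2 = Re (g (ip (X n) (X n))) * Re (g (ip y y))" for n
      by (simp add: power_mult_distrib G.sn_def G.nonneg)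
    finally show "\<exists>N. \<forall>n\<ge>N. (cmod (g (ip (X n) y)))\<^sup>2 \<le> Re (g (ip (X n) (X n))) * Re (g (ip y y))"
      by blast
  qed
  obtain B where B: "0 \<le> B" "\<And>n. F.sn (X n) \<le> B" using F.s_Cauchy_bounded[OF X] by blast
  have act0: "\<phi> (act y e) = 0" if y: "y \<in> L" for y e
  proof -
    have act_bound: "cmod (\<phi> (act y e)) \<le> d * (norm y * B)" if d: "0 < d" for d
    proof -
      have "\<exists>a. \<forall>c. cmod (f (star a * c) - g (star e * c)) \<le> d * FA.sn c"
      proof (rule FA.approximate_riesz[where C = "GA.sn e"])
        show "cmod (g (star e * c)) \<le> GA.sn e * FA.sn c" for c
          using GA.cauchy_schwarz[of e c] mult_left_mono[OF GFA[of c] GA.sn_nonneg[of e]] by linarith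
      qed (use d in \<open>simp_all add: GA.add_right GA.scale_right\<close>)
      then obtain a where a: "\<And>c. cmod (f (star a * c) - g (star e * c)) \<le> d * FA.sn c" by blast
      have "cmod (f (ip (X n) (act y a)) - g (ip (X n) (act y e))) \<le> d * (norm y * B)" for n
      proof -
        have "FA.sn (ip y (X n)) \<le> sqrt ((norm y)\<^sup>2 * (F.sn (X n))\<^sup>2)"
        proof -
          have "0 \<le> Re (f ((norm y)\<^sup>2 *\<^sub>R ip (X n) (X n) - ip (X n) y * ip y (X n)))"
            by (intro positive_functional_Re_nonneg[OF f] module_cauchy_schwarz)
          then have "Re (f (star (ip y (X n)) * ip y (X n))) \<le> (norm y)\<^sup>2 * (F.sn (X n))\<^sup>2"
            by (simp add: positive_functionalD[OF f] F.self ip_star[symmetric])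
          then show ?thesis unfolding FA.sn_def by (rule real_sqrt_le_mono)
        qed
        also have "\<dots> = norm y * F.sn (X n)" by (simp add: real_sqrt_mult)
        also have "\<dots> \<le> norm y * B" by (intro mult_left_mono B) simp
        finally have sn: "FA.sn (ip y (X n)) \<le> norm y * B" .
        have "f (ip (X n) (act y a)) - g (ip (X n) (act y e))
            = cnj (f (star a * ip y (X n)) - g (star e * ip y (X n)))"
          using F.hermitian[of "act y a" "X n"] G.hermitian[of "act y e" "X n"] by (simp add: ip_act_left)
        then have "cmod (f (ip (X n) (act y a)) - g (ip (X n) (act y e))) \<le> d * FA.sn (ip y (X n))"
          using a by (metis complex_mod_cnj)
        also have "\<dots> \<le> d * (norm y * B)" using sn d by (intro mult_left_mono) auto
        finally show ?thesis .
      qed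
      moreover have "(\<lambda>n. f (ip (X n) (act y a)) - g (ip (X n) (act y e))) \<longlonglongrightarrow> \<psi> (act y a) - \<phi> (act y e)"
        by (intro tendsto_intros X\<psi> \<phi>)
      ultimately have "cmod (\<psi> (act y a) - \<phi> (act y e)) \<le> d * (norm y * B)"
        by (intro LIMSEQ_le_const2[OF tendsto_norm]) auto
      then show ?thesis using L y by simp
    qed
    have *: "cmod (\<phi> (act y e)) \<le> 0 + k" if "0 < k" for k
    proof -
      have p: "0 < norm y * B + 1" using B by (simp add: add_nonneg_pos)
      have "cmod (\<phi> (act y e)) \<le> k / (norm y * B + 1) * (norm y * B)"
        using p that by (intro act_bound) simp
      also have "\<dots> \<le> k" using p that B by (simp add: divide_le_eq algebra_simps)
      finally show ?thesis by simp
    qed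
    then show ?thesis using field_le_epsilon[of "cmod (\<phi> (act y e))" 0] by simp
  qed
  have "\<phi> y = 0" if y: "y \<in> L" for y
  proof -
    have "cmod (\<phi> y) \<le> 0 + k" if k: "0 < k" for k
    proof -
      define D where "D = sqrt (Re l) * sqrt C + 1"
      have D: "0 < D" using t0 C0 by (simp add: D_def add_nonneg_pos)
      obtain e where e: "norm (y - act y e) < k / D" using ex_act_near[of "k / D" y] k D by auto
      have "(\<lambda>n. g (ip (X n) y) - g (ip (X n) (act y e))) \<longlonglongrightarrow> \<phi> y - \<phi> (act y e)"
        by (intro tendsto_intros \<phi>)
      then have eq: "\<phi> y = \<phi> (y - act y e)"
        using LIMSEQ_unique[OF \<phi>[of "y - act y e"]] act0[OF y] by (simp add: G.diff_right)
      have "cmod (\<phi> y) \<le> sqrt (Re l) * G.sn (y - act y e)"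
        using real_sqrt_le_mono[OF bound[of "y - act y e"]] by (simp add: eq real_sqrt_mult G.sn_def)
      also have "\<dots> \<le> sqrt (Re l) * (sqrt C * norm (y - act y e))"
        using t0 by (intro mult_left_mono sn_module_le[OF g gC]) auto
      also have "\<dots> \<le> D * norm (y - act y e)" by (simp add: D_def algebra_simps)
      also have "\<dots> \<le> D * (k / D)" using e D by (intro mult_left_mono) auto
      finally show ?thesis using D by simp
    qed
    then show ?thesis using field_le_epsilon[of "cmod (\<phi> y)" 0] by simp
  qed
  then show ?thesis using that \<phi> t t0 bound by blast
qed

text \<open>
  A decomposition \<open>f1 + f2\<close> of a positive functional induces one of every functional on the module
  that is bounded for it. The two components are limits along one sequence that represents
  \<open>\<psi>\<close>, hence they add up to \<open>\<psi>\<close>, and their bounds add up to at most \<open>\<tau>\<close>;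
  what is left of \<open>\<tau>\<close> is assigned to the first component. Purity of the state constructed
  later depends on this lemma.
\<close>

lemma (in hilbert_cstar_module) split_bounded_functional:
  assumes f1: "positive_functional f1" "\<And>a. cmod (f1 a) \<le> C * norm a"
    and f2: "positive_functional f2" "\<And>a. cmod (f2 a) \<le> C * norm a" and C0: "0 \<le> C"
    and \<psi>: "\<And>x y. \<psi> (x + y) = \<psi> x + \<psi> y" "\<And>c y. \<psi> (c *\<^sub>C y) = c * \<psi> y" and \<tau>: "0 \<le> \<tau>"
    and bound: "\<And>x. (cmod (\<psi> x))\<^sup>2 \<le> \<tau> * Re (f1 (ip x x) + f2 (ip x x))"
    and L: "\<And>y a. y \<in> L \<Longrightarrow> act y a \<in> L" "\<And>y. y \<in> L \<Longrightarrow> \<psi> y = 0"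
  obtains \<psi>1 \<psi>2 t1 t2 where
    "\<And>x y. \<psi>1 (x + y) = \<psi>1 x + \<psi>1 y" "\<And>c y. \<psi>1 (c *\<^sub>C y) = c * \<psi>1 y"
    "\<And>x y. \<psi>2 (x + y) = \<psi>2 x + \<psi>2 y" "\<And>c y. \<psi>2 (c *\<^sub>C y) = c * \<psi>2 y"
    "\<And>y. \<psi> y = \<psi>1 y + \<psi>2 y" "\<tau> = t1 + t2" "0 \<le> t1" "0 \<le> t2"
    "\<And>x. (cmod (\<psi>1 x))\<^sup>2 \<le> t1 * Re (f1 (ip x x))" "\<And>x. (cmod (\<psi>2 x))\<^sup>2 \<le> t2 * Re (f2 (ip x x))"
    "\<And>y. y \<in> L \<Longrightarrow> \<psi>1 y = 0" "\<And>y. y \<in> L \<Longrightarrow> \<psi>2 y = 0"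
proof -
  define f where "f a = f1 a + f2 a" for a
  note d1 = positive_functionalD[OF f1(1)] and d2 = positive_functionalD[OF f2(1)]
  have f: "positive_functional f"
    unfolding positive_functional_def f_def using d1 d2
    by (auto simp: algebra_simps complex_nonneg_Reals_iff)
  interpret F: semi_inner "\<lambda>x y. f (ip x y)" by (rule semi_inner_module[OF f])
  interpret F1: semi_inner "\<lambda>x y. f1 (ip x y)" by (rule semi_inner_module[OF f1(1)])
  interpret F2: semi_inner "\<lambda>x y. f2 (ip x y)" by (rule semi_inner_module[OF f2(1)])
  have "cmod (\<psi> y) \<le> sqrt \<tau> * F.sn y" for y
    using real_sqrt_le_mono[OF bound[of y]] unfolding F.sn_def by (simp add: real_sqrt_mult f_def)
  then obtain X where X\<psi>: "\<And>y. (\<lambda>n. f (ip (X n) y)) \<longlonglongrightarrow> \<psi> y" and X: "F.s_Cauchy X" "\<And>n. F.sn (X n) \<le> sqrt \<tau> + 1 / real (Suc n)"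
    using F.riesz_sequence[OF \<psi>, of "sqrt \<tau>"] \<tau> by (metis real_sqrt_ge_zero)
  have inv: "(\<lambda>n. 1 / real (Suc n)) \<longlonglongrightarrow> 0" using LIMSEQ_inverse_real_of_nat by (simp add: inverse_eq_divide)
  have le: "Re (f1 a) \<le> Re (f a)" "Re (f2 a) \<le> Re (f a)" if "cstar_positive a" for a
    using that positive_functional_Re_nonneg[OF f1(1)] positive_functional_Re_nonneg[OF f2(1)]
    by (simp_all add: f_def)
  obtain \<psi>1 t1 where 1: "\<And>y. (\<lambda>n. f1 (ip (X n) y)) \<longlonglongrightarrow> \<psi>1 y" "(\<lambda>n. Re (f1 (ip (X n) (X n)))) \<longlonglongrightarrow> t1"
    "0 \<le> t1" "\<And>y. (cmod (\<psi>1 y))\<^sup>2 \<le> t1 * Re (f1 (ip y y))" "\<And>y. y \<in> L \<Longrightarrow> \<psi>1 y = 0"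
    using dominated_functional_component[OF f f1(1) f1(2) C0 le(1) X(1) X\<psi> L] by blast
  obtain \<psi>2 t2 where 2: "\<And>y. (\<lambda>n. f2 (ip (X n) y)) \<longlonglongrightarrow> \<psi>2 y" "(\<lambda>n. Re (f2 (ip (X n) (X n)))) \<longlonglongrightarrow> t2"
    "0 \<le> t2" "\<And>y. (cmod (\<psi>2 y))\<^sup>2 \<le> t2 * Re (f2 (ip y y))" "\<And>y. y \<in> L \<Longrightarrow> \<psi>2 y = 0"
    using dominated_functional_component[OF f f2(1) f2(2) C0 le(2) X(1) X\<psi> L] by blast
  have sum: "\<psi> y = \<psi>1 y + \<psi>2 y" for y
    using LIMSEQ_unique[OF X\<psi>[of y]] tendsto_add[OF 1(1)[of y] 2(1)[of y]] by (simp add: f_def)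
  have "t1 + t2 \<le> (sqrt \<tau> + 0)\<^sup>2"
  proof (rule LIMSEQ_le)
    show "(\<lambda>n. Re (f1 (ip (X n) (X n))) + Re (f2 (ip (X n) (X n)))) \<longlonglongrightarrow> t1 + t2"
      by (intro tendsto_add 1(2) 2(2))
    show "(\<lambda>n. (sqrt \<tau> + 1 / real (Suc n))\<^sup>2) \<longlonglongrightarrow> (sqrt \<tau> + 0)\<^sup>2"
      by (intro tendsto_intros inv)
    have "Re (f1 (ip (X n) (X n))) + Re (f2 (ip (X n) (X n))) = (F.sn (X n))\<^sup>2" for n
      using F.nonneg[of "X n"] unfolding F.sn_def by (simp add: f_def)
    also have "(F.sn (X n))\<^sup>2 \<le> (sqrt \<tau> + 1 / real (Suc n))\<^sup>2" for n by (intro power_mono X(2)) simp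
    finally show "\<exists>N. \<forall>n\<ge>N. Re (f1 (ip (X n) (X n))) + Re (f2 (ip (X n) (X n)))
        \<le> (sqrt \<tau> + 1 / real (Suc n))\<^sup>2" by blast
  qed
  then have tt: "t1 + t2 \<le> \<tau>" using \<tau> by simp
  have lin1: "\<psi>1 (x + y) = \<psi>1 x + \<psi>1 y" "\<psi>1 (c *\<^sub>C y) = c * \<psi>1 y" for x y c
    using LIMSEQ_unique[OF 1(1)[of "x + y"]] tendsto_add[OF 1(1)[of x] 1(1)[of y]]
      LIMSEQ_unique[OF 1(1)[of "c *\<^sub>C y"]] tendsto_mult_left[OF 1(1)[of y], of c]
    by (simp_all add: F1.add_right F1.scale_right)
  have lin2: "\<psi>2 (x + y) = \<psi>2 x + \<psi>2 y" "\<psi>2 (c *\<^sub>C y) = c * \<psi>2 y" for x y c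
    using LIMSEQ_unique[OF 2(1)[of "x + y"]] tendsto_add[OF 2(1)[of x] 2(1)[of y]]
      LIMSEQ_unique[OF 2(1)[of "c *\<^sub>C y"]] tendsto_mult_left[OF 2(1)[of y], of c]
    by (simp_all add: F2.add_right F2.scale_right)
  have b1: "(cmod (\<psi>1 x))\<^sup>2 \<le> (\<tau> - t2) * Re (f1 (ip x x))" for x
    using 1(4)[of x] mult_right_mono[of t1 "\<tau> - t2" "Re (f1 (ip x x))"] tt F1.nonneg[of x] by simp
  show ?thesis
    by (rule that[of \<psi>1 \<psi>2 "\<tau> - t2" t2]) (use lin1 lin2 sum b1 1 2 tt in auto)
qed

section \<open>Pure states that separate a point from a submodule\<close>

lemma sublinear_Inf:
  fixes R :: "'v::real_vector \<Rightarrow> real \<Rightarrow> bool"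
  assumes add: "\<And>v w m n. R v m \<Longrightarrow> R w n \<Longrightarrow> R (v + w) (m + n)"
    and scale: "\<And>c v m. 0 < c \<Longrightarrow> R v m \<Longrightarrow> R (c *\<^sub>R v) (c * m)"
    and total: "\<And>v. \<exists>m. R v m" and nonneg: "\<And>v m. R v m \<Longrightarrow> 0 \<le> m"
    and zero: "\<And>m. 0 < m \<Longrightarrow> R 0 m"
  defines "p \<equiv> \<lambda>v. Inf {m. R v m}"
  shows "sublinear p" "\<And>v m. R v m \<Longrightarrow> p v \<le> m" "\<And>v b. (\<And>m. R v m \<Longrightarrow> b \<le> m) \<Longrightarrow> b \<le> p v"
proof -
  have bdd: "bdd_below {m. R v m}" for v using nonneg by (auto intro!: bdd_belowI)
  show le: "p v \<le> m" if "R v m" for v m unfolding p_def using bdd that by (intro cInf_lower) auto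
  show ge: "b \<le> p v" if "\<And>m. R v m \<Longrightarrow> b \<le> m" for v b
    unfolding p_def using total that by (intro cInf_greatest) auto
  have pa: "p (v + w) \<le> p v + p w" for v w
  proof -
    have "p (v + w) - n \<le> p v" if n: "R w n" for n
      by (rule ge) (use le[OF add[OF _ n]] in \<open>simp add: algebra_simps\<close>)
    then have "p (v + w) - p v \<le> p w" by (intro ge) (simp add: algebra_simps)
    then show ?thesis by simp
  qed
  have ps: "c * p v \<le> p (c *\<^sub>R v)" if c: "0 < c" for c v
  proof (rule ge)
    fix m assume "R (c *\<^sub>R v) m"
    then have "R (inverse c *\<^sub>R c *\<^sub>R v) (inverse c * m)" using c by (intro scale) auto
    then have "p v \<le> m / c" using c by (intro le) (simp add: field_simps)
    then show "c * p v \<le> m" using c by (simp add: field_simps)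
  qed
  have "p 0 \<le> 0" using le[OF zero] field_le_epsilon[of "p 0" 0] by simp
  moreover have "0 \<le> p 0" using nonneg by (intro ge)
  ultimately show "sublinear p" using sublinearI[OF pa ps] by simp
qed

definition complexify :: "('v::complex_normed_space \<Rightarrow> real) \<Rightarrow> 'v \<Rightarrow> complex"
  where "complexify r x = Complex (r x) (- r (\<i> *\<^sub>C x))"

lemma scaleC_eq_scaleR: "c *\<^sub>C x = Re c *\<^sub>R x + Im c *\<^sub>R (\<i> *\<^sub>C (x::'v::complex_normed_space))"
proof -
  have "c *\<^sub>C x = (complex_of_real (Re c) + complex_of_real (Im c) * \<i>) *\<^sub>C x"
    by (subst complex_eq[of c]) (simp add: mult.commute)
  then show ?thesis by (simp only: scaleC_add_left scaleC_scaleC[symmetric] scaleC_of_real)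
qed

lemma complexify:
  assumes r: "linear r"
  shows complexify_add: "complexify r (x + y) = complexify r x + complexify r y"
    and complexify_scaleC: "complexify r (c *\<^sub>C x) = c * complexify r x"
    and Re_complexify: "Re (complexify r x) = r x"
proof -
  show "complexify r (x + y) = complexify r x + complexify r y"
    by (intro complex_eqI) (simp_all add: complexify_def scaleC_add_right linear_add[OF r])
  have "\<i> *\<^sub>C c *\<^sub>C x = (\<i> * c) *\<^sub>C x" by (rule scaleC_scaleC)
  then have "r (\<i> *\<^sub>C c *\<^sub>C x) = - Im c * r x + Re c * r (\<i> *\<^sub>C x)"
    by (simp add: scaleC_eq_scaleR[of "\<i> * c"] linear_add[OF r] linear_scale[OF r] linear_diff[OF r])
  moreover have "r (c *\<^sub>C x) = Re c * r x + Im c * r (\<i> *\<^sub>C x)"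
    by (simp add: scaleC_eq_scaleR[of c] linear_add[OF r] linear_scale[OF r])
  ultimately show "complexify r (c *\<^sub>C x) = c * complexify r x"
    by (intro complex_eqI) (simp_all add: complexify_def)
qed (simp add: complexify_def)

text \<open>
  Rotating \<open>x\<close> by a scalar of modulus \<open>1\<close> makes the complex value real and nonnegative.
\<close>

lemma cmod_complexify_le:
  assumes r: "linear r" and bound: "\<And>c. cmod c = 1 \<Longrightarrow> r (c *\<^sub>C x) \<le> B" and B: "0 \<le> B"
  shows "cmod (complexify r x) \<le> B"
proof (cases "complexify r x = 0")
  case False
  define c where "c = cnj (complexify r x) / cmod (complexify r x)"
  have "cmod c = 1" using False by (simp add: c_def norm_divide)
  have "complexify r (c *\<^sub>C x) = cnj (complexify r x) * complexify r x / cmod (complexify r x)"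
    by (simp add: complexify_scaleC[OF r] c_def)
  also have "\<dots> = complex_of_real (cmod (complexify r x))"
    using False complex_norm_square[of "complexify r x"] by (simp add: power2_eq_square mult.commute divide_eq_eq)
  finally have "r (c *\<^sub>C x) = cmod (complexify r x)"
    using Re_complexify[OF r, of "c *\<^sub>C x"] by simp
  then show ?thesis using bound[OF \<open>cmod c = 1\<close>] by simp
qed (use B in simp)

lemma sq_le_of_weighted_am_gm:
  assumes "\<And>T. 0 < T \<Longrightarrow> 2 * x \<le> A / T + T * t" "0 \<le> x" "0 \<le> A" "0 \<le> t"
  shows "x\<^sup>2 \<le> t * (A::real)"
proof (cases "x = 0")
  case False
  with assms have x: "0 < x" by simp
  show ?thesis
  proof (cases "t = 0")
    case True
    have "2 * x \<le> A / ((A + 1) / x)" using assms(1)[of "(A + 1) / x"] True x assms(3) by simp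
    also have "\<dots> \<le> x" using x assms(3) by (simp add: field_simps)
    finally show ?thesis using x by simp
  next
    case False
    with assms have t: "0 < t" by simp
    have "2 * x \<le> A / (x / t) + x / t * t" using x t by (intro assms(1)) simp
    then have "x \<le> A * t / x" using t by simp
    then show ?thesis using x by (simp add: field_simps power2_eq_square)
  qed
qed (use assms in simp)

context hilbert_cstar_module
begin

text \<open>
  Linear functionals on the triples \<open>(a, x, s)\<close> are sums \<open>Re (f a) + Re (\<psi> x) + t * s\<close> with
  complex linear \<open>f\<close> and \<open>\<psi>\<close>. The
  infimum of the \<open>m\<close> below is a sublinear functional designed so that such a sum is below it
  iff \<open>f\<close> is positive, \<open>\<psi>\<close> vanishes on \<open>L\<close>,
  \<open>(cmod (\<psi> x))\<^sup>2 \<le> t * Re (f (ip x x))\<close> and \<open>norm f + t \<le> 1\<close>. Indeed, the first three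
  conditions mean that the sum is nonnegative on the triples
  \<open>(k, y - 2 w, T)\<close> for which the real part of \<open>k\<close> is at least \<open>ip w w / T\<close>, and the last one
  bounds the sum on \<open>(b, 0, s)\<close> by \<open>max (norm b) \<bar>s\<bar>\<close>. The gauge of \<open>(a, x, s)\<close> is the infimum
  of the maxima that result from adding a triple of the first kind, with \<open>k = b - a\<close>. The
  term \<open>ip w w / T\<close> is the perspective of the square and therefore jointly convex in \<open>w\<close>
  and \<open>T\<close>.
\<close>

definition gauge_le :: "'e set \<Rightarrow> 'a \<times> 'e \<times> real \<Rightarrow> real \<Rightarrow> bool"
  where "gauge_le L v m \<longleftrightarrow> (case v of (a, x, s) \<Rightarrow> \<exists>T w y b. 0 < T \<and> y \<in> L \<and> x = 2 *\<^sub>R w - y \<and>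
    \<bar>s + T\<bar> \<le> m \<and> norm b \<le> m \<and>
    cstar_positive ((b - a) + star (b - a) - (2 / T) *\<^sub>R ip w w))"

lemma gauge_leI:
  assumes "0 < T" "y \<in> L" "x = 2 *\<^sub>R w - y" "\<bar>s + T\<bar> \<le> m" "norm b \<le> m"
    "cstar_positive ((b - a) + star (b - a) - (2 / T) *\<^sub>R ip w w)"
  shows "gauge_le L (a, x, s) m"
  using assms unfolding gauge_le_def by auto

lemma gauge_le_add:
  assumes L: "\<And>y z. y \<in> L \<Longrightarrow> z \<in> L \<Longrightarrow> y + z \<in> L"
    and v: "gauge_le L v m" and v': "gauge_le L v' m'"
  shows "gauge_le L (v + v') (m + m')"
proof -
  obtain a x s a' x' s' where v_eq: "v = (a, x, s)" "v' = (a', x', s')" by (metis prod_cases3)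
  obtain T w y b where 1: "0 < T" "y \<in> L" "x = 2 *\<^sub>R w - y" "\<bar>s + T\<bar> \<le> m" "norm b \<le> m"
    "cstar_positive ((b - a) + star (b - a) - (2 / T) *\<^sub>R ip w w)"
    using v unfolding v_eq gauge_le_def by auto
  obtain T' w' y' b' where 2: "0 < T'" "y' \<in> L" "x' = 2 *\<^sub>R w' - y'" "\<bar>s' + T'\<bar> \<le> m'" "norm b' \<le> m'"
    "cstar_positive ((b' - a') + star (b' - a') - (2 / T') *\<^sub>R ip w' w')"
    using v' unfolding v_eq gauge_le_def by auto
  define z where "z = T' *\<^sub>R w - T *\<^sub>R w'"
  define c where "c = 2 / (T * T' * (T + T'))"
  have c: "0 \<le> c" using 1(1) 2(1) by (simp add: c_def)
  \<comment> \<open>Convexity of the perspective: the defect is a nonnegative multiple of \<open>ip z z\<close>.\<close>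
  have coef: "c * (T' * T') = 2 / T - 2 / (T + T')" "c * (T * T') = 2 / (T + T')"
    "c * (T * T) = 2 / T' - 2 / (T + T')"
    using 1(1) 2(1) by (simp_all add: c_def divide_simps)
  have "c *\<^sub>R ip z z = (c * (T' * T')) *\<^sub>R ip w w - (c * (T * T')) *\<^sub>R (ip w w' + ip w' w)
      + (c * (T * T)) *\<^sub>R ip w' w'"
    by (simp add: z_def ip_diff_left ip_diff_right ip_scaleR_left ip_scaleR_right algebra_simps)
  also have "\<dots> = (2 / T) *\<^sub>R ip w w + (2 / T') *\<^sub>R ip w' w' - (2 / (T + T')) *\<^sub>R ip (w + w') (w + w')"
    unfolding coef by (simp add: ip_add_left ip_add_right algebra_simps)
  finally have persp: "cstar_positive ((2 / T) *\<^sub>R ip w w + (2 / T') *\<^sub>R ip w' w'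
      - (2 / (T + T')) *\<^sub>R ip (w + w') (w + w'))"
    using cstar_positive_scaleR[OF ip_positive c, of z] by simp
  show ?thesis
    unfolding v_eq add_Pair
  proof (rule gauge_leI)
    show "0 < T + T'" using 1(1) 2(1) by simp
    show "y + y' \<in> L" using L 1(2) 2(2) by blast
    show "x + x' = 2 *\<^sub>R (w + w') - (y + y')" using 1(3) 2(3) by (simp add: algebra_simps)
    show "\<bar>s + s' + (T + T')\<bar> \<le> m + m'" using 1(4) 2(4) by linarith
    show "norm (b + b') \<le> m + m'" using 1(5) 2(5) norm_triangle_ineq[of b b'] by linarith
    have "(b + b' - (a + a')) + star (b + b' - (a + a')) - (2 / (T + T')) *\<^sub>R ip (w + w') (w + w')
      = ((b - a) + star (b - a) - (2 / T) *\<^sub>R ip w w) + ((b' - a') + star (b' - a') - (2 / T') *\<^sub>R ip w' w')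
        + ((2 / T) *\<^sub>R ip w w + (2 / T') *\<^sub>R ip w' w' - (2 / (T + T')) *\<^sub>R ip (w + w') (w + w'))"
      by (simp add: star_diff star_add)
    then show "cstar_positive ((b + b' - (a + a')) + star (b + b' - (a + a'))
        - (2 / (T + T')) *\<^sub>R ip (w + w') (w + w'))"
      using cstar_positive_add[OF cstar_positive_add[OF 1(6) 2(6)] persp] by (simp only:)
  qed
qed

lemma gauge_le_scale:
  assumes L: "\<And>y r. y \<in> L \<Longrightarrow> r *\<^sub>R y \<in> L" and c: "0 < c" and v: "gauge_le L v m"
  shows "gauge_le L (c *\<^sub>R v) (c * m)"
proof -
  obtain a x s where v_eq: "v = (a, x, s)" by (metis prod_cases3)
  obtain T w y b where 1: "0 < T" "y \<in> L" "x = 2 *\<^sub>R w - y" "\<bar>s + T\<bar> \<le> m" "norm b \<le> m"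
    "cstar_positive ((b - a) + star (b - a) - (2 / T) *\<^sub>R ip w w)"
    using v unfolding v_eq gauge_le_def by auto
  show ?thesis
    unfolding v_eq scaleR_Pair
  proof (rule gauge_leI)
    show "0 < c * T" "c *\<^sub>R y \<in> L" using 1 c L by auto
    show "c *\<^sub>R x = 2 *\<^sub>R (c *\<^sub>R w) - c *\<^sub>R y"
      unfolding 1(3) by (simp add: scaleR_right_diff_distrib mult.commute)
    have "\<bar>c *\<^sub>R s + c * T\<bar> = c * \<bar>s + T\<bar>" using c by (simp add: abs_mult flip: distrib_left)
    then show "\<bar>c *\<^sub>R s + c * T\<bar> \<le> c * m" using 1(4) c by simp
    show "norm (c *\<^sub>R b) \<le> c * m" using 1(5) c by simp
    have "(c *\<^sub>R b - c *\<^sub>R a) + star (c *\<^sub>R b - c *\<^sub>R a) - (2 / (c * T)) *\<^sub>R ip (c *\<^sub>R w) (c *\<^sub>R w)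
        = c *\<^sub>R ((b - a) + star (b - a) - (2 / T) *\<^sub>R ip w w)"
      using c by (simp add: star_diff star_scaleR ip_scaleR_left ip_scaleR_right algebra_simps)
    then show "cstar_positive ((c *\<^sub>R b - c *\<^sub>R a) + star (c *\<^sub>R b - c *\<^sub>R a)
        - (2 / (c * T)) *\<^sub>R ip (c *\<^sub>R w) (c *\<^sub>R w))"
      using cstar_positive_scaleR[OF 1(6), of c] c by simp
  qed
qed

text \<open>
  The constraints force \<open>(norm w)\<^sup>2 \<le> T * m \<le> m\<^sup>2\<close>, while \<open>2 w\<close> is a translate of \<open>x0\<close> by
  an element of \<open>L\<close>. So the gauge is strictly positive at a point that has positive distance from \<open>L\<close>.
\<close>

lemma gauge_le_separates:
  assumes "\<And>y. y \<in> L \<Longrightarrow> d \<le> norm (x0 + y)" and m: "gauge_le L (0, x0, 0) m" and d: "0 \<le> d"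
  shows "d / 2 \<le> m"
proof -
  obtain T w y b where 1: "0 < T" "y \<in> L" "x0 = 2 *\<^sub>R w - y" "\<bar>T\<bar> \<le> m" "norm b \<le> m"
    "cstar_positive (b + star b - (2 / T) *\<^sub>R ip w w)"
    using m unfolding gauge_le_def by auto
  have "2 / T * (norm w)\<^sup>2 = norm ((2 / T) *\<^sub>R ip w w)" using 1(1) by (simp add: norm_ip_self)
  also have "\<dots> \<le> norm ((2 / T) *\<^sub>R ip w w + (b + star b - (2 / T) *\<^sub>R ip w w))"
    using 1 by (intro cstar_positive_norm_mono cstar_positive_scaleR ip_positive) auto
  also have "\<dots> \<le> 2 * m" using norm_triangle_ineq[of b "star b"] 1(5) by (simp add: norm_star)
  finally have "(norm w)\<^sup>2 \<le> T * m" using 1(1) by (simp add: field_simps)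
  also have "\<dots> \<le> m\<^sup>2" using 1(1,4) by (simp add: power2_eq_square mult_right_mono)
  finally have "norm w \<le> m" by (rule power2_le_imp_le) (use 1(1,4) in simp)
  moreover have "d \<le> 2 * norm w" using assms(1)[OF 1(2)] 1(3) by simp
  ultimately show ?thesis by simp
qed

text \<open>
  The term \<open>2 * cmod (\<psi> w)\<close> is at most \<open>t * T + Re (f (ip w w)) / T\<close>, by the inequality of
  arithmetic and geometric means; the two constraints on \<open>T\<close> absorb these summands.
\<close>

lemma functional_le_gauge:
  assumes f: "positive_functional f" and fa: "\<And>a. cmod (f a) \<le> \<alpha> * norm a" and \<alpha>: "0 \<le> \<alpha>" and t: "0 \<le> t"
    and \<psi>: "\<And>x y. \<psi> (x + y) = \<psi> x + \<psi> y" "\<And>c y. \<psi> (c *\<^sub>C y) = c * \<psi> y"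
    and bound: "\<And>x. (cmod (\<psi> x))\<^sup>2 \<le> t * Re (f (ip x x))" and L: "\<And>y. y \<in> L \<Longrightarrow> \<psi> y = 0"
    and m: "gauge_le L (a, x, s) m"
  shows "Re (f a) + Re (\<psi> x) + t * s \<le> (\<alpha> + t) * m"
proof -
  note fD = positive_functionalD[OF f]
  have bl: "bounded_linear f"
    by (rule bounded_linear_intro[of _ \<alpha>]) (use fa in \<open>auto simp: fD mult.commute\<close>)
  obtain T w y b where 1: "0 < T" "y \<in> L" "x = 2 *\<^sub>R w - y" "\<bar>s + T\<bar> \<le> m" "norm b \<le> m"
    "cstar_positive ((b - a) + star (b - a) - (2 / T) *\<^sub>R ip w w)"
    using m unfolding gauge_le_def by auto
  have "0 \<le> Re (f ((b - a) + star (b - a) - (2 / T) *\<^sub>R ip w w))"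
    by (rule positive_functional_Re_nonneg[OF f 1(6)])
  then have A: "Re (f a) \<le> Re (f b) - Re (f (ip w w)) / T"
    by (simp add: fD positive_functional_star[OF f bl] field_simps)
  have B: "Re (f b) \<le> \<alpha> * m"
    using complex_Re_le_cmod[of "f b"] fa[of b] mult_left_mono[OF 1(5) \<alpha>] by linarith
  have "2 *\<^sub>R w = 2 *\<^sub>C w" using scaleC_of_real[of 2 w] by simp
  moreover have "\<psi> (2 *\<^sub>R w) = \<psi> x + \<psi> y" using \<psi>(1)[of x y] 1(3) by simp
  ultimately have "\<psi> x = 2 * \<psi> w" using \<psi>(2)[of 2 w] L[OF 1(2)] by simp
  then have "Re (\<psi> x) \<le> 2 * cmod (\<psi> w)" using complex_Re_le_cmod[of "\<psi> w"] by simp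
  also have "\<dots> \<le> Re (f (ip w w)) / T + t * T"
  proof -
    let ?A = "Re (f (ip w w))"
    have A0: "0 \<le> ?A" by (intro positive_functional_Re_nonneg[OF f] ip_positive)
    have "cmod (\<psi> w) \<le> sqrt (t * T) * sqrt (?A / T)"
      using real_sqrt_le_mono[OF bound[of w]] 1(1) by (simp flip: real_sqrt_mult)
    moreover have "2 * sqrt (t * T) * sqrt (?A / T) \<le> (sqrt (t * T))\<^sup>2 + (sqrt (?A / T))\<^sup>2"
      by (rule sum_squares_bound)
    ultimately show ?thesis using t 1(1) A0 by simp
  qed
  finally have "Re (f a) + Re (\<psi> x) + t * s \<le> \<alpha> * m + t * (s + T)" using A B by (simp add: algebra_simps)
  also have "\<dots> \<le> \<alpha> * m + t * m" using 1(4) t by (intro add_left_mono mult_left_mono) auto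
  finally show ?thesis by (simp add: algebra_simps)
qed

text \<open>
  Each constraint on \<open>f\<close>, \<open>\<psi>\<close> and \<open>t\<close> is read off from a special triple of small gauge. Since
  \<open>T\<close> has to be strictly positive, some of these triples carry an error \<open>e\<close> in the last
  component, which tends to \<open>0\<close>.
\<close>

lemma functional_below_gauge:
  assumes q: "linear q" and le: "\<And>v m. gauge_le L v m \<Longrightarrow> q v \<le> m"
    and L: "0 \<in> L" "\<And>y c. y \<in> L \<Longrightarrow> c *\<^sub>C y \<in> L"
  defines "f \<equiv> complexify (\<lambda>a. q (a, 0, 0))" and "\<psi> \<equiv> complexify (\<lambda>x. q (0, x, 0))" and "t \<equiv> q (0, 0, 1)"
  shows "positive_functional f" "0 \<le> t" "\<And>a. cmod (f a) \<le> (1 - t) * norm a" "t \<le> 1"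
    "\<And>x. (cmod (\<psi> x))\<^sup>2 \<le> t * Re (f (ip x x))" "\<And>y. y \<in> L \<Longrightarrow> \<psi> y = 0"
    "\<And>x y. \<psi> (x + y) = \<psi> x + \<psi> y" "\<And>c y. \<psi> (c *\<^sub>C y) = c * \<psi> y"
    "\<And>a x s. q (a, x, s) = Re (f a) + Re (\<psi> x) + t * s"
proof -
  have qa: "q ((a, x, s) + (a', x', s')) = q (a, x, s) + q (a', x', s')" for a x s a' x' s'
    by (rule linear_add[OF q])
  have qs: "q (r *\<^sub>R (a, x, s)) = r * q (a, x, s)" for r a x s
    using linear_scale[OF q, of r "(a, x, s)"] by (simp only: real_scaleR_def)
  have l1: "linear (\<lambda>a. q (a, 0, 0))"
    by (rule linearI) (use qa[of _ 0 0 _ 0 0] qs[of _ _ 0 0] in simp_all)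
  have l2: "linear (\<lambda>x. q (0, x, 0))"
    by (rule linearI) (use qa[of 0 _ 0 0 _ 0] qs[of _ 0 _ 0] in simp_all)
  note f1 = complexify_add[OF l1, folded f_def] complexify_scaleC[OF l1, folded f_def]
    and Ref = Re_complexify[OF l1, folded f_def]
  show \<psi>1: "\<psi> (x + y) = \<psi> x + \<psi> y" "\<psi> (c *\<^sub>C y) = c * \<psi> y" for x y c
    unfolding \<psi>_def by (rule complexify_add[OF l2] complexify_scaleC[OF l2])+
  note Re\<psi> = Re_complexify[OF l2, folded \<psi>_def]
  have qs1: "q (0, 0, s) = t * s" for s using qs[of s 0 0 1] by (simp add: t_def)
  show q_eq: "q (a, x, s) = Re (f a) + Re (\<psi> x) + t * s" for a x s
    using qa[of a x 0 0 0 s] qa[of a 0 0 0 x 0] by (simp add: Ref Re\<psi> qs1)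
  have key: "Re (f a) + Re (\<psi> (2 *\<^sub>R w - y)) + t * s \<le> m"
    if "0 < T" "y \<in> L" "\<bar>s + T\<bar> \<le> m" "norm b \<le> m"
      "cstar_positive ((b - a) + star (b - a) - (2 / T) *\<^sub>R ip w w)" for a b w y s m T
    using le[OF gauge_leI[OF that(1,2) refl that(3-5)]] by (simp add: q_eq)
  have \<psi>0: "\<psi> 0 = 0" using \<psi>1(1)[of 0 0] by simp
  have f0: "f 0 = 0" using f1(1)[of 0 0] by simp
  have fneg: "f (- a) = - f a" for a using f1(2)[of "-1" a] by simp
  show t0: "0 \<le> t" using key[of 1 0 "-1" 0 0 0 0] L(1) by (simp add: \<psi>0 f0)
  have small: "x \<le> 0" if "\<And>e. 0 < e \<Longrightarrow> x \<le> e * t" for x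
  proof (rule field_le_epsilon)
    fix e :: real assume e: "0 < e"
    have "x \<le> e / (t + 1) * t" using e t0 by (intro that) simp
    also have "\<dots> \<le> e" using e t0 by (simp add: field_simps)
    finally show "x \<le> 0 + e" by simp
  qed
  \<comment> \<open>Elements with nonpositive real part; this covers \<open>- a\<close> and \<open>\<plusminus> \<i> a\<close> for positive \<open>a\<close>.\<close>
  have herm: "Re (f h) \<le> 0" if "cstar_positive (- h - star h)" for h
  proof (rule small)
    fix e :: real assume e: "0 < e"
    show "Re (f h) \<le> e * t" using key[of e 0 "- e" 0 0 h 0] L(1) e that by (simp add: \<psi>0 star_minus algebra_simps)
  qed
  have pos: "f a \<in> \<real>\<^sub>\<ge>\<^sub>0" if a: "cstar_positive a" for a
  proof -
    have sa: "star a = a" using a by (auto simp: cstar_positive_def star_mult star_star)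
    have "0 \<le> Re (f a)"
      using herm[of "- a"] cstar_positive_add[OF a a] by (simp add: sa star_minus fneg)
    moreover have "Re (f (\<i> *\<^sub>C a)) = 0"
    proof -
      have mi: "(- \<i>) *\<^sub>C a = - (\<i> *\<^sub>C a)" using scaleC_scaleC[of "-1" \<i> a] by simp
      show ?thesis
        using herm[of "\<i> *\<^sub>C a"] herm[of "- (\<i> *\<^sub>C a)"] by (simp add: star_minus star_scaleC sa mi fneg)
    qed
    ultimately show ?thesis by (simp add: f1(2) complex_nonneg_Reals_iff)
  qed
  show posf: "positive_functional f"
    unfolding positive_functional_def using f1 pos by blast
  have nb: "Re (f a) + t * s \<le> max (norm a) \<bar>s\<bar>" for a s
  proof (rule field_le_epsilon)
    fix e :: real assume e: "0 < e"
    show "Re (f a) + t * s \<le> max (norm a) \<bar>s\<bar> + e"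
      using key[of e 0 s "max (norm a) \<bar>s\<bar> + e" a a 0] L(1) e by (simp add: \<psi>0)
  qed
  show t1: "t \<le> 1" using nb[of 0 1] by (simp add: f0)
  have Ref_le: "Re (f a) \<le> (1 - t) * norm a" for a
    using nb[of a "norm a"] by (simp add: algebra_simps)
  show "cmod (f a) \<le> (1 - t) * norm a" for a
    unfolding f_def
  proof (rule cmod_complexify_le[OF l1])
    show "q (c *\<^sub>C a, 0, 0) \<le> (1 - t) * norm a" if "cmod c = 1" for c
      using Ref_le[of "c *\<^sub>C a"] that by (simp add: Ref norm_scaleC)
  qed (use t1 in simp)
  show "(cmod (\<psi> x))\<^sup>2 \<le> t * Re (f (ip x x))" for x
  proof (rule sq_le_of_weighted_am_gm)
    show A0: "0 \<le> Re (f (ip x x))" by (intro positive_functional_Re_nonneg[OF posf] ip_positive)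
    show "2 * cmod (\<psi> x) \<le> Re (f (ip x x)) / T + T * t" if T: "0 < T" for T
    proof -
      have "cmod (\<psi> x) \<le> (Re (f (ip x x)) / T + T * t) / 2"
        unfolding \<psi>_def
      proof (rule cmod_complexify_le[OF l2])
        fix c assume c: "cmod c = 1"
        have "c * cnj c = 1" using complex_norm_square[of c] c by simp
        then have "ip (c *\<^sub>C x) (c *\<^sub>C x) = ip x x"
          by (simp add: ip_scaleC_left ip_scaleC_right scaleC_scaleC)
        moreover have "star ((1 / T) *\<^sub>R ip x x) = (1 / T) *\<^sub>R ip x x" by (simp add: star_scaleR star_ip_self)
        ultimately have "Re (f (- ((1 / T) *\<^sub>R ip x x))) + Re (\<psi> (2 *\<^sub>R (c *\<^sub>C x) - 0)) + t * (- T) \<le> 0"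
          using L(1) T by (intro key[of T 0 _ _ 0]) (simp_all flip: scaleR_left_distrib)
        moreover have "\<psi> (2 *\<^sub>R (c *\<^sub>C x)) = 2 * \<psi> (c *\<^sub>C x)"
          by (simp add: scaleR_2 \<psi>1(1))
        ultimately have "2 * Re (\<psi> (c *\<^sub>C x)) \<le> Re (f (ip x x)) / T + T * t"
          by (simp add: fneg positive_functionalD(6)[OF posf] algebra_simps)
        then show "q (0, c *\<^sub>C x, 0) \<le> (Re (f (ip x x)) / T + T * t) / 2" by (simp add: Re\<psi>)
      qed (use A0 T t0 in simp)
      then show ?thesis by simp
    qed
  qed (use t0 in simp_all)
  have \<psi>L: "Re (\<psi> y) = 0" if y: "y \<in> L" for y
  proof -
    have ym: "- y \<in> L" using L(2)[OF y, of "-1"] by simp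
    have neg: "\<psi> (- z) = - \<psi> z" for z using \<psi>1(2)[of "-1" z] by simp
    have "Re (\<psi> (- z)) \<le> 0" if z: "z \<in> L" for z
    proof (rule small)
      fix e :: real assume "0 < e"
      then show "Re (\<psi> (- z)) \<le> e * t"
        using key[of e z "- e" 0 0 0 0] z by (simp add: f0 mult.commute)
    qed
    from this[OF y] this[OF ym] show ?thesis by (simp add: neg)
  qed
  show "\<psi> y = 0" if y: "y \<in> L" for y
  proof (rule complex_eqI)
    show "Re (\<psi> y) = Re 0" using \<psi>L[OF y] by simp
    show "Im (\<psi> y) = Im 0" using \<psi>L[OF L(2)[OF y, of \<i>]] by (simp add: \<psi>1(2))
  qed
qed

text \<open>
  Take an extreme point \<open>(f, \<psi>, t)\<close> of the triples below the gauge at which the value at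
  \<open>(0, x0, 0)\<close> is maximal; this value is positive, so \<open>\<psi> x0 \<noteq> 0\<close> and \<open>f \<noteq> 0\<close>. If the
  normalized \<open>f\<close> were a proper convex combination of two states, then \<open>\<psi>\<close> and \<open>t\<close> would split
  accordingly, and \<open>(f, \<psi>, t)\<close> would be a convex combination of two normalized triples. By
  extremality both summands are proportional to it, so the two states agree. Hence the normalized
  \<open>f\<close> is pure.

  An extreme point among the functionals \<open>f\<close> alone would not do: the set of states at which
  \<open>x0\<close> remains separated from \<open>L\<close> need not be a face. Carrying \<open>\<psi>\<close> along repairs this.
\<close>

theorem ex_separating_pure_state:
  assumes L: "closed_submodule act L" and x0: "x0 \<notin> L"
  obtains f \<psi> t where "f \<in> pure_states" "0 \<le> t"
    "\<And>x y. \<psi> (x + y) = \<psi> x + \<psi> y" "\<And>c y. \<psi> (c *\<^sub>C y) = c * \<psi> y"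
    "\<And>x. (cmod (\<psi> x))\<^sup>2 \<le> t * Re (blinfun_apply f (ip x x))" "\<And>y. y \<in> L \<Longrightarrow> \<psi> y = 0" "\<psi> x0 \<noteq> 0"
proof -
  have L0: "0 \<in> L" and Ladd: "\<And>y z. y \<in> L \<Longrightarrow> z \<in> L \<Longrightarrow> y + z \<in> L"
    and LC: "\<And>c y. y \<in> L \<Longrightarrow> c *\<^sub>C y \<in> L" and Lact: "\<And>y a. y \<in> L \<Longrightarrow> act y a \<in> L" and Lcl: "closed L"
    using L unfolding closed_submodule_def by auto
  have LR: "r *\<^sub>R y \<in> L" if "y \<in> L" for r y using LC[OF that, of "complex_of_real r"] by (simp add: scaleC_of_real)
  define d where "d = infdist x0 L"
  have d: "0 < d"
    unfolding d_def using x0 L0 Lcl infdist_nonneg[of x0 L] in_closed_iff_infdist_zero[of L x0] by fastforce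
  have dist: "d \<le> norm (x0 + y)" if "y \<in> L" for y
    using infdist_le[OF LR[OF that, of "-1"], of x0] by (simp add: d_def dist_norm)
  define p where "p v = Inf {m. gauge_le L v m}" for v
  have tot: "\<exists>m. gauge_le L v m" for v
  proof -
    obtain a x s where v: "v = (a, x, s)" by (metis prod_cases3)
    let ?w = "(1/2) *\<^sub>R x"
    have "gauge_le L (a, x, s) (max \<bar>s + 1\<bar> (norm (a + ip ?w ?w)))"
      by (rule gauge_leI[of 1 0 _ _ ?w _ _ "a + ip ?w ?w"]) (simp_all add: L0 star_ip_self scaleR_2)
    then show ?thesis using v by blast
  qed
  have nn: "0 \<le> m" if "gauge_le L v m" for v m
    using that unfolding gauge_le_def by (auto intro: order_trans[OF abs_ge_zero])
  have zero: "gauge_le L 0 m" if "0 < m" for m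
    unfolding zero_prod_def by (rule gauge_leI[of m 0 _ _ 0 _ _ 0]) (use that L0 in simp_all)
  have p: "sublinear p" and ple: "\<And>v m. gauge_le L v m \<Longrightarrow> p v \<le> m"
    and pge: "\<And>v b. (\<And>m. gauge_le L v m \<Longrightarrow> b \<le> m) \<Longrightarrow> b \<le> p v"
    unfolding p_def using sublinear_Inf[of "gauge_le L"] gauge_le_add[OF Ladd] gauge_le_scale[OF LR] tot nn zero by blast+
  define v0 :: "'a \<times> 'e \<times> real" where "v0 = (0, x0, 0)"
  have pv0: "0 < p v0"
  proof -
    have "d / 2 \<le> p v0" unfolding v0_def using dist d by (intro pge gauge_le_separates) auto
    then show ?thesis using d by simp
  qed
  obtain q where q: "linear q" "q \<le> p" "q v0 = p v0"
    and ext: "\<And>g h t. linear g \<Longrightarrow> linear h \<Longrightarrow> g \<le> p \<Longrightarrow> h \<le> p \<Longrightarrow> 0 < t \<Longrightarrow> t < 1 \<Longrightarrow>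
      q = (\<lambda>x. t * g x + (1 - t) * h x) \<Longrightarrow> g = q \<and> h = q"
    using ex_extreme_linear_below_sublinear[OF p] by blast
  have qle: "q v \<le> m" if "gauge_le L v m" for v m
    using le_funD[OF q(2), of v] ple[OF that] by simp
  define f where "f = complexify (\<lambda>a. q (a, 0, 0))"
  define \<psi> where "\<psi> = complexify (\<lambda>x. q (0, x, 0))"
  define t where "t = q (0, 0, 1)"
  note F = functional_below_gauge[OF q(1) qle L0 LC, folded f_def \<psi>_def t_def]
  note fD = positive_functionalD[OF F(1)]
  have \<psi>x0: "Re (\<psi> x0) = p v0" using F(9)[of 0 x0 0] q(3) fD(4) by (simp add: v0_def)
  have blf: "bounded_linear f"
    by (rule bounded_linear_intro[of _ "1 - t"]) (use F(3) in \<open>auto simp: fD mult.commute\<close>)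
  define fb where "fb = Blinfun f"
  have fb: "blinfun_apply fb = f" unfolding fb_def by (rule bounded_linear_Blinfun_apply[OF blf])
  define \<alpha> where "\<alpha> = norm fb"
  have \<alpha>t: "\<alpha> + t \<le> 1"
  proof -
    have "norm fb \<le> 1 - t" by (rule norm_blinfun_bound) (use F(3,4) fb in auto)
    then show ?thesis by (simp add: \<alpha>_def)
  qed
  have "fb \<noteq> 0"
  proof
    assume "fb = 0"
    then have "f a = 0" for a using fb by (metis zero_blinfun.rep_eq)
    then have "\<psi> x0 = 0" using F(5)[of x0] by simp
    then show False using \<psi>x0 pv0 by simp
  qed
  then have \<alpha>: "0 < \<alpha>" by (simp add: \<alpha>_def)
  have fR: "f (r *\<^sub>R a) = complex_of_real r * f a" for r a by (simp add: fD scaleR_conv_of_real)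
  define g where "g = (1 / \<alpha>) *\<^sub>R fb"
  have g_app: "blinfun_apply g a = f a / \<alpha>" for a
    by (simp add: g_def scaleR_blinfun.rep_eq fb scaleR_conv_of_real)
  have "positive_functional (blinfun_apply g)"
    unfolding positive_functional_def g_app
    using fD \<alpha> by (auto simp: add_divide_distrib complex_nonneg_Reals_iff)
  moreover have "norm g = 1" using \<alpha> by (simp add: g_def \<alpha>_def)
  ultimately have g_state: "g \<in> states" by (simp add: states_def)
  have "g \<notin> open_segment g1 g2" if g1: "g1 \<in> states" and g2: "g2 \<in> states" for g1 g2
  proof
    assume "g \<in> open_segment g1 g2"
    then obtain u where u: "0 < u" "u < 1" "g = (1 - u) *\<^sub>R g1 + u *\<^sub>R g2" and ne: "g1 \<noteq> g2"
      by (auto simp: in_segment)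
    have pg1: "positive_functional (blinfun_apply g1)" "norm g1 = 1"
      and pg2: "positive_functional (blinfun_apply g2)" "norm g2 = 1"
      using g1 g2 by (auto simp: states_def)
    define \<alpha>1 where "\<alpha>1 = \<alpha> * (1 - u)"
    define \<alpha>2 where "\<alpha>2 = \<alpha> * u"
    have a12: "0 < \<alpha>1" "0 < \<alpha>2" "\<alpha>1 + \<alpha>2 = \<alpha>" using \<alpha> u by (auto simp: \<alpha>1_def \<alpha>2_def algebra_simps)
    define f1 where "f1 a = complex_of_real \<alpha>1 * blinfun_apply g1 a" for a
    define f2 where "f2 a = complex_of_real \<alpha>2 * blinfun_apply g2 a" for a
    have pf1: "positive_functional f1" and pf2: "positive_functional f2"
      unfolding positive_functional_def f1_def f2_def
      using positive_functionalD[OF pg1(1)] positive_functionalD[OF pg2(1)] a12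
      by (auto simp: algebra_simps complex_nonneg_Reals_iff)
    have nf1: "cmod (f1 a) \<le> \<alpha>1 * norm a" and nf2: "cmod (f2 a) \<le> \<alpha>2 * norm a" for a
      using norm_blinfun[of g1 a] norm_blinfun[of g2 a] pg1(2) pg2(2) a12
      by (auto simp: f1_def f2_def norm_mult)
    have sum: "f a = f1 a + f2 a" for a
    proof -
      have "f a = \<alpha> * blinfun_apply g a" using \<alpha> by (simp add: g_app)
      then show ?thesis
        unfolding u(3) f1_def f2_def \<alpha>1_def \<alpha>2_def plus_blinfun.rep_eq scaleR_blinfun.rep_eq
        by (simp add: scaleR_conv_of_real algebra_simps)
    qed
    obtain \<psi>1 \<psi>2 t1 t2 where S:
      "\<And>x y. \<psi>1 (x + y) = \<psi>1 x + \<psi>1 y" "\<And>c y. \<psi>1 (c *\<^sub>C y) = c * \<psi>1 y"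
      "\<And>x y. \<psi>2 (x + y) = \<psi>2 x + \<psi>2 y" "\<And>c y. \<psi>2 (c *\<^sub>C y) = c * \<psi>2 y"
      "\<And>y. \<psi> y = \<psi>1 y + \<psi>2 y" "t = t1 + t2" "0 \<le> t1" "0 \<le> t2"
      "\<And>x. (cmod (\<psi>1 x))\<^sup>2 \<le> t1 * Re (f1 (ip x x))" "\<And>x. (cmod (\<psi>2 x))\<^sup>2 \<le> t2 * Re (f2 (ip x x))"
      "\<And>y. y \<in> L \<Longrightarrow> \<psi>1 y = 0" "\<And>y. y \<in> L \<Longrightarrow> \<psi>2 y = 0"
    proof (rule split_bounded_functional[OF pf1 _ pf2 _ _ F(7,8,2) _ Lact F(6)])
      show "cmod (f1 a) \<le> \<alpha> * norm a" "cmod (f2 a) \<le> \<alpha> * norm a" for a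
        using nf1[of a] nf2[of a] mult_right_mono[of \<alpha>1 \<alpha> "norm a"] mult_right_mono[of \<alpha>2 \<alpha> "norm a"] a12
        by auto
    qed (use \<alpha> F(5) sum in auto)
    have part: "linear Q \<and> Q \<le> p"
      if Q: "Q = (\<lambda>(a, x, s). (Re (h a) + Re (\<eta> x) + k * s) / (\<beta> + k))"
        and h: "positive_functional h" "\<And>a. cmod (h a) \<le> \<beta> * norm a" and \<beta>: "0 < \<beta>" and k: "0 \<le> k"
        and \<eta>: "\<And>x y. \<eta> (x + y) = \<eta> x + \<eta> y" "\<And>c y. \<eta> (c *\<^sub>C y) = c * \<eta> y"
        "\<And>x. (cmod (\<eta> x))\<^sup>2 \<le> k * Re (h (ip x x))" "\<And>y. y \<in> L \<Longrightarrow> \<eta> y = 0"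
      for Q h \<eta> k \<beta>
    proof
      have cR: "\<eta> (r *\<^sub>R x) = complex_of_real r * \<eta> x" for r x
        using \<eta>(2)[of "complex_of_real r" x] by (simp add: scaleC_of_real)
      show "linear Q"
        unfolding Q using positive_functionalD[OF h(1)] \<eta>(1) cR
        by (intro linearI) (auto simp: add_divide_distrib algebra_simps)
      show "Q \<le> p"
      proof (rule le_funI)
        fix v :: "'a \<times> 'e \<times> real"
        obtain a x s where v: "v = (a, x, s)" by (metis prod_cases3)
        show "Q v \<le> p v"
        proof (rule pge)
          fix m assume "gauge_le L v m"
          then have "Re (h a) + Re (\<eta> x) + k * s \<le> (\<beta> + k) * m"
            unfolding v by (intro functional_le_gauge[OF h _ k \<eta>]) (use \<beta> in auto)
          then show "Q v \<le> m" using \<beta> k by (simp add: Q v divide_le_eq mult.commute add_pos_nonneg)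
        qed
      qed
    qed
    define N1 where "N1 = \<alpha>1 + t1"
    define N2 where "N2 = \<alpha>2 + t2"
    have N: "0 < N1" "0 < N2" "N1 + N2 \<le> 1" using a12 S(6-8) \<alpha>t by (auto simp: N1_def N2_def)
    define Q1 where "Q1 = (\<lambda>(a, x, s). (Re (f1 a) + Re (\<psi>1 x) + t1 * s) / N1)"
    define Q2 where "Q2 = (\<lambda>(a, x, s). (Re (f2 a) + Re (\<psi>2 x) + t2 * s) / N2)"
    have Q1: "linear Q1 \<and> Q1 \<le> p"
      by (rule part[OF Q1_def[unfolded N1_def] pf1 nf1 a12(1) S(7,1,2,9,11)])
    have Q2: "linear Q2 \<and> Q2 \<le> p"
      by (rule part[OF Q2_def[unfolded N2_def] pf2 nf2 a12(2) S(8,3,4,10,12)])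
    have qsum: "q v = N1 * Q1 v + N2 * Q2 v" for v :: "'a \<times> 'e \<times> real"
    proof -
      obtain a x s where v: "v = (a, x, s)" by (metis prod_cases3)
      have "N1 * Q1 v = Re (f1 a) + Re (\<psi>1 x) + t1 * s" "N2 * Q2 v = Re (f2 a) + Re (\<psi>2 x) + t2 * s"
        using N by (simp_all add: v Q1_def Q2_def)
      then show ?thesis by (simp add: v F(9) sum S(5,6) algebra_simps)
    qed
    \<comment> \<open>Both normalized summands are at most \<open>p v0\<close> at \<open>v0\<close>, so no weight can be lost.\<close>
    have "p v0 \<le> (N1 + N2) * p v0"
      using qsum[of v0] q(3) le_funD[OF conjunct2[OF Q1], of v0] le_funD[OF conjunct2[OF Q2], of v0] N
        mult_left_mono[of "Q1 v0" "p v0" N1] mult_left_mono[of "Q2 v0" "p v0" N2]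
      by (simp add: algebra_simps)
    then have N12: "N2 = 1 - N1" using N pv0 by auto
    have "Q1 = q \<and> Q2 = q"
      by (rule ext[of Q1 Q2 N1]) (use Q1 Q2 N N12 qsum in \<open>auto simp: fun_eq_iff\<close>)
    then have Qeq: "Q1 (a, 0, 0) = q (a, 0, 0)" "Q2 (a, 0, 0) = q (a, 0, 0)" for a by auto
    have "\<psi> 0 = 0" "\<psi>1 0 = 0" "\<psi>2 0 = 0" using F(7)[of 0 0] S(1)[of 0 0] S(3)[of 0 0] by auto
    then have re: "Re (f1 a) = N1 * Re (f a)" "Re (f2 a) = N2 * Re (f a)" for a
      using Qeq[of a] N(1,2) F(9)[of a 0 0] unfolding Q1_def Q2_def by (simp_all add: divide_eq_eq mult.commute)
    have eq: "f1 a = N1 * f a" "f2 a = N2 * f a" for a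
      using re[of a] re[of "\<i> *\<^sub>C a"]
      by (auto intro!: complex_eqI simp: positive_functionalD(2)[OF pf1] positive_functionalD(2)[OF pf2] fD(2))
    have "g1 = (N1 / \<alpha>1) *\<^sub>R fb" "g2 = (N2 / \<alpha>2) *\<^sub>R fb"
      using eq a12 by (auto intro!: blinfun_eqI simp: f1_def f2_def scaleR_blinfun.rep_eq fb
          scaleR_conv_of_real field_simps)
    moreover from this have "N1 / \<alpha>1 * \<alpha> = 1" "N2 / \<alpha>2 * \<alpha> = 1"
      using pg1(2) pg2(2) N a12 by (auto simp: \<alpha>_def)
    then have "N1 / \<alpha>1 = N2 / \<alpha>2" using \<alpha> by (metis mult_right_cancel less_irrefl)
    ultimately show False using ne by simp
  qed
  then have "g \<in> pure_states" using g_state by (simp add: pure_states_def extreme_point_of_def)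
  moreover have "(cmod (\<psi> x))\<^sup>2 \<le> (t * \<alpha>) * Re (blinfun_apply g (ip x x))" for x
    using F(5)[of x] \<alpha> by (simp add: g_app)
  moreover have "\<psi> x0 \<noteq> 0" using \<psi>x0 pv0 by auto
  ultimately show ?thesis using that[of g "t * \<alpha>" \<psi>] F(2,6,7,8) \<alpha> by auto
qed

end

section \<open>Localizations\<close>

locale localized_module = hilbert_cstar_module act ip
  for act :: "'e::complex_banach \<Rightarrow> 'a::cstar_algebra \<Rightarrow> 'e" and ip +
  fixes f :: "'a \<Rightarrow> complex"
  assumes positive: "positive_functional f"
begin

sublocale semi_inner "\<lambda>x y. f (ip x y)"
  by (rule semi_inner_module[OF positive])

abbreviation coset :: "'e \<Rightarrow> 'e set" where "coset x \<equiv> x +o null_space ip f"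

lemma mem_null_space: "x \<in> null_space ip f \<longleftrightarrow> sn x = 0"
  by (simp add: null_space_def self)

lemma mem_coset: "y \<in> coset x \<longleftrightarrow> sn (y - x) = 0"
  unfolding elt_set_plus_def mem_null_space[symmetric] by (auto intro: bexI[of _ "y - x"])

lemma inner_eq_if_sn_0:
  assumes "sn (x' - x) = 0" "sn (y' - y) = 0"
  shows "f (ip x' y') = f (ip x y)"
proof -
  have "f (ip x' y') - f (ip x y) = f (ip (x' - x) y') + f (ip x (y' - y))"
    by (simp add: diff_left diff_right)
  moreover have "f (ip (x' - x) y') = 0" "f (ip x (y' - y)) = 0"
    using cauchy_schwarz[of "x' - x" y'] cauchy_schwarz[of x "y' - y"] assms by simp_all
  ultimately show ?thesis by simp
qed

lemma vinner_quotient: "vinner (quotient_space ip f) (coset x) (coset y) = f (ip x y)"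
  unfolding quotient_space_def inner_space.simps
proof (rule the_equality)
  show "\<forall>x'\<in>coset x. \<forall>y'\<in>coset y. f (ip x' y') = f (ip x y)"
    by (auto simp: mem_coset intro: inner_eq_if_sn_0)
  show "z = f (ip x y)" if "\<forall>x'\<in>coset x. \<forall>y'\<in>coset y. f (ip x' y') = z" for z
    using that by (auto simp: mem_coset)
qed

lemma vadd_quotient: "vadd (quotient_space ip f) (coset x) (coset y) = coset (x + y)"
proof -
  have "coset x + coset y = coset (x + y)"
  proof (intro set_eqI iffI)
    fix z assume "z \<in> coset x + coset y"
    then obtain x' y' where z: "z = x' + y'" "sn (x' - x) = 0" "sn (y' - y) = 0"
      by (auto elim!: set_plus_elim simp: mem_coset)
    then have "sn (z - (x + y)) \<le> 0"
      using sn_triangle[of "x' - x" "y' - y"] by (simp add: algebra_simps)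
    then show "z \<in> coset (x + y)" using sn_nonneg[of "z - (x + y)"] by (simp only: mem_coset)
  next
    fix z assume "z \<in> coset (x + y)"
    then have "z - x \<in> coset y" "x \<in> coset x" by (simp_all add: mem_coset diff_diff_eq)
    then show "z \<in> coset x + coset y" using set_plus_intro[of x "coset x" "z - x" "coset y"] by simp
  qed
  then show ?thesis by (simp add: quotient_space_def)
qed

lemma vscale_quotient: "vscale (quotient_space ip f) c (coset x) = coset (c *\<^sub>C x)"
proof -
  have "scaleC c ` coset x + null_space ip f = coset (c *\<^sub>C x)"
  proof (rule set_eqI)
    fix z
    have "sn (c *\<^sub>C y + n - c *\<^sub>C x) = 0" if "sn (y - x) = 0" "sn n = 0" for y n
    proof -
      have "sn (c *\<^sub>C (y - x) + n) \<le> 0"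
        using sn_triangle[of "c *\<^sub>C (y - x)" n] that by (simp add: sn_scaleC)
      moreover have "c *\<^sub>C y + n - c *\<^sub>C x = c *\<^sub>C (y - x) + n" by (simp add: scaleC_diff_right)
      ultimately have "sn (c *\<^sub>C y + n - c *\<^sub>C x) \<le> 0" by (simp only:)
      then show ?thesis using sn_nonneg[of "c *\<^sub>C y + n - c *\<^sub>C x"] by linarith
    qed
    then have "z \<in> scaleC c ` coset x + null_space ip f \<Longrightarrow> sn (z - c *\<^sub>C x) = 0"
      by (auto elim!: set_plus_elim simp: mem_coset mem_null_space)
    moreover have "z \<in> scaleC c ` coset x + null_space ip f" if "sn (z - c *\<^sub>C x) = 0"
    proof -
      have "c *\<^sub>C x \<in> scaleC c ` coset x" "z - c *\<^sub>C x \<in> null_space ip f"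
        using that by (auto simp: mem_coset mem_null_space)
      from set_plus_intro[OF this] show ?thesis by simp
    qed
    ultimately show "z \<in> scaleC c ` coset x + null_space ip f \<longleftrightarrow> z \<in> coset (c *\<^sub>C x)"
      unfolding mem_coset by blast
  qed
  then show ?thesis by (simp add: quotient_space_def)
qed

lemma vdist_quotient: "vdist (quotient_space ip f) (coset x) (coset y) = sn (x - y)"
  by (simp add: vdist_def vscale_quotient vadd_quotient vinner_quotient sn_def)

lemma cauchy_seqs_quotient:
  "cauchy_seqs (quotient_space ip f) = {\<lambda>n. coset (X n) | X. s_Cauchy X}"
proof (intro set_eqI iffI)
  fix Y assume Y: "Y \<in> cauchy_seqs (quotient_space ip f)"
  then have "range Y \<subseteq> range coset" by (simp add: cauchy_seqs_def quotient_space_def)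
  then have "\<forall>n. \<exists>x. Y n = coset x" by blast
  then obtain X where "Y = (\<lambda>n. coset (X n))" by metis
  then show "Y \<in> {\<lambda>n. coset (X n) | X. s_Cauchy X}"
    using Y by (auto simp: cauchy_seqs_def vdist_quotient s_Cauchy_def)
next
  fix Y assume "Y \<in> {\<lambda>n. coset (X n) | X. s_Cauchy X}"
  then show "Y \<in> cauchy_seqs (quotient_space ip f)"
    by (auto simp: cauchy_seqs_def vdist_quotient s_Cauchy_def) (auto simp: quotient_space_def)
qed

text \<open>
  Every vector of the localization is of this form for a Cauchy sequence of module elements. The
  lemmas that follow compute the operations of the completion on such sequences, so that
  the equality of subspaces in the theorem becomes a statement about sequences in the module.
\<close>

definition loc_class :: "(nat \<Rightarrow> 'e) \<Rightarrow> (nat \<Rightarrow> 'e set) set"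
  where "loc_class X = seq_class (quotient_space ip f) (\<lambda>n. coset (X n))"

lemma mem_loc_class:
  "Y \<in> loc_class X \<longleftrightarrow> (\<exists>Z. Y = (\<lambda>n. coset (Z n)) \<and> s_Cauchy Z \<and> (\<lambda>n. sn (X n - Z n)) \<longlonglongrightarrow> 0)"
  by (auto simp: loc_class_def seq_class_def cauchy_seqs_quotient vdist_quotient)

lemma vecs_localization: "vecs (localization ip f) = loc_class ` {X. s_Cauchy X}"
  by (auto simp: localization_def hilbert_completion_def cauchy_seqs_quotient loc_class_def)

lemma completion_embed_coset: "completion_embed (quotient_space ip f) (coset x) = loc_class (\<lambda>_. x)"
  by (simp add: completion_embed_def loc_class_def)

lemma sn_diff_tendsto_trans:
  assumes "(\<lambda>n. sn (X n - Y n)) \<longlonglongrightarrow> 0" "(\<lambda>n. sn (Y n - Z n)) \<longlonglongrightarrow> 0"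
  shows "(\<lambda>n. sn (X n - Z n)) \<longlonglongrightarrow> 0"
  by (rule Lim_null_comparison[OF _ tendsto_add_zero[OF assms]]) (simp add: sn_triangle_diff)

lemma loc_class_eqI:
  assumes "(\<lambda>n. sn (X n - Y n)) \<longlonglongrightarrow> 0"
  shows "loc_class X = loc_class Y"
proof -
  have sub: "loc_class X \<subseteq> loc_class Y" if "(\<lambda>n. sn (Y n - X n)) \<longlonglongrightarrow> 0" for X Y
  proof
    fix W assume "W \<in> loc_class X"
    then obtain Z where "W = (\<lambda>n. coset (Z n))" "s_Cauchy Z" "(\<lambda>n. sn (X n - Z n)) \<longlonglongrightarrow> 0"
      unfolding mem_loc_class by blast
    then show "W \<in> loc_class Y"
      unfolding mem_loc_class using sn_diff_tendsto_trans[OF that] by blast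
  qed
  have "(\<lambda>n. sn (Y n - X n)) \<longlonglongrightarrow> 0" using assms by (subst sn_diff_commute)
  then show ?thesis using sub assms by blast
qed

lemma seq_rep_loc_class:
  assumes "s_Cauchy X"
  obtains Z where "seq_rep (loc_class X) = (\<lambda>n. coset (Z n))" "s_Cauchy Z" "(\<lambda>n. sn (X n - Z n)) \<longlonglongrightarrow> 0"
proof -
  have "(\<lambda>n. coset (X n)) \<in> loc_class X" using assms by (auto simp: mem_loc_class)
  then have "seq_rep (loc_class X) \<in> loc_class X" unfolding seq_rep_def by (rule someI[of "\<lambda>Y. Y \<in> loc_class X"])
  then show ?thesis using that by (auto simp: mem_loc_class)
qed

lemma vinner_localization:
  assumes X: "s_Cauchy X" and Y: "s_Cauchy Y"
  shows "(\<lambda>n. f (ip (X n) (Y n))) \<longlonglongrightarrow> vinner (localization ip f) (loc_class X) (loc_class Y)"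
proof -
  obtain Z where Z: "seq_rep (loc_class X) = (\<lambda>n. coset (Z n))" "s_Cauchy Z" "(\<lambda>n. sn (X n - Z n)) \<longlonglongrightarrow> 0"
    using seq_rep_loc_class[OF X] by blast
  obtain W where W: "seq_rep (loc_class Y) = (\<lambda>n. coset (W n))" "s_Cauchy W" "(\<lambda>n. sn (Y n - W n)) \<longlonglongrightarrow> 0"
    using seq_rep_loc_class[OF Y] by blast
  obtain B where B: "0 \<le> B" "\<And>n. sn (Z n) \<le> B" using s_Cauchy_bounded[OF Z(2)] by blast
  obtain C where C: "0 \<le> C" "\<And>n. sn (Y n) \<le> C" using s_Cauchy_bounded[OF Y] by blast
  have eq: "vinner (localization ip f) (loc_class X) (loc_class Y) = lim (\<lambda>n. f (ip (Z n) (W n)))"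
    by (simp add: localization_def hilbert_completion_def Z(1) W(1) vinner_quotient)
  have l: "(\<lambda>n. f (ip (Z n) (W n))) \<longlonglongrightarrow> lim (\<lambda>n. f (ip (Z n) (W n)))"
    using s_Cauchy_inner_convergent[OF Z(2) W(2)] by (simp add: convergent_LIMSEQ_iff)
  have "(\<lambda>n. f (ip (X n) (Y n)) - f (ip (Z n) (W n))) \<longlonglongrightarrow> 0"
  proof (rule Lim_null_comparison)
    have "(\<lambda>n. sn (X n - Z n) * C + B * sn (Y n - W n)) \<longlonglongrightarrow> 0 * C + B * 0"
      by (intro tendsto_intros Z W)
    then show "(\<lambda>n. sn (X n - Z n) * C + B * sn (Y n - W n)) \<longlonglongrightarrow> 0" by simp
    have "cmod (f (ip (X n) (Y n)) - f (ip (Z n) (W n))) \<le> sn (X n - Z n) * C + B * sn (Y n - W n)" for n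
    proof -
      have "cmod (f (ip (X n) (Y n)) - f (ip (Z n) (W n)))
          \<le> sn (X n - Z n) * sn (Y n) + sn (Z n) * sn (Y n - W n)" by (rule inner_diff_le)
      also have "\<dots> \<le> sn (X n - Z n) * C + B * sn (Y n - W n)"
        by (intro add_mono mult_left_mono mult_right_mono B C sn_nonneg)
      finally show ?thesis .
    qed
    then show "\<forall>\<^sub>F n in sequentially. norm (f (ip (X n) (Y n)) - f (ip (Z n) (W n)))
        \<le> sn (X n - Z n) * C + B * sn (Y n - W n)" by simp
  qed
  from tendsto_add[OF this l] show ?thesis by (simp add: eq)
qed

lemma vadd_localization:
  assumes X: "s_Cauchy X" and Y: "s_Cauchy Y"
  shows "vadd (localization ip f) (loc_class X) (loc_class Y) = loc_class (\<lambda>n. X n + Y n)"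
proof -
  obtain Z where Z: "seq_rep (loc_class X) = (\<lambda>n. coset (Z n))" "(\<lambda>n. sn (X n - Z n)) \<longlonglongrightarrow> 0"
    using seq_rep_loc_class[OF X] by blast
  obtain W where W: "seq_rep (loc_class Y) = (\<lambda>n. coset (W n))" "(\<lambda>n. sn (Y n - W n)) \<longlonglongrightarrow> 0"
    using seq_rep_loc_class[OF Y] by blast
  have "sn (X n + Y n - (Z n + W n)) \<le> sn (X n - Z n) + sn (Y n - W n)" for n
    using sn_triangle[of "X n - Z n" "Y n - W n"] by (simp add: algebra_simps)
  then have "(\<lambda>n. sn (X n + Y n - (Z n + W n))) \<longlonglongrightarrow> 0"
    by (intro Lim_null_comparison[OF _ tendsto_add_zero[OF Z(2) W(2)]]) simp
  then have "loc_class (\<lambda>n. X n + Y n) = loc_class (\<lambda>n. Z n + W n)" by (rule loc_class_eqI)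
  then show ?thesis
    using Z(1) W(1) by (simp add: localization_def hilbert_completion_def vadd_quotient)
      (simp add: loc_class_def)
qed

lemma vscale_localization:
  assumes X: "s_Cauchy X"
  shows "vscale (localization ip f) c (loc_class X) = loc_class (\<lambda>n. c *\<^sub>C X n)"
proof -
  obtain Z where Z: "seq_rep (loc_class X) = (\<lambda>n. coset (Z n))" "(\<lambda>n. sn (X n - Z n)) \<longlonglongrightarrow> 0"
    using seq_rep_loc_class[OF X] by blast
  have "(\<lambda>n. sn (c *\<^sub>C X n - c *\<^sub>C Z n)) \<longlonglongrightarrow> 0"
    using tendsto_mult_right_zero[OF Z(2), of "cmod c"] by (simp add: sn_scaleC flip: scaleC_diff_right)
  then have "loc_class (\<lambda>n. c *\<^sub>C X n) = loc_class (\<lambda>n. c *\<^sub>C Z n)" by (rule loc_class_eqI)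
  then show ?thesis
    using Z(1) by (simp add: localization_def hilbert_completion_def vscale_quotient)
      (simp add: loc_class_def)
qed

lemma s_Cauchy_diff:
  assumes X: "s_Cauchy X" and Y: "s_Cauchy Y"
  shows "s_Cauchy (\<lambda>n. X n - Y n)"
  unfolding s_Cauchy_def
proof (intro allI impI)
  fix e :: real assume "0 < e"
  then have e: "0 < e / 2" by simp
  obtain M where M: "\<And>m n. m \<ge> M \<Longrightarrow> n \<ge> M \<Longrightarrow> sn (X m - X n) < e / 2"
    using X e unfolding s_Cauchy_def by blast
  obtain N where N: "\<And>m n. m \<ge> N \<Longrightarrow> n \<ge> N \<Longrightarrow> sn (Y m - Y n) < e / 2"
    using Y e unfolding s_Cauchy_def by blast
  have "sn (X m - Y m - (X n - Y n)) < e" if "m \<ge> max M N" "n \<ge> max M N" for m n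
  proof -
    have "X m - Y m - (X n - Y n) = (X m - X n) + (Y n - Y m)" by simp
    then have "sn (X m - Y m - (X n - Y n)) \<le> sn (X m - X n) + sn (Y n - Y m)"
      by (metis sn_triangle)
    then show ?thesis using M[of m n] N[of n m] that by simp
  qed
  then show "\<exists>M. \<forall>m\<ge>M. \<forall>n\<ge>M. sn (X m - Y m - (X n - Y n)) < e" by blast
qed

lemma vdist_localization:
  assumes X: "s_Cauchy X" and Y: "s_Cauchy Y"
  shows "(\<lambda>n. sn (X n - Y n)) \<longlonglongrightarrow> vdist (localization ip f) (loc_class X) (loc_class Y)"
proof -
  have Y': "s_Cauchy (\<lambda>n. - Y n)" using s_Cauchy_diff[OF s_Cauchy_const[of 0] Y] by simp
  have D: "s_Cauchy (\<lambda>n. X n - Y n)" by (rule s_Cauchy_diff[OF X Y])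
  have "vdist (localization ip f) (loc_class X) (loc_class Y)
      = sqrt (Re (vinner (localization ip f) (loc_class (\<lambda>n. X n - Y n)) (loc_class (\<lambda>n. X n - Y n))))"
    by (simp add: vdist_def Let_def vscale_localization[OF Y] vadd_localization[OF X Y'])
  moreover have "(\<lambda>n. sqrt (Re (f (ip (X n - Y n) (X n - Y n))))) \<longlonglongrightarrow>
      sqrt (Re (vinner (localization ip f) (loc_class (\<lambda>n. X n - Y n)) (loc_class (\<lambda>n. X n - Y n))))"
    by (intro tendsto_intros vinner_localization D)
  ultimately show ?thesis by (simp add: sn_def)
qed

definition limit_near :: "(nat \<Rightarrow> 'e) \<Rightarrow> 'e set \<Rightarrow> bool"
  where "limit_near X M \<longleftrightarrow> (\<forall>e>0. \<exists>m\<in>M. \<forall>\<^sub>F n in sequentially. sn (X n - m) < e)"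

definition limit_orthogonal :: "(nat \<Rightarrow> 'e) \<Rightarrow> 'e set \<Rightarrow> bool"
  where "limit_orthogonal X M \<longleftrightarrow> (\<forall>m\<in>M. (\<lambda>n. f (ip (X n) m)) \<longlonglongrightarrow> 0)"

lemma loc_class_in_localized_submodule:
  assumes X: "s_Cauchy X"
  shows "loc_class X \<in> localized_submodule ip f M \<longleftrightarrow> limit_near X M"
proof -
  let ?d = "\<lambda>m. vdist (localization ip f) (loc_class X) (loc_class (\<lambda>_. m))"
  have d: "(\<lambda>n. sn (X n - m)) \<longlonglongrightarrow> ?d m" for m by (rule vdist_localization[OF X s_Cauchy_const])
  have "loc_class X \<in> localized_submodule ip f M \<longleftrightarrow> (\<forall>e>0. \<exists>m\<in>M. ?d m < e)"
    using X by (auto simp: localized_submodule_def vclosure_def vecs_localization completion_embed_coset)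
  also have "\<dots> \<longleftrightarrow> limit_near X M"
  proof
    assume *: "\<forall>e>0. \<exists>m\<in>M. ?d m < e"
    show "limit_near X M"
      unfolding limit_near_def using * order_tendstoD(2)[OF d] by blast
  next
    assume *: "limit_near X M"
    show "\<forall>e>0. \<exists>m\<in>M. ?d m < e"
    proof (intro allI impI)
      fix e :: real assume "0 < e"
      then obtain m where m: "m \<in> M" "\<forall>\<^sub>F n in sequentially. sn (X n - m) < e / 2"
        using * unfolding limit_near_def by (meson half_gt_zero)
      have "?d m \<le> e / 2"
        by (rule tendsto_upperbound[OF d eventually_mono[OF m(2)]]) auto
      then show "\<exists>m\<in>M. ?d m < e" using m(1) \<open>0 < e\<close> by (intro bexI[of _ m]) auto
    qed
  qed
  finally show ?thesis .
qed

lemma loc_class_in_vperp: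
  assumes X: "s_Cauchy X"
  shows "loc_class X \<in> vperp (localization ip f) (localized_submodule ip f M) \<longleftrightarrow> limit_orthogonal X M"
proof
  assume *: "loc_class X \<in> vperp (localization ip f) (localized_submodule ip f M)"
  show "limit_orthogonal X M"
    unfolding limit_orthogonal_def
  proof
    fix m assume "m \<in> M"
    then have "limit_near (\<lambda>_. m) M" unfolding limit_near_def by (auto intro!: bexI[of _ m])
    then have "loc_class (\<lambda>_. m) \<in> localized_submodule ip f M"
      by (simp add: loc_class_in_localized_submodule s_Cauchy_const)
    then have "vinner (localization ip f) (loc_class X) (loc_class (\<lambda>_. m)) = 0"
      using * by (simp add: vperp_def)
    then show "(\<lambda>n. f (ip (X n) m)) \<longlonglongrightarrow> 0"
      using vinner_localization[OF X s_Cauchy_const[of m]] by simp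
  qed
next
  assume *: "limit_orthogonal X M"
  obtain B where B: "0 \<le> B" "\<And>n. sn (X n) \<le> B" using s_Cauchy_bounded[OF X] by blast
  have "vinner (localization ip f) (loc_class X) v = 0" if v: "v \<in> localized_submodule ip f M" for v
  proof -
    obtain Y where Y: "v = loc_class Y" "s_Cauchy Y"
      using v by (auto simp: localized_submodule_def vclosure_def vecs_localization)
    then have near: "limit_near Y M" using v loc_class_in_localized_submodule by simp
    let ?l = "vinner (localization ip f) (loc_class X) v"
    have l: "(\<lambda>n. f (ip (X n) (Y n))) \<longlonglongrightarrow> ?l" unfolding Y(1) by (rule vinner_localization[OF X Y(2)])
    have "cmod ?l \<le> 0 + e" if e: "0 < e" for e
    proof -
      have B1: "0 < B + 1" using B by simp
      then have "0 < e / (B + 1)" using e by simp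
      then obtain m where m: "m \<in> M" "\<forall>\<^sub>F n in sequentially. sn (Y n - m) < e / (B + 1)"
        using near unfolding limit_near_def by blast
      have "(\<lambda>n. f (ip (X n) m)) \<longlonglongrightarrow> 0" using * m(1) by (simp add: limit_orthogonal_def)
      from tendsto_diff[OF l this] have "(\<lambda>n. f (ip (X n) (Y n - m))) \<longlonglongrightarrow> ?l" by (simp add: diff_right)
      then have "(\<lambda>n. cmod (f (ip (X n) (Y n - m)))) \<longlonglongrightarrow> cmod ?l" by (rule tendsto_norm)
      moreover have "\<forall>\<^sub>F n in sequentially. cmod (f (ip (X n) (Y n - m))) \<le> e"
        using m(2)
      proof eventually_elim
        case (elim n)
        have "cmod (f (ip (X n) (Y n - m))) \<le> sn (X n) * sn (Y n - m)" by (rule cauchy_schwarz)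
        also have "\<dots> \<le> (B + 1) * (e / (B + 1))"
          using elim B(1) B(2)[of n] by (intro mult_mono) auto
        finally show ?case using B1 by simp
      qed
      ultimately show ?thesis by (intro tendsto_upperbound) auto
    qed
    then show ?thesis using field_le_epsilon[of "cmod ?l" 0] by simp
  qed
  then show "loc_class X \<in> vperp (localization ip f) (localized_submodule ip f M)"
    using X by (auto simp: vperp_def vecs_localization)
qed

lemma localized_eq_iff:
  "localized_submodule ip f M = vperp (localization ip f) (localized_submodule ip f S) \<inter>
      vperp (localization ip f) (localized_submodule ip f T) \<longleftrightarrow>
    (\<forall>X. s_Cauchy X \<longrightarrow> (limit_near X M \<longleftrightarrow> limit_orthogonal X S \<and> limit_orthogonal X T))"
proof -
  have split: "A = B \<inter> C \<longleftrightarrow> (\<forall>X. s_Cauchy X \<longrightarrow> (loc_class X \<in> A \<longleftrightarrow> loc_class X \<in> B \<and> loc_class X \<in> C))"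
    if "A \<subseteq> loc_class ` {X. s_Cauchy X}" "B \<subseteq> loc_class ` {X. s_Cauchy X}" for A B C
    using that by blast
  have "localized_submodule ip f M \<subseteq> loc_class ` {X. s_Cauchy X}"
    "vperp (localization ip f) (localized_submodule ip f S) \<subseteq> loc_class ` {X. s_Cauchy X}"
    by (auto simp: localized_submodule_def vclosure_def vperp_def vecs_localization)
  from split[OF this] show ?thesis
    by (simp only: loc_class_in_localized_submodule loc_class_in_vperp cong: imp_cong)
qed

end

section \<open>Concordant pairs\<close>

context hilbert_cstar_module
begin

lemma orthogonal_to_closure_perps:
  assumes x: "x \<in> H \<inter> K" and y: "y \<in> closure (module_perp ip H + module_perp ip K)"
  shows "ip x y = 0"
proof -
  have sub: "module_perp ip H + module_perp ip K \<subseteq> {y. ip x y = 0}"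
  proof
    fix y assume "y \<in> module_perp ip H + module_perp ip K"
    then obtain h k where y: "y = h + k" "ip h x = 0" "ip k x = 0"
      using x by (auto simp: set_plus_def module_perp_def)
    then have "ip x h = 0" "ip x k = 0" using ip_star[of x h] ip_star[of x k] by simp_all
    then show "y \<in> {y. ip x y = 0}" using y(1) by (simp add: ip_add_right)
  qed
  have "closed {y. ip x y = 0}"
    by (intro closed_Collect_eq continuous_on_const linear_continuous_on bounded_linear_ip_right)
  from closure_minimal[OF sub this] show ?thesis using y by blast
qed

lemma closed_submodule_closure:
  assumes "0 \<in> S" "\<And>x y. x \<in> S \<Longrightarrow> y \<in> S \<Longrightarrow> x + y \<in> S"
    "\<And>c x. x \<in> S \<Longrightarrow> c *\<^sub>C x \<in> S" "\<And>a x. x \<in> S \<Longrightarrow> act x a \<in> S"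
  shows "closed_submodule act (closure S)"
  unfolding closed_submodule_def
proof (intro conjI ballI allI)
  show "0 \<in> closure S" using assms(1) closure_subset by blast
  show "closed (closure S)" by simp
next
  fix x y assume "x \<in> closure S" "y \<in> closure S"
  then obtain X Y where "\<And>n. X n \<in> S" "X \<longlonglongrightarrow> x" "\<And>n. Y n \<in> S" "Y \<longlonglongrightarrow> y"
    unfolding closure_sequential by blast
  then show "x + y \<in> closure S"
    unfolding closure_sequential using assms(2) by (intro exI[of _ "\<lambda>n. X n + Y n"]) (auto intro: tendsto_add)
next
  fix x c assume "x \<in> closure S"
  then obtain X where X: "\<And>n. X n \<in> S" "X \<longlonglongrightarrow> x" unfolding closure_sequential by blast
  have "bounded_linear (\<lambda>x::'e. c *\<^sub>C x)"
    by (rule bounded_linear_intro[of _ "cmod c"]) (simp_all add: scaleC_add_right norm_scaleC scaleR_scaleC)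
  then have "(\<lambda>n. c *\<^sub>C X n) \<longlonglongrightarrow> c *\<^sub>C x" using X(2) by (rule bounded_linear.tendsto)
  then show "c *\<^sub>C x \<in> closure S"
    unfolding closure_sequential using assms(3) X(1) by (intro exI[of _ "\<lambda>n. c *\<^sub>C X n"]) simp
next
  fix x a assume "x \<in> closure S"
  then obtain X where X: "\<And>n. X n \<in> S" "X \<longlonglongrightarrow> x" unfolding closure_sequential by blast
  have "(\<lambda>n. act (X n) a) \<longlonglongrightarrow> act x a"
    using bounded_linear_act_left X(2) by (rule bounded_linear.tendsto)
  then show "act x a \<in> closure S"
    unfolding closure_sequential using assms(4) X(1) by (intro exI[of _ "\<lambda>n. act (X n) a"]) simp
qed

lemma closed_submodule_closure_perps:
  "closed_submodule act (closure (module_perp ip H + module_perp ip K))"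
proof (rule closed_submodule_closure)
  have z: "0 \<in> module_perp ip S" for S by (simp add: module_perp_def)
  have a: "x + y \<in> module_perp ip S" if "x \<in> module_perp ip S" "y \<in> module_perp ip S" for x y S
    using that by (simp add: module_perp_def ip_add_left)
  have c: "c *\<^sub>C x \<in> module_perp ip S" if "x \<in> module_perp ip S" for x c S
    using that by (simp add: module_perp_def ip_scaleC_left)
  have m: "act x b \<in> module_perp ip S" if "x \<in> module_perp ip S" for x b S
    using that by (simp add: module_perp_def ip_act_left)
  show "0 \<in> module_perp ip H + module_perp ip K"
    using set_plus_intro[OF z z] by simp
  fix x assume "x \<in> module_perp ip H + module_perp ip K"
  then obtain h k where x: "x = h + k" "h \<in> module_perp ip H" "k \<in> module_perp ip K"
    by (auto elim: set_plus_elim)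
  show "c *\<^sub>C x \<in> module_perp ip H + module_perp ip K" for c
    unfolding x(1) scaleC_add_right by (intro set_plus_intro c x)
  show "act x b \<in> module_perp ip H + module_perp ip K" for b
    unfolding x(1) act_add_left by (intro set_plus_intro m x)
  fix y assume "y \<in> module_perp ip H + module_perp ip K"
  then obtain h' k' where y: "y = h' + k'" "h' \<in> module_perp ip H" "k' \<in> module_perp ip K"
    by (auto elim: set_plus_elim)
  have "(h + h') + (k + k') \<in> module_perp ip H + module_perp ip K"
    by (intro set_plus_intro a x y)
  then show "x + y \<in> module_perp ip H + module_perp ip K" by (simp add: x y algebra_simps)
qed

lemma norm_le_norm_orthogonal_sum:
  assumes "ip x y = 0"
  shows "norm x \<le> norm (x + y)"
proof -
  have "ip y x = 0" using ip_star[of y x] assms by simp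
  then have "ip (x + y) (x + y) = ip x x + ip y y" using assms by (simp add: ip_add_left ip_add_right)
  then have "norm (ip x x) \<le> norm (ip (x + y) (x + y))"
    using cstar_positive_norm_mono[OF ip_positive[of x] ip_positive[of y]] by simp
  then show ?thesis by (simp add: norm_eq_sqrt_ip)
qed

text \<open>
  Orthogonality gives \<open>norm x \<le> norm (x + y)\<close>, so the components of a convergent sequence
  converge separately.
\<close>

lemma closed_submodule_orthogonal_sum:
  assumes M: "closed_submodule act M" and N: "closed_submodule act N"
    and orth: "\<And>x y. x \<in> M \<Longrightarrow> y \<in> N \<Longrightarrow> ip x y = 0"
  shows "closed_submodule act (M + N)"
proof -
  note Md = M[unfolded closed_submodule_def] and Nd = N[unfolded closed_submodule_def]
  have neg: "x - y \<in> S" if "closed_submodule act S" "x \<in> S" "y \<in> S" for S x y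
  proof -
    have "(-1) *\<^sub>C y \<in> S" using that unfolding closed_submodule_def by blast
    then have "x + - y \<in> S" using that unfolding closed_submodule_def scaleC_minus_one by blast
    then show ?thesis by simp
  qed
  have "closed (M + N)"
    unfolding closed_sequential_limits
  proof (intro allI impI, elim conjE)
    fix X l assume X: "\<forall>n. X n \<in> M + N" and lim: "X \<longlonglongrightarrow> l"
    then have "\<forall>n. \<exists>a b. a \<in> M \<and> b \<in> N \<and> X n = a + b" by (meson set_plus_elim)
    then obtain A B where AB: "\<And>n. A n \<in> M" "\<And>n. B n \<in> N" "\<And>n. X n = A n + B n" by metis
    have le: "norm (A m - A n) \<le> norm (X m - X n)" for m n
    proof -
      have "norm (A m - A n) \<le> norm ((A m - A n) + (B m - B n))"
        using AB neg[OF M] neg[OF N] by (intro norm_le_norm_orthogonal_sum orth) auto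
      then show ?thesis by (simp add: AB(3) algebra_simps)
    qed
    have "Cauchy A"
      unfolding Cauchy_def dist_norm
      using LIMSEQ_imp_Cauchy[OF lim] le unfolding Cauchy_def dist_norm by (meson le_less_trans)
    then obtain a where a: "A \<longlonglongrightarrow> a" using Cauchy_convergent convergent_def by blast
    have "(\<lambda>n. X n - A n) \<longlonglongrightarrow> l - a" by (intro tendsto_diff lim a)
    then have b: "B \<longlonglongrightarrow> l - a" by (simp add: AB(3))
    have "a \<in> M" "l - a \<in> N"
      using closed_sequentially[of M A a] closed_sequentially[of N B "l - a"] a b AB Md Nd by auto
    then have "a + (l - a) \<in> M + N" by (rule set_plus_intro)
    then show "l \<in> M + N" by simp
  qed
  moreover have "0 \<in> M + N" using set_plus_intro[of 0 M 0 N] Md Nd by simp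
  moreover have "x + y \<in> M + N" if x: "x \<in> M + N" and y: "y \<in> M + N" for x y
  proof -
    obtain a b c d where *: "x = a + b" "a \<in> M" "b \<in> N" "y = c + d" "c \<in> M" "d \<in> N"
      using x y by (meson set_plus_elim)
    then have "(a + c) + (b + d) \<in> M + N" using Md Nd by (intro set_plus_intro) auto
    then show ?thesis by (simp add: * algebra_simps)
  qed
  moreover have "c *\<^sub>C x \<in> M + N" if x: "x \<in> M + N" for c x
  proof -
    obtain a b where *: "x = a + b" "a \<in> M" "b \<in> N" using x by (meson set_plus_elim)
    then show ?thesis unfolding *(1) scaleC_add_right using Md Nd by (intro set_plus_intro) auto
  qed
  moreover have "act x e \<in> M + N" if x: "x \<in> M + N" for e x
  proof -
    obtain a b where *: "x = a + b" "a \<in> M" "b \<in> N" using x by (meson set_plus_elim)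
    then show ?thesis unfolding *(1) act_add_left using Md Nd by (intro set_plus_intro) auto
  qed
  ultimately show ?thesis unfolding closed_submodule_def by blast
qed

end

text \<open>
  A limit form of the fact that \<open>\<langle>z, y\<rangle> = \<langle>y, y\<rangle>\<close> bounds \<open>y\<close> by the distance of \<open>z\<close> from the
  complement of \<open>y\<close>.
\<close>

lemma (in localized_module) sn_le_of_limit_orthogonal:
  assumes z: "f (ip z y) = f (ip y y)" and near: "\<forall>\<^sub>F n in sequentially. sn (X n - z) \<le> d"
    and orth: "(\<lambda>n. f (ip (X n) y)) \<longlonglongrightarrow> 0" and d: "0 \<le> d"
  shows "sn y \<le> d"
proof -
  have "sn y * sn y \<le> 0 + d * sn y"
  proof (rule tendsto_lowerbound)
    show "(\<lambda>n. cmod (f (ip (X n) y)) + d * sn y) \<longlonglongrightarrow> 0 + d * sn y"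
      using tendsto_norm_zero[OF orth] by (intro tendsto_intros)
    show "\<forall>\<^sub>F n in sequentially. sn y * sn y \<le> cmod (f (ip (X n) y)) + d * sn y"
      using near
    proof eventually_elim
      case (elim n)
      have "sn y * sn y = cmod (f (ip (X n) y) - f (ip (X n - z) y))"
        by (simp add: diff_left z norm_self power2_eq_square)
      also have "\<dots> \<le> cmod (f (ip (X n) y)) + cmod (f (ip (X n - z) y))" by (rule norm_triangle_ineq4)
      also have "cmod (f (ip (X n - z) y)) \<le> sn (X n - z) * sn y" by (rule cauchy_schwarz)
      also have "\<dots> \<le> d * sn y" using elim by (intro mult_right_mono) auto
      finally show ?case by simp
    qed
  qed simp
  then show ?thesis using d sn_nonneg[of y] by (cases "sn y = 0") (auto simp: mult_le_cancel_right)
qed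

text \<open>
  Suppose that the Cauchy sequence \<open>X\<close> is asymptotically orthogonal to both complements, hence to
  the closure of their sum. Decompose a late member as \<open>X k = m + n\<close>. Then \<open>n\<close> is orthogonal to
  \<open>m\<close> and almost orthogonal to the later members of \<open>X\<close>, so it is small and \<open>X\<close> is close to
  \<open>m \<in> H \<inter> K\<close>.
\<close>

lemma (in localized_module) limit_near_iff_limit_orthogonal:
  assumes con: "concordant ip H K" and C: "\<And>a. cmod (f a) \<le> C * norm a" "0 \<le> C" and X: "s_Cauchy X"
  shows "limit_near X (H \<inter> K) \<longleftrightarrow>
    limit_orthogonal X (module_perp ip H) \<and> limit_orthogonal X (module_perp ip K)"
proof
  assume near: "limit_near X (H \<inter> K)"
  have "(\<lambda>n. f (ip (X n) h)) \<longlonglongrightarrow> 0" if h: "\<And>m. m \<in> H \<inter> K \<Longrightarrow> ip h m = 0" for h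
  proof (rule tendstoI)
    fix e :: real assume e: "0 < e"
    have p: "0 < sn h + 1" using sn_nonneg[of h] by linarith
    then have "0 < e / (sn h + 1)" using e by simp
    then obtain m where m: "m \<in> H \<inter> K" "\<forall>\<^sub>F n in sequentially. sn (X n - m) < e / (sn h + 1)"
      using near unfolding limit_near_def by blast
    have "ip m h = 0" using h[OF m(1)] ip_star[of m h] by simp
    then have eq: "f (ip (X n) h) = f (ip (X n - m) h)" for n by (simp add: ip_diff_left)
    show "\<forall>\<^sub>F n in sequentially. dist (f (ip (X n) h)) 0 < e"
      using m(2)
    proof eventually_elim
      case (elim n)
      have "cmod (f (ip (X n) h)) \<le> sn (X n - m) * sn h" unfolding eq by (rule cauchy_schwarz)
      also have "\<dots> \<le> e / (sn h + 1) * sn h" using elim by (intro mult_right_mono) auto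
      also have "\<dots> < e" using p e by (simp add: field_simps)
      finally show ?case by simp
    qed
  qed
  then show "limit_orthogonal X (module_perp ip H) \<and> limit_orthogonal X (module_perp ip K)"
    by (auto simp: limit_orthogonal_def module_perp_def)
next
  assume orth: "limit_orthogonal X (module_perp ip H) \<and> limit_orthogonal X (module_perp ip K)"
  let ?N = "closure (module_perp ip H + module_perp ip K)"
  obtain B where B: "0 \<le> B" "\<And>n. sn (X n) \<le> B" using s_Cauchy_bounded[OF X] by blast
  have orthN: "(\<lambda>j. f (ip (X j) y)) \<longlonglongrightarrow> 0" if y: "y \<in> ?N" for y
  proof (rule tendstoI)
    fix e :: real assume e: "0 < e"
    define D where "D = B * sqrt C + 1"
    have D: "0 < D" using B(1) C(2) by (simp add: D_def add_nonneg_pos)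
    obtain z where z: "z \<in> module_perp ip H + module_perp ip K" "dist z y < e / 2 / D"
      using y e D closure_approachable[of y] by (meson divide_pos_pos half_gt_zero)
    obtain h k where hk: "z = h + k" "h \<in> module_perp ip H" "k \<in> module_perp ip K"
      using z(1) by (auto elim: set_plus_elim)
    have "(\<lambda>j. f (ip (X j) h) + f (ip (X j) k)) \<longlonglongrightarrow> 0"
      using orth hk by (intro tendsto_add_zero) (auto simp: limit_orthogonal_def)
    then have "\<forall>\<^sub>F j in sequentially. dist (f (ip (X j) z)) 0 < e / 2"
      unfolding hk(1) add_right using e by (intro tendstoD) auto
    then show "\<forall>\<^sub>F j in sequentially. dist (f (ip (X j) y)) 0 < e"
    proof eventually_elim
      case (elim j)
      have "cmod (f (ip (X j) (y - z))) \<le> sn (X j) * sn (y - z)" by (rule cauchy_schwarz)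
      also have "\<dots> \<le> B * (sqrt C * norm (y - z))"
        using B sn_module_le[OF positive C(1), of "y - z"] by (intro mult_mono) auto
      also have "\<dots> \<le> D * norm (y - z)" by (simp add: D_def algebra_simps)
      also have "\<dots> \<le> D * (e / 2 / D)"
        using z(2) D by (intro mult_left_mono) (auto simp: dist_norm norm_minus_commute)
      finally have "cmod (f (ip (X j) (y - z))) \<le> e / 2" using D by simp
      then show ?case
        using elim norm_triangle_ineq[of "f (ip (X j) z)" "f (ip (X j) (y - z))"]
        by (simp add: diff_right)
    qed
  qed
  show "limit_near X (H \<inter> K)"
    unfolding limit_near_def
  proof (intro allI impI)
    fix e :: real assume "0 < e"
    then have e2: "0 < e / 2" by simp
    obtain k where k: "\<And>j. j \<ge> k \<Longrightarrow> sn (X j - X k) < e / 2"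
      using X e2 unfolding s_Cauchy_def by blast
    have "X k \<in> (H \<inter> K) + ?N" using con by (simp add: concordant_def orthogonal_decomposition_def)
    then obtain m n where mn: "X k = m + n" "m \<in> H \<inter> K" "n \<in> ?N" by (auto elim: set_plus_elim)
    have "ip m n = 0" using con mn by (auto simp: concordant_def orthogonal_decomposition_def)
    then have "f (ip (X k) n) = f (ip n n)" by (simp add: mn(1) ip_add_left)
    then have "sn n \<le> e / 2"
      using e2 k orthN[OF mn(3)] sn_le_of_limit_orthogonal[of "X k" n X "e / 2"]
      by (auto simp: eventually_sequentially intro: less_imp_le)
    then have "sn (X j - m) < e" if "j \<ge> k" for j
      using sn_triangle_diff[of "X j" m "X k"] k[OF that] by (simp add: mn(1))
    then show "\<exists>m\<in>H \<inter> K. \<forall>\<^sub>F n in sequentially. sn (X n - m) < e"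
      using mn(2) by (auto simp: eventually_sequentially)
  qed
qed

text \<open>
  The sequence that represents \<open>\<psi>\<close> is asymptotically orthogonal to \<open>S\<close> and \<open>T\<close>, so it is close to
  elements of \<open>M\<close>. It is also asymptotically orthogonal to \<open>M\<close>, so its seminorm tends to \<open>0\<close>.
\<close>

lemma (in localized_module) functional_vanishes:
  assumes near: "\<And>X. s_Cauchy X \<Longrightarrow> limit_orthogonal X S \<Longrightarrow> limit_orthogonal X T \<Longrightarrow> limit_near X M"
    and \<psi>: "\<And>x y. \<psi> (x + y) = \<psi> x + \<psi> y" "\<And>c y. \<psi> (c *\<^sub>C y) = c * \<psi> y"
    and bound: "\<And>x. (cmod (\<psi> x))\<^sup>2 \<le> t * Re (f (ip x x))" and t: "0 \<le> t"
    and zero: "\<And>y. y \<in> M \<union> S \<union> T \<Longrightarrow> \<psi> y = 0"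
  shows "\<psi> x = 0"
proof -
  have "cmod (\<psi> y) \<le> sqrt t * sn y" for y
    using real_sqrt_le_mono[OF bound[of y]] by (simp add: real_sqrt_mult sn_def)
  then obtain X where X\<psi>: "\<And>y. (\<lambda>n. f (ip (X n) y)) \<longlonglongrightarrow> \<psi> y" and X: "s_Cauchy X"
    using riesz_sequence[OF \<psi>, of "sqrt t"] t by (metis real_sqrt_ge_zero)
  have "limit_orthogonal X S" "limit_orthogonal X T"
    unfolding limit_orthogonal_def using X\<psi> zero by (metis UnI1 UnI2)+
  then have nr: "limit_near X M" using near X by blast
  have "cmod (\<psi> x) \<le> 0 + e" if e: "0 < e" for e
  proof -
    define D where "D = 2 * sn x + 1"
    have D: "0 < D" using sn_nonneg[of x] by (simp add: D_def add_nonneg_pos)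
    then have eD: "0 < e / D" using e by simp
    obtain m where m: "m \<in> M" "\<forall>\<^sub>F n in sequentially. sn (X n - m) < e / D"
      using nr eD unfolding limit_near_def by blast
    have snm: "sn m \<le> e / D"
      using X\<psi>[of m] zero[of m] m eD
      by (intro sn_le_of_limit_orthogonal[OF refl]) (auto elim: eventually_mono)
    have "cmod (\<psi> x) \<le> 2 * (e / D) * sn x"
    proof (rule tendsto_upperbound[OF tendsto_norm[OF X\<psi>[of x]]])
      show "\<forall>\<^sub>F n in sequentially. cmod (f (ip (X n) x)) \<le> 2 * (e / D) * sn x"
        using m(2)
      proof eventually_elim
        case (elim n)
        have "sn (X n) \<le> sn (X n - m) + sn m" using sn_triangle[of "X n - m" m] by simp
        then have "sn (X n) \<le> 2 * (e / D)" using elim snm by linarith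
        then have "sn (X n) * sn x \<le> 2 * (e / D) * sn x" by (rule mult_right_mono) simp
        then show ?case using cauchy_schwarz[of "X n" x] by linarith
      qed
    qed simp
    also have "\<dots> \<le> e" using e D by (simp add: D_def field_simps)
    finally show ?thesis by simp
  qed
  then show ?thesis using field_le_epsilon[of "cmod (\<psi> x)" 0] by simp
qed

theorem theorem3p5:
  fixes act :: "'e::complex_banach \<Rightarrow> 'a::cstar_algebra \<Rightarrow> 'e"
    and ip :: "'e \<Rightarrow> 'e \<Rightarrow> 'a"
    and H K :: "'e set"
  assumes "hilbert_cstar_module act ip"
    and "closed_submodule act H"
    and "closed_submodule act K"
  shows "(concordant ip H K \<longleftrightarrow>
      (\<forall>f\<in>states. localized_submodule ip (blinfun_apply f) (H \<inter> K) =
        vperp (localization ip (blinfun_apply f))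
          (localized_submodule ip (blinfun_apply f) (module_perp ip H)) \<inter>
        vperp (localization ip (blinfun_apply f))
          (localized_submodule ip (blinfun_apply f) (module_perp ip K)))) \<and>
    (concordant ip H K \<longleftrightarrow>
      (\<forall>f\<in>pure_states. localized_submodule ip (blinfun_apply f) (H \<inter> K) =
        vperp (localization ip (blinfun_apply f))
          (localized_submodule ip (blinfun_apply f) (module_perp ip H)) \<inter>
        vperp (localization ip (blinfun_apply f))
          (localized_submodule ip (blinfun_apply f) (module_perp ip K))))"
proof -
  interpret hilbert_cstar_module act ip by fact
  let ?eq = "\<lambda>f. localized_submodule ip (blinfun_apply f) (H \<inter> K) =
        vperp (localization ip (blinfun_apply f))
          (localized_submodule ip (blinfun_apply f) (module_perp ip H)) \<inter>
        vperp (localization ip (blinfun_apply f))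
          (localized_submodule ip (blinfun_apply f) (module_perp ip K))"
  have all: "?eq f" if con: "concordant ip H K" and f: "f \<in> states" for f
  proof -
    interpret L: localized_module act ip "blinfun_apply f"
      by unfold_locales (use f in \<open>simp add: states_def\<close>)
    have "cmod (blinfun_apply f a) \<le> norm f * norm a" for a by (rule norm_blinfun)
    then show ?thesis
      unfolding L.localized_eq_iff using L.limit_near_iff_limit_orthogonal[OF con, of "norm f"] by simp
  qed
  have pure: "pure_states \<subseteq> (states :: ('a \<Rightarrow>\<^sub>L complex) set)"
    by (auto simp: pure_states_def extreme_point_of_def)
  let ?N = "closure (module_perp ip H + module_perp ip K)"
  have conc: "concordant ip H K" if eq: "\<forall>f\<in>pure_states. ?eq f"
  proof -
    have M: "closed_submodule act (H \<inter> K)"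
      using assms(2,3) unfolding closed_submodule_def by (simp add: closed_Int)
    have orth: "ip x y = 0" if "x \<in> H \<inter> K" "y \<in> ?N" for x y
      using orthogonal_to_closure_perps that .
    have L: "closed_submodule act ((H \<inter> K) + ?N)"
      by (rule closed_submodule_orthogonal_sum[OF M closed_submodule_closure_perps orth])
    have N0: "0 \<in> ?N" and M0: "0 \<in> H \<inter> K"
      using closed_submodule_closure_perps[of H K] M by (auto simp: closed_submodule_def)
    have P0: "0 \<in> module_perp ip S" for S by (simp add: module_perp_def)
    have sub: "H \<inter> K \<union> module_perp ip H \<union> module_perp ip K \<subseteq> (H \<inter> K) + ?N"
    proof -
      have "x \<in> (H \<inter> K) + ?N" if "x \<in> H \<inter> K" for x using set_plus_intro[OF that N0] by simp
      moreover have "x \<in> (H \<inter> K) + ?N" if "x \<in> ?N" for x using set_plus_intro[OF M0 that] by simp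
      moreover have "module_perp ip H \<subseteq> ?N"
        using set_plus_intro[OF _ P0[of K]] closure_subset by fastforce
      moreover have "module_perp ip K \<subseteq> ?N"
        using set_plus_intro[OF P0[of H]] closure_subset by fastforce
      ultimately show ?thesis by blast
    qed
    have "(H \<inter> K) + ?N = UNIV"
    proof (rule ccontr)
      assume "(H \<inter> K) + ?N \<noteq> UNIV"
      then obtain x0 where x0: "x0 \<notin> (H \<inter> K) + ?N" by blast
      obtain f \<psi> t where f: "f \<in> pure_states" and t: "0 \<le> t"
        and \<psi>: "\<And>x y. \<psi> (x + y) = \<psi> x + \<psi> y" "\<And>c y. \<psi> (c *\<^sub>C y) = c * \<psi> y"
        "\<And>x. (cmod (\<psi> x))\<^sup>2 \<le> t * Re (blinfun_apply f (ip x x))"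
        "\<And>y. y \<in> (H \<inter> K) + ?N \<Longrightarrow> \<psi> y = 0" "\<psi> x0 \<noteq> 0"
        by (rule ex_separating_pure_state[OF L x0]) (rule that)
      interpret L: localized_module act ip "blinfun_apply f"
        by unfold_locales (use f pure in \<open>auto simp: states_def\<close>)
      have "?eq f" using eq f by blast
      then have near: "L.limit_near X (H \<inter> K)"
        if "L.s_Cauchy X" "L.limit_orthogonal X (module_perp ip H)" "L.limit_orthogonal X (module_perp ip K)"
        for X unfolding L.localized_eq_iff using that by blast
      have "\<psi> x0 = 0"
      proof (rule L.functional_vanishes[OF near \<psi>(1-3) t])
        show "\<psi> y = 0" if "y \<in> H \<inter> K \<union> module_perp ip H \<union> module_perp ip K" for y
          using \<psi>(4) sub that by blast
      qed
      then show False using \<psi>(5) by simp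
    qed
    then show ?thesis using orth by (simp add: concordant_def orthogonal_decomposition_def)
  qed
  show ?thesis using all conc pure by blast
qed

end
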